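(* Let $m\ge 2$, $\mathfrak g=\mathfrak{gl}(m)$ and $\eta=\epsilon_1-\epsilon_m$. Let $\lambda\in\mathfrak h^*$, let $v$ be a highest weight vector of weight $\lambda$ in the Verma module $M(\lambda)$, and set $$\Theta_\eta=\sum_{J\in\mathbb I} f_J H_J .$$ Then $e_{\alpha_k}\Theta_\eta v=0$ for all $1\le k\le m-2$. If moreover $(\lambda+\rho,\eta)=1$, then $\Theta_\eta v$ is a $\mathfrak g$-highest weight vector; and hence $\Theta_\eta$ is a Šapovalov element for the pair $(\eta,1)$.
   Context: Ground field $\mathbb C$. $e_{i,j}$ are the matrix units of $\mathfrak g=\mathfrak{gl}(m)$; $\mathfrak h$ is the diagonal subalgebra, $\epsilon_i\in\mathfrak h^*$ with $\epsilon_i(e_{j,j})=\delta_{ij}$, and $(\epsilon_i,\epsilon_j)=\delta_{ij}$. For $\alpha\in\mathfrak h^*$, $h_\alpha\in\mathfrak h$ is the element with $\beta(h_\alpha)=(\alpha,\beta)$ for all $\beta\in\mathfrak h^*$. Positive roots $\Delta^+=\{\epsilon_i-\epsilon_j: i<j\}$, simple roots $\Pi=\{\alpha_i=\epsilon_i-\epsilon_{i+1}\}$, $e_{\alpha_i}=e_{i,i+1}$; $\mathfrak n^+$, $\mathfrak n^-$ are the strictly upper, lower triangular matrices, $\mathfrak b^-=\mathfrak h\oplus\mathfrak n^-$; $\rho$ is the half-sum of the positive roots. $M(\lambda)$ is the Verma module with highest weight $\lambda$ with respect to $\mathfrak h\oplus\mathfrak n^+$. Elements $f_J,H_J$: $\mathbb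 I=\{I\subseteq\{1,\dots,m\}: 1,m\in I\}$. If $I=\{i_0>i_1>\dots>i_{s+1}\}$ (with $i_0=m$, $i_{s+1}=1$), then $f_I=e_{i_0,i_1}e_{i_1,i_2}\cdots e_{i_s,i_{s+1}}\in U(\mathfrak n^-)$. For $1\le k\le m-1$ let $\sigma_k=\epsilon_1-\epsilon_{k+1}$ and $h_k=h_{\sigma_k}+(\rho,\sigma_k)-1\in U(\mathfrak h)$. For $I\in\mathbb I$ let $r(I)=\{x-1: x\in\{1,\dots,m\}\setminus I\}$ and $H_I=\prod_{i\in r(I)}h_i$ (empty product $=1$). Šapovalov element for $(\eta,1)$: an element $\theta\in U(\mathfrak b^-)$ of weight $-\eta$ of the form $\theta=\sum_\pi e_{-\pi}H_\pi$ with $H_\pi\in U(\mathfrak h)$, where $\pi$ runs over the partitions of $\eta$ (functions $\pi:\Delta^+\to\mathbb Z_{\ge0}$ with $\sum_\alpha\pi(\alpha)\alpha=\eta$) and $e_{-\pi}$ is the product of the negative root vectors $e_{-\alpha}^{\pi(\alpha)}$ in a fixed order on $\Delta^+$, such that $H_{\pi^0}=1$ for the unique partition $\pi^0$ vanishing off $\Pi$, and $$e_\alpha\theta\in U(\mathfrak g)\bigl(h_\eta+\rho(h_\eta)-(\eta,\eta)/2\bigr)+U(\mathfrak g)\mathfrak n^+\quad\text{for all }\alpha\in\Delta^+.$$ Here the elements $f_J$, $J\in\mathbb I$, are the monomials $e_{-\pi}$ for an order placing $e_{a,b}$ before $e_{c,d}$ when $a>c$. *)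

theory Defs
  imports
    "Jordan_Normal_Form.Matrix"
    "HOL-Library.Poly_Mapping"
    "HOL-Algebra.QuotRing"
    "HOL-Algebra.Generated_Rings"
begin

section \<open>Free associative algebras over the complex numbers\<close>

datatype 'a free_monoid = Free_Monoid (letters: "'a list")

instantiation free_monoid :: (type) monoid_add
begin

definition zero_free_monoid :: "'a free_monoid" where
  "0 = Free_Monoid []"

definition plus_free_monoid :: "'a free_monoid \<Rightarrow> 'a free_monoid \<Rightarrow> 'a free_monoid" where
  "v + w = Free_Monoid (letters v @ letters w)"

instance
  by standard (auto simp: zero_free_monoid_def plus_free_monoid_def)

end

type_synonym 'a free_alg = "'a free_monoid \<Rightarrow>\<^sub>0 complex"

text \<open>
  The free algebra on the set \<open>X\<close>: finitely supported complex-valued functions on the words in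
  \<open>X\<close>, with the convolution product of \<^theory>\<open>HOL-Library.Poly_Mapping\<close>.
\<close>

definition free_algebra :: "'a set \<Rightarrow> 'a free_alg ring" where
  "free_algebra X =
    \<lparr>carrier = {p. \<forall>w\<in>Poly_Mapping.keys p. set (letters w) \<subseteq> X},
     mult = (*), one = 1, zero = 0, add = (+)\<rparr>"

definition free_gen :: "'a \<Rightarrow> 'a free_alg" where
  "free_gen x = Poly_Mapping.single (Free_Monoid [x]) 1"

definition free_scal :: "complex \<Rightarrow> 'a free_alg" where
  "free_scal c = Poly_Mapping.single 0 c"

lemma free_algebra_simps:
  "p \<in> carrier (free_algebra X) \<longleftrightarrow> (\<forall>w\<in>Poly_Mapping.keys p. set (letters w) \<subseteq> X)"
  "p \<otimes>\<^bsub>free_algebra X\<^esub> q = p * q"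
  "p \<oplus>\<^bsub>free_algebra X\<^esub> q = p + q"
  "\<one>\<^bsub>free_algebra X\<^esub> = 1"
  "\<zero>\<^bsub>free_algebra X\<^esub> = 0"
  by (simp_all add: free_algebra_def)

lemma free_algebra_closed:
  "p \<in> carrier (free_algebra X) \<Longrightarrow> q \<in> carrier (free_algebra X)
    \<Longrightarrow> p + q \<in> carrier (free_algebra X)"
  "p \<in> carrier (free_algebra X) \<Longrightarrow> q \<in> carrier (free_algebra X)
    \<Longrightarrow> p * q \<in> carrier (free_algebra X)"
  "p \<in> carrier (free_algebra X) \<Longrightarrow> - p \<in> carrier (free_algebra X)"
  "0 \<in> carrier (free_algebra X)"
  "1 \<in> carrier (free_algebra X)"
  "x \<in> X \<Longrightarrow> free_gen x \<in> carrier (free_algebra X)"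
  "free_scal c \<in> carrier (free_algebra X)"
proof -
  show "p + q \<in> carrier (free_algebra X)"
    if "p \<in> carrier (free_algebra X)" "q \<in> carrier (free_algebra X)"
    using that Poly_Mapping.keys_add[of p q] unfolding free_algebra_simps by blast
  show "p * q \<in> carrier (free_algebra X)"
    if "p \<in> carrier (free_algebra X)" "q \<in> carrier (free_algebra X)"
    using that keys_mult[of p q] unfolding free_algebra_simps
    by (fastforce simp: plus_free_monoid_def)
qed (simp_all add: free_algebra_simps free_gen_def free_scal_def zero_free_monoid_def)

lemma free_algebra_diff_closed:
  "p \<in> carrier (free_algebra X) \<Longrightarrow> q \<in> carrier (free_algebra X)
    \<Longrightarrow> p - q \<in> carrier (free_algebra X)"
  using free_algebra_closed(1)[of p X "- q"] free_algebra_closed(3)[of q X] by simp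

lemma ring_free_algebra: "ring (free_algebra X)"
proof (rule ringI)
  show "abelian_group (free_algebra X)"
  proof (rule abelian_groupI, unfold free_algebra_simps(2-5))
    show "\<exists>y\<in>carrier (free_algebra X). y + p = 0" if "p \<in> carrier (free_algebra X)" for p
      using free_algebra_closed(3)[OF that] by (intro bexI[of _ "- p"]) simp_all
  qed (simp_all add: free_algebra_closed ac_simps)
  show "Group.monoid (free_algebra X)"
    by (rule monoidI, unfold free_algebra_simps(2-5))
      (simp_all add: free_algebra_closed mult.assoc)
qed (simp_all add: free_algebra_simps(2-5) distrib_left distrib_right)


section \<open>The Lie algebra \<open>gl(m)\<close> and its subalgebras\<close>

text \<open>
  The matrices of \<^theory>\<open>Jordan_Normal_Form.Matrix\<close> are indexed from \<open>0\<close>, whereas the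
  indices of \<open>mat_unit m i j\<close>, \<open>eps m i\<close> and of everything built from them run over \<open>{1..m}\<close>.
\<close>

definition gl :: "nat \<Rightarrow> complex mat set" where
  "gl m = carrier_mat m m"

definition lie_bracket :: "complex mat \<Rightarrow> complex mat \<Rightarrow> complex mat" where
  "lie_bracket A B = A * B - B * A"

definition mat_unit :: "nat \<Rightarrow> nat \<Rightarrow> nat \<Rightarrow> complex mat" where
  "mat_unit m i j = mat m m (\<lambda>(a, b). if a + 1 = i \<and> b + 1 = j then 1 else 0)"

definition cartan :: "nat \<Rightarrow> complex mat set" where
  "cartan m = {A \<in> gl m. diagonal_mat A}"

definition n_plus :: "nat \<Rightarrow> complex mat set" where
  "n_plus m = {A \<in> gl m. \<forall>a<m. \<forall>b<m. b \<le> a \<longrightarrow> A $$ (a, b) = 0}"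

definition n_minus :: "nat \<Rightarrow> complex mat set" where
  "n_minus m = {A \<in> gl m. \<forall>a<m. \<forall>b<m. a \<le> b \<longrightarrow> A $$ (a, b) = 0}"

definition b_minus :: "nat \<Rightarrow> complex mat set" where
  "b_minus m = {A + B | A B. A \<in> cartan m \<and> B \<in> n_minus m}"


section \<open>Weights and roots\<close>

text \<open>
  The dual of the diagonal subalgebra is \<open>carrier_vec m\<close>: a vector is the list of coordinates of
  a weight with respect to the basis \<open>eps m 1, \<dots>, eps m m\<close>.  As this basis is orthonormal, the
  bilinear form on weights is \<^const>\<open>scalar_prod\<close> (which involves no complex conjugation).
\<close>

definition eps :: "nat \<Rightarrow> nat \<Rightarrow> complex vec" where
  "eps m i = unit_vec m (i - 1)"

definition weight_eval :: "complex vec \<Rightarrow> complex mat \<Rightarrow> complex" where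
  "weight_eval \<mu> A = (\<Sum>k<dim_vec \<mu>. \<mu> $ k * A $$ (k, k))"

definition h_elt :: "complex vec \<Rightarrow> complex mat" where
  "h_elt \<alpha> = mat (dim_vec \<alpha>) (dim_vec \<alpha>) (\<lambda>(a, b). if a = b then \<alpha> $ a else 0)"

lemma weight_eval_eps_mat_unit:
  assumes "i \<in> {1..m}" "j \<in> {1..m}"
  shows "weight_eval (eps m i) (mat_unit m j j) = (if i = j then 1 else 0)"
proof -
  have "weight_eval (eps m i) (mat_unit m j j)
      = (\<Sum>k<m. if k = j - 1 then (if i = j then 1 else 0) else 0)"
    unfolding weight_eval_def eps_def index_unit_vec(3)
  proof (rule sum.cong[OF refl])
    fix k assume "k \<in> {..<m}"
    moreover have "k + 1 = j \<longleftrightarrow> k = j - 1" "i - 1 = j - 1 \<longleftrightarrow> i = j" using assms by auto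
    ultimately show "unit_vec m (i - 1) $ k * mat_unit m j j $$ (k, k)
        = (if k = j - 1 then if i = j then 1 else 0 else 0)"
      by (auto simp: mat_unit_def unit_vec_def)
  qed
  also have "\<dots> = (if j - 1 \<in> {..<m} then (if i = j then 1 else 0) else 0)"
    by (rule sum.delta) simp
  also have "\<dots> = (if i = j then 1 else 0)"
  proof -
    have "j - 1 < m" using assms(2) unfolding atLeastAtMost_iff by linarith
    then show ?thesis by simp
  qed
  finally show ?thesis .
qed

lemma h_elt_props:
  assumes "\<alpha> \<in> carrier_vec m"
  shows "h_elt \<alpha> \<in> cartan m"
    and "\<And>\<beta>. \<beta> \<in> carrier_vec m \<Longrightarrow> weight_eval \<beta> (h_elt \<alpha>) = \<alpha> \<bullet> \<beta>"
proof -
  show "h_elt \<alpha> \<in> cartan m"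
    using assms by (simp add: h_elt_def cartan_def gl_def diagonal_mat_def)
  fix \<beta> :: "complex vec"
  assume \<beta>: "\<beta> \<in> carrier_vec m"
  have "weight_eval \<beta> (h_elt \<alpha>) = (\<Sum>k<m. \<beta> $ k * \<alpha> $ k)"
    unfolding weight_eval_def h_elt_def using assms \<beta> by simp
  also have "\<dots> = \<beta> \<bullet> \<alpha>"
    using assms by (simp add: scalar_prod_def lessThan_atLeast0)
  also have "\<dots> = \<alpha> \<bullet> \<beta>"
    by (rule comm_scalar_prod[OF \<beta> assms])
  finally show "weight_eval \<beta> (h_elt \<alpha>) = \<alpha> \<bullet> \<beta>" .
qed

text \<open>The pair \<open>(i, j)\<close> with \<open>i < j\<close> stands for the positive root \<open>\<epsilon>\<^sub>i - \<epsilon>\<^sub>j\<close>.\<close>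

definition pos_roots :: "nat \<Rightarrow> (nat \<times> nat) set" where
  "pos_roots m = {(i, j). 1 \<le> i \<and> i < j \<and> j \<le> m}"

definition simple_roots :: "nat \<Rightarrow> (nat \<times> nat) set" where
  "simple_roots m = {(i, i + 1) | i. 1 \<le> i \<and> i \<le> m - 1}"

definition root_wt :: "nat \<Rightarrow> nat \<times> nat \<Rightarrow> complex vec" where
  "root_wt m \<alpha> = eps m (fst \<alpha>) - eps m (snd \<alpha>)"

definition rho :: "nat \<Rightarrow> complex vec" where
  "rho m = (1/2) \<cdot>\<^sub>v finsum_vec TYPE(complex) m (root_wt m) (pos_roots m)"


section \<open>The enveloping algebra of \<open>gl(m)\<close>\<close>

definition env_relations :: "nat \<Rightarrow> complex mat free_alg set" where
  "env_relations m =
     {free_gen (A + B) - free_gen A - free_gen B | A B. A \<in> gl m \<and> B \<in> gl m}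
   \<union> {free_gen (c \<cdot>\<^sub>m A) - free_scal c * free_gen A | c A. A \<in> gl m}
   \<union> {free_gen A * free_gen B - free_gen B * free_gen A - free_gen (lie_bracket A B)
        | A B. A \<in> gl m \<and> B \<in> gl m}"

text \<open>
  The tensor algebra of \<open>gl(m)\<close> is the quotient of the free algebra on the set \<open>gl(m)\<close> by
  the first two families of relations, so \<open>Ugl m\<close> is the usual quotient of the tensor algebra.
\<close>

definition env_ideal :: "nat \<Rightarrow> complex mat free_alg set" where
  "env_ideal m = genideal (free_algebra (gl m)) (env_relations m)"

definition Ugl :: "nat \<Rightarrow> complex mat free_alg set ring" where
  "Ugl m = free_algebra (gl m) Quot env_ideal m"

definition ugl_inc :: "nat \<Rightarrow> complex mat \<Rightarrow> complex mat free_alg set" where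
  "ugl_inc m A = env_ideal m +>\<^bsub>free_algebra (gl m)\<^esub> free_gen A"

definition ugl_scal :: "nat \<Rightarrow> complex \<Rightarrow> complex mat free_alg set" where
  "ugl_scal m c = env_ideal m +>\<^bsub>free_algebra (gl m)\<^esub> free_scal c"

lemma env_relations_subset: "env_relations m \<subseteq> carrier (free_algebra (gl m))"
proof
  fix x assume "x \<in> env_relations m"
  then consider
      (add) A B where "x = free_gen (A + B) - free_gen A - free_gen B" "A \<in> gl m" "B \<in> gl m"
    | (smult) c A where "x = free_gen (c \<cdot>\<^sub>m A) - free_scal c * free_gen A" "A \<in> gl m"
    | (bracket) A B where "x = free_gen A * free_gen B - free_gen B * free_gen A
        - free_gen (lie_bracket A B)" "A \<in> gl m" "B \<in> gl m"
    unfolding env_relations_def by fast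
  then show "x \<in> carrier (free_algebra (gl m))"
  proof cases
    case add
    moreover from add have "A + B \<in> gl m" by (simp add: gl_def)
    ultimately show ?thesis by (simp add: free_algebra_diff_closed free_algebra_closed)
  next
    case smult
    moreover from smult have "c \<cdot>\<^sub>m A \<in> gl m" by (simp add: gl_def)
    ultimately show ?thesis by (simp add: free_algebra_diff_closed free_algebra_closed)
  next
    case bracket
    moreover from bracket have "lie_bracket A B \<in> gl m"
      unfolding gl_def lie_bracket_def by (intro minus_carrier_mat mult_carrier_mat)
    ultimately show ?thesis by (simp add: free_algebra_diff_closed free_algebra_closed)
  qed
qed

lemma ideal_env_ideal: "ideal (env_ideal m) (free_algebra (gl m))"
  unfolding env_ideal_def
  by (rule ring.genideal_ideal[OF ring_free_algebra env_relations_subset])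

lemma ring_Ugl: "ring (Ugl m)"
  unfolding Ugl_def by (rule ideal.quotient_is_ring[OF ideal_env_ideal])

text \<open>
  For a subalgebra \<open>S\<close> of \<open>gl(m)\<close>, the enveloping algebra of \<open>S\<close> is identified with its
  image in \<open>Ugl m\<close>, the unital complex subalgebra generated by \<open>S\<close>.
\<close>

definition Ugl_sub :: "nat \<Rightarrow> complex mat set \<Rightarrow> complex mat free_alg set set" where
  "Ugl_sub m S = generate_ring (Ugl m) (range (ugl_scal m) \<union> ugl_inc m ` S)"

definition left_ideal :: "nat \<Rightarrow> complex mat free_alg set set \<Rightarrow> complex mat free_alg set set" where
  "left_ideal m S = generate (add_monoid (Ugl m)) {u \<otimes>\<^bsub>Ugl m\<^esub> s | u s. u \<in> carrier (Ugl m) \<and> s \<in> S}"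

definition Ugl_has_weight :: "nat \<Rightarrow> complex mat free_alg set \<Rightarrow> complex vec \<Rightarrow> bool" where
  "Ugl_has_weight m u \<mu> \<longleftrightarrow> u \<in> carrier (Ugl m) \<and>
     (\<forall>h\<in>cartan m. ugl_inc m h \<otimes>\<^bsub>Ugl m\<^esub> u \<ominus>\<^bsub>Ugl m\<^esub> u \<otimes>\<^bsub>Ugl m\<^esub> ugl_inc m h
        = ugl_scal m (weight_eval \<mu> h) \<otimes>\<^bsub>Ugl m\<^esub> u)"

definition Ugl_prod_list :: "nat \<Rightarrow> complex mat free_alg set list \<Rightarrow> complex mat free_alg set" where
  "Ugl_prod_list m us = foldr (\<otimes>\<^bsub>Ugl m\<^esub>) us \<one>\<^bsub>Ugl m\<^esub>"


section \<open>Verma modules\<close>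

text \<open>
  \<open>M(lam)\<close> is the quotient of the left regular module \<open>Ugl m\<close> by the left ideal generated by
  \<open>\<nn>\<^sup>+\<close> and the elements \<open>h - lam(h)\<close>, \<open>h\<close> diagonal; its zero vector is that left ideal.
\<close>

definition verma_ideal :: "nat \<Rightarrow> complex vec \<Rightarrow> complex mat free_alg set set" where
  "verma_ideal m lam = left_ideal m
     (ugl_inc m ` n_plus m \<union> {ugl_inc m h \<ominus>\<^bsub>Ugl m\<^esub> ugl_scal m (weight_eval lam h) | h. h \<in> cartan m})"

definition verma :: "nat \<Rightarrow> complex vec \<Rightarrow> complex mat free_alg set set set" where
  "verma m lam = a_rcosets\<^bsub>Ugl m\<^esub> (verma_ideal m lam)"

definition verma_act ::
  "nat \<Rightarrow> complex vec \<Rightarrow> complex mat free_alg set \<Rightarrow> complex mat free_alg set set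
     \<Rightarrow> complex mat free_alg set set" where
  "verma_act m lam u v = (\<Union>x\<in>v. verma_ideal m lam +>\<^bsub>Ugl m\<^esub> (u \<otimes>\<^bsub>Ugl m\<^esub> x))"

text \<open>\<open>v\<close> is a highest weight vector of weight \<open>\<mu>\<close> in \<open>M(lam)\<close>.\<close>

definition highest_weight_vector ::
  "nat \<Rightarrow> complex vec \<Rightarrow> complex vec \<Rightarrow> complex mat free_alg set set \<Rightarrow> bool" where
  "highest_weight_vector m lam \<mu> v \<longleftrightarrow> v \<in> verma m lam \<and> v \<noteq> verma_ideal m lam \<and>
     (\<forall>x\<in>n_plus m. verma_act m lam (ugl_inc m x) v = verma_ideal m lam) \<and>
     (\<forall>h\<in>cartan m. verma_act m lam (ugl_inc m h) v = verma_act m lam (ugl_scal m (weight_eval \<mu> h)) v)"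

lemma left_ideal_props:
  assumes "S \<subseteq> carrier (Ugl m)"
  shows "additive_subgroup (left_ideal m S) (Ugl m)"
    and "S \<subseteq> left_ideal m S"
    and "\<And>u x. u \<in> carrier (Ugl m) \<Longrightarrow> x \<in> left_ideal m S \<Longrightarrow> u \<otimes>\<^bsub>Ugl m\<^esub> x \<in> left_ideal m S"
proof -
  interpret R: ring "Ugl m" by (rule ring_Ugl)
  let ?G = "{u \<otimes>\<^bsub>Ugl m\<^esub> s | u s. u \<in> carrier (Ugl m) \<and> s \<in> S}"
  have G: "?G \<subseteq> carrier (Ugl m)" using assms by auto
  have sub: "subgroup (left_ideal m S) (add_monoid (Ugl m))"
    unfolding left_ideal_def by (rule R.add.generate_is_subgroup[OF G])
  then show "additive_subgroup (left_ideal m S) (Ugl m)"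
    by (rule additive_subgroup.intro)
  show "S \<subseteq> left_ideal m S"
  proof
    fix x assume x: "x \<in> S"
    then have "x = \<one>\<^bsub>Ugl m\<^esub> \<otimes>\<^bsub>Ugl m\<^esub> x" using assms by auto
    then have "x \<in> ?G" using x R.one_closed by blast
    then show "x \<in> left_ideal m S" unfolding left_ideal_def by (rule generate.incl)
  qed
  have prod: "w \<otimes>\<^bsub>Ugl m\<^esub> g \<in> ?G" if "w \<in> carrier (Ugl m)" "g \<in> ?G" for w g
  proof -
    from that(2) obtain u s where us: "g = u \<otimes>\<^bsub>Ugl m\<^esub> s" "u \<in> carrier (Ugl m)" "s \<in> S"
      by blast
    with assms that(1) have "w \<otimes>\<^bsub>Ugl m\<^esub> g = (w \<otimes>\<^bsub>Ugl m\<^esub> u) \<otimes>\<^bsub>Ugl m\<^esub> s"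
      by (auto simp: R.m_assoc)
    moreover have "w \<otimes>\<^bsub>Ugl m\<^esub> u \<in> carrier (Ugl m)"
      using that(1) us(2) by (rule R.m_closed)
    ultimately show ?thesis using us(3) by blast
  qed
  show "u \<otimes>\<^bsub>Ugl m\<^esub> x \<in> left_ideal m S" if u: "u \<in> carrier (Ugl m)" and x: "x \<in> left_ideal m S" for u x
    using x unfolding left_ideal_def
  proof (induction rule: generate.induct)
    case one
    show ?case using u generate.one[of "add_monoid (Ugl m)" ?G] by simp
  next
    case (incl h)
    show ?case by (rule generate.incl[OF prod[OF u incl]])
  next
    case (inv h)
    then have h: "h \<in> carrier (Ugl m)" using G by auto
    have "inv\<^bsub>add_monoid (Ugl m)\<^esub> (u \<otimes>\<^bsub>Ugl m\<^esub> h) \<in> generate (add_monoid (Ugl m)) ?G"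
      by (rule generate.inv[OF prod[OF u inv]])
    then show ?case unfolding a_inv_def[symmetric] R.r_minus[OF u h] .
  next
    case (eng h1 h2)
    have "h1 \<in> carrier (Ugl m)" "h2 \<in> carrier (Ugl m)"
      using eng.hyps R.add.generate_in_carrier[OF G] by auto
    then show ?case using eng.IH u generate.eng[OF eng.IH] by (simp add: R.r_distr)
  qed
qed


lemma verma_act_coset:
  assumes "u \<in> carrier (Ugl m)" "x \<in> carrier (Ugl m)"
  shows "verma_act m lam u (verma_ideal m lam +>\<^bsub>Ugl m\<^esub> x)
       = verma_ideal m lam +>\<^bsub>Ugl m\<^esub> (u \<otimes>\<^bsub>Ugl m\<^esub> x)"
proof -
  interpret R: ring "Ugl m" by (rule ring_Ugl)
  interpret F: ideal "env_ideal m" "free_algebra (gl m)" by (rule ideal_env_ideal)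
  let ?J = "verma_ideal m lam"
  have coset: "env_ideal m +>\<^bsub>free_algebra (gl m)\<^esub> p \<in> carrier (Ugl m)"
    if "p \<in> carrier (free_algebra (gl m))" for p
    using F.rcos_ring_hom that by (auto simp: Ugl_def ring_hom_def)
  have "ugl_inc m A \<in> carrier (Ugl m)" if "A \<in> gl m" for A
    unfolding ugl_inc_def using that by (intro coset free_algebra_closed)
  moreover have "ugl_scal m c \<in> carrier (Ugl m)" for c
    unfolding ugl_scal_def by (intro coset free_algebra_closed)
  ultimately have S: "ugl_inc m ` n_plus m
      \<union> {ugl_inc m h \<ominus>\<^bsub>Ugl m\<^esub> ugl_scal m (weight_eval lam h) | h. h \<in> cartan m}
      \<subseteq> carrier (Ugl m)"
    by (auto simp: n_plus_def cartan_def)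
  interpret J: additive_subgroup ?J "Ugl m"
    unfolding verma_ideal_def by (rule left_ideal_props(1)[OF S])
  interpret J: abelian_subgroup ?J "Ugl m"
    by (rule abelian_subgroupI3[OF J.additive_subgroup_axioms R.abelian_group_axioms])
  have mult: "u \<otimes>\<^bsub>Ugl m\<^esub> j \<in> ?J" if "j \<in> ?J" for j
    using left_ideal_props(3)[OF S assms(1)] that unfolding verma_ideal_def by blast
  have eq: "?J +>\<^bsub>Ugl m\<^esub> (u \<otimes>\<^bsub>Ugl m\<^esub> y) = ?J +>\<^bsub>Ugl m\<^esub> (u \<otimes>\<^bsub>Ugl m\<^esub> x)"
    if "y \<in> ?J +>\<^bsub>Ugl m\<^esub> x" for y
  proof -
    from that obtain j where j: "j \<in> ?J" "y = j \<oplus>\<^bsub>Ugl m\<^esub> x"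
      by (auto simp: a_r_coset_def')
    then have jC: "j \<in> carrier (Ugl m)" using J.a_subset by blast
    have "u \<otimes>\<^bsub>Ugl m\<^esub> y = u \<otimes>\<^bsub>Ugl m\<^esub> j \<oplus>\<^bsub>Ugl m\<^esub> u \<otimes>\<^bsub>Ugl m\<^esub> x"
      using assms jC j(2) by (simp add: R.r_distr)
    then have "u \<otimes>\<^bsub>Ugl m\<^esub> y \<in> ?J +>\<^bsub>Ugl m\<^esub> (u \<otimes>\<^bsub>Ugl m\<^esub> x)"
      using mult[OF j(1)] by (auto simp: a_r_coset_def')
    then show ?thesis
      by (rule J.a_repr_independence'[symmetric]) (rule R.m_closed[OF assms])
  qed
  have "x \<in> ?J +>\<^bsub>Ugl m\<^esub> x" using J.a_rcos_self assms(2) by blast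
  then show ?thesis unfolding verma_act_def by (rule UN_constant_eq) (rule ballI, erule eq)
qed


section \<open>Partitions and Shapovalov elements\<close>

definition partitions :: "nat \<Rightarrow> nat \<times> nat \<Rightarrow> (nat \<times> nat \<Rightarrow> nat) set" where
  "partitions m \<eta> = {\<pi>. (\<forall>\<alpha>. \<alpha> \<notin> pos_roots m \<longrightarrow> \<pi> \<alpha> = 0) \<and>
     finsum_vec TYPE(complex) m (\<lambda>\<alpha>. of_nat (\<pi> \<alpha>) \<cdot>\<^sub>v root_wt m \<alpha>) (pos_roots m) = root_wt m \<eta>}"

definition root_order :: "nat \<Rightarrow> (nat \<times> nat) list \<Rightarrow> bool" where
  "root_order m rs \<longleftrightarrow> distinct rs \<and> set rs = pos_roots m"

text \<open>
  The root vector of \<open>-(\<epsilon>\<^sub>i - \<epsilon>\<^sub>j)\<close> is \<open>mat_unit m j i\<close>.  Hence a list of positive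
  roots with weakly decreasing second components is an order which places
  \<open>mat_unit m a b\<close> before \<open>mat_unit m c d\<close> whenever \<open>c < a\<close>.
\<close>

definition e_neg ::
  "nat \<Rightarrow> (nat \<times> nat) list \<Rightarrow> (nat \<times> nat \<Rightarrow> nat) \<Rightarrow> complex mat free_alg set" where
  "e_neg m rs \<pi> = Ugl_prod_list m
     (map (\<lambda>\<alpha>. ugl_inc m (mat_unit m (snd \<alpha>) (fst \<alpha>)) [^]\<^bsub>Ugl m\<^esub> \<pi> \<alpha>) rs)"

text \<open>
  The condition of being a Shapovalov element for the pair \<open>(\<eta>, 1)\<close>, relative to the order
  \<open>rs\<close> of the positive roots.
\<close>

definition shapovalov ::
  "nat \<Rightarrow> (nat \<times> nat) list \<Rightarrow> nat \<times> nat \<Rightarrow> complex mat free_alg set \<Rightarrow> bool" where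
  "shapovalov m rs \<eta> \<theta> \<longleftrightarrow>
     \<theta> \<in> Ugl_sub m (b_minus m) \<and>
     Ugl_has_weight m \<theta> (- root_wt m \<eta>) \<and>
     (\<exists>H. (\<forall>\<pi>\<in>partitions m \<eta>. H \<pi> \<in> Ugl_sub m (cartan m)) \<and>
          \<theta> = (\<Oplus>\<^bsub>Ugl m\<^esub>\<pi>\<in>partitions m \<eta>. e_neg m rs \<pi> \<otimes>\<^bsub>Ugl m\<^esub> H \<pi>) \<and>
          (\<exists>\<pi>0\<in>partitions m \<eta>.
             (\<forall>\<alpha>\<in>pos_roots m - simple_roots m. \<pi>0 \<alpha> = 0) \<and> H \<pi>0 = \<one>\<^bsub>Ugl m\<^esub>)) \<and>
     (\<forall>\<alpha>\<in>pos_roots m.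
        ugl_inc m (mat_unit m (fst \<alpha>) (snd \<alpha>)) \<otimes>\<^bsub>Ugl m\<^esub> \<theta>
        \<in> left_ideal m
            {ugl_inc m (h_elt (root_wt m \<eta>)) \<oplus>\<^bsub>Ugl m\<^esub>
             ugl_scal m (weight_eval (rho m) (h_elt (root_wt m \<eta>))
               - (root_wt m \<eta> \<bullet> root_wt m \<eta>) / 2)}
          <+>\<^bsub>Ugl m\<^esub> left_ideal m (ugl_inc m ` n_plus m))"


section \<open>The elements \<open>f\<^sub>I\<close>, \<open>H\<^sub>I\<close> and \<open>\<Theta>\<close>\<close>

definition index_sets :: "nat \<Rightarrow> nat set set" where
  "index_sets m = {I. I \<subseteq> {1..m} \<and> 1 \<in> I \<and> m \<in> I}"

definition f_elt :: "nat \<Rightarrow> nat set \<Rightarrow> complex mat free_alg set" where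
  "f_elt m I = (let js = rev (sorted_list_of_set I)
     in Ugl_prod_list m (map (\<lambda>(a, b). ugl_inc m (mat_unit m a b)) (zip js (tl js))))"

definition hk :: "nat \<Rightarrow> nat \<Rightarrow> complex mat free_alg set" where
  "hk m k = ugl_inc m (h_elt (root_wt m (1, k + 1))) \<oplus>\<^bsub>Ugl m\<^esub> ugl_scal m (rho m \<bullet> root_wt m (1, k + 1) - 1)"

definition r_set :: "nat \<Rightarrow> nat set \<Rightarrow> nat set" where
  "r_set m I = {x - 1 | x. x \<in> {1..m} - I}"

text \<open>
  The factors \<open>hk m i\<close> commute, so the choice of the increasing order is immaterial.
\<close>

definition H_elt :: "nat \<Rightarrow> nat set \<Rightarrow> complex mat free_alg set" where
  "H_elt m I = Ugl_prod_list m (map (hk m) (sorted_list_of_set (r_set m I)))"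

definition Theta :: "nat \<Rightarrow> complex mat free_alg set" where
  "Theta m = (\<Oplus>\<^bsub>Ugl m\<^esub>J\<in>index_sets m. f_elt m J \<otimes>\<^bsub>Ugl m\<^esub> H_elt m J)"

end

theory Submission
  imports Defs
begin

text \<open>
  Put \<open>a\<^sub>x = e\<^sub>1\<^sub>1 - e\<^sub>x\<^sub>x + x - 2\<close>, so that \<open>h\<^sub>x = a\<^sub>x\<^sub>+\<^sub>1\<close>.  Sorting the index sets with
  maximum \<open>x\<close> by their second largest element \<open>y\<close> gives elements \<open>T 1 = 1\<close> and
  \<open>T x = (\<Sum>y<x. e\<^sub>x\<^sub>y T y \<Prod>y<z<x. a\<^sub>z)\<close> with \<open>T m = \<Theta>\<close>, and an induction on \<open>x\<close> shows that, modulo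
  \<open>U \<nn>\<^sup>+\<close>, the product \<open>e\<^sub>k\<^sub>,\<^sub>k\<^sub>+\<^sub>1 T x\<close> is \<open>T k a\<^sub>x\<close> for \<open>k + 1 = x\<close> and \<open>0\<close> otherwise.  As \<open>a\<^sub>m\<close> acts
  on a vector of weight \<open>\<lambda>\<close> by \<open>(\<lambda> + \<rho>, \<eta>) - 1\<close>, this yields all vanishing statements.

  That \<open>\<Theta> v\<close> is not zero is read off from a model of a highest weight module of arbitrary highest
  weight \<open>\<lambda>\<close>: functionals on polynomial functions on a product of big cells of Grassmannians.
  The functional \<open>\<Theta> v\<close> takes the value \<open>1\<close> on the product of the coordinates belonging to the
  simple roots, since lowering operators of other roots vanish there.  Vectors of weight \<open>\<lambda>\<close>
  in \<open>M(\<lambda>)\<close> are multiples of the generator, because the other weight spaces of the span of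
  monomials in \<open>\<nn>\<^sup>-\<close> are separated from it by an element of the Cartan subalgebra.
\<close>


section \<open>Chains of indices and the recursion for \<open>\<Theta>\<close>\<close>

text \<open>The statements on raising operators come from one congruence in the enveloping algebra,
  before any weight is fixed. Read modulo the Verma ideal it gives the module statements; read
  modulo the sum of \<open>U a_m\<close> and \<open>U n^+\<close> it gives the Shapovalov condition
  directly. The obstacle is nonvanishing: \<open>Ugl m\<close> is given by relations, and to show
  that an element lies outside an ideal a representation has to detect it. Finite-dimensional
  modules cannot serve, since (lambda + rho, eta) = 1 means lambda_1 - lambda_m = 2 - m: for m >= 3
  this is never dominant, and for m = 2 the module is one-dimensional and e_21 acts as 0. On a big
  cell only the Lie algebra has to act, through multipliers linear in the exponents
  \<open>c k\<close>, so arbitrary complex exponents are allowed. Functionals are used because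
  evaluation at the origin is killed by the raising operators, while among functions it is the
  constant 1 that the lowering fields kill. Transposition also turns the antihomomorphism given by
  vector fields into a representation.\<close>

definition left_ideal_set :: "'a::ring_1 set \<Rightarrow> bool" where
  "left_ideal_set L \<longleftrightarrow> 0 \<in> L \<and> (\<forall>x\<in>L. \<forall>y\<in>L. x + y \<in> L) \<and> (\<forall>u. \<forall>x\<in>L. u * x \<in> L)"

lemma left_ideal_setD:
  assumes "left_ideal_set L"
  shows "0 \<in> L" "x \<in> L \<Longrightarrow> y \<in> L \<Longrightarrow> x + y \<in> L" "x \<in> L \<Longrightarrow> u * x \<in> L"
    "x \<in> L \<Longrightarrow> - x \<in> L" "x \<in> L \<Longrightarrow> y \<in> L \<Longrightarrow> x - y \<in> L"
proof -
  show *: "0 \<in> L" "x \<in> L \<Longrightarrow> y \<in> L \<Longrightarrow> x + y \<in> L" "x \<in> L \<Longrightarrow> u * x \<in> L" for u x y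
    using assms by (auto simp: left_ideal_set_def)
  show **: "x \<in> L \<Longrightarrow> - x \<in> L" for x
    using *(3)[of x "-1"] by simp
  show "x \<in> L \<Longrightarrow> y \<in> L \<Longrightarrow> x - y \<in> L"
    using *(2)[of x "-y"] **[of y] by simp
qed

lemma left_ideal_set_sum:
  assumes "left_ideal_set L" "\<And>i. i \<in> I \<Longrightarrow> f i \<in> L"
  shows "sum f I \<in> L"
  using assms(2) by (induction I rule: infinite_finite_induct)
    (auto intro: left_ideal_setD[OF assms(1)])

lemma if_zero_mult: "(if P then x else 0) * y = (if P then x * y else (0::'a::ring_1))"
  by simp

section \<open>Splitting index sets by their second largest element\<close>

lemma index_sets_1: "index_sets 1 = {{1}}"
  by (auto simp: index_sets_def)

lemma finite_index_sets: "finite (index_sets x)"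
  by (rule finite_subset[of _ "Pow {1..x}"]) (auto simp: index_sets_def)

lemma index_sets_rec:
  assumes "1 < x"
  shows "index_sets x = (\<Union>y\<in>{1..<x}. insert x ` index_sets y)"
proof (intro equalityI subsetI)
  fix J assume J: "J \<in> index_sets x"
  define J' where "J' = J - {x}"
  have fin: "finite J'" and "1 \<in> J'"
    using J assms by (auto simp: J'_def index_sets_def intro: finite_subset)
  then have mem: "Max J' \<in> J'" by (intro Max_in) auto
  have "J' \<in> index_sets (Max J')"
    using J Max_ge[OF fin] mem \<open>1 \<in> J'\<close> unfolding index_sets_def J'_def by fastforce
  moreover have "J = insert x J'"
    using J by (auto simp: index_sets_def J'_def)
  moreover have "Max J' \<in> {1..<x}"
    using mem J by (auto simp: J'_def index_sets_def)
  ultimately show "J \<in> (\<Union>y\<in>{1..<x}. insert x ` index_sets y)" by blast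
qed (use assms in \<open>auto simp: index_sets_def\<close>)

lemma index_sets_Max: "J \<in> index_sets x \<Longrightarrow> Max J = x"
  by (intro Max_eqI) (auto simp: index_sets_def intro: finite_subset)

text \<open>The union in \<open>index_sets_rec\<close> is disjoint, because \<open>y\<close> is
  recovered as the maximum of what remains after removing \<open>x\<close>.\<close>

lemma sum_index_sets_rec:
  fixes g :: "nat set \<Rightarrow> 'b::comm_monoid_add"
  assumes "1 < x"
  shows "sum g (index_sets x) = (\<Sum>y\<in>{1..<x}. \<Sum>J\<in>index_sets y. g (insert x J))"
proof -
  have notin: "x \<notin> J" if "J \<in> index_sets y" "y < x" for J y
    using that by (auto simp: index_sets_def)
  have "sum g (index_sets x) = (\<Sum>y\<in>{1..<x}. sum g (insert x ` index_sets y))"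
    unfolding index_sets_rec[OF assms]
  proof (rule sum.UNION_disjoint)
    show "\<forall>i\<in>{1..<x}. \<forall>j\<in>{1..<x}. i \<noteq> j \<longrightarrow>
        insert x ` index_sets i \<inter> insert x ` index_sets j = {}"
    proof (intro ballI impI equals0I)
      fix i j J assume ij: "i \<in> {1..<x}" "j \<in> {1..<x}" "i \<noteq> j"
        and "J \<in> insert x ` index_sets i \<inter> insert x ` index_sets j"
      then obtain I1 I2 where I: "I1 \<in> index_sets i" "I2 \<in> index_sets j" "insert x I1 = insert x I2"
        by auto
      then have "I1 = I2"
        using notin[OF I(1)] notin[OF I(2)] ij by auto
      then show False using I index_sets_Max ij by metis
    qed
  qed (auto simp: finite_index_sets)
  also have "\<dots> = (\<Sum>y\<in>{1..<x}. \<Sum>J\<in>index_sets y. g (insert x J))"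
  proof (rule sum.cong[OF refl])
    fix y assume y: "y \<in> {1..<x}"
    have "inj_on (insert x) (index_sets y)"
      using notin y by (intro inj_onI) (metis atLeastLessThan_iff insert_ident)
    then show "sum g (insert x ` index_sets y) = (\<Sum>J\<in>index_sets y. g (insert x J))"
      by (simp add: sum.reindex)
  qed
  finally show ?thesis .
qed

lemma sorted_list_insert_greatest:
  assumes "finite J" "\<And>y. y \<in> J \<Longrightarrow> y < x"
  shows "sorted_list_of_set (insert x J) = sorted_list_of_set J @ [x]"
proof -
  have "x \<notin> J" using assms by auto
  then show ?thesis
    using assms sorted_insort_is_snoc[of "sorted_list_of_set J" x]
    by (auto simp: less_imp_le)
qed

definition chain_pairs :: "nat set \<Rightarrow> (nat \<times> nat) list" where
  "chain_pairs J = (let js = rev (sorted_list_of_set J) in zip js (tl js))"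

lemma chain_pairs_1: "chain_pairs {x} = []"
  by (simp add: chain_pairs_def)

lemma chain_pairs_insert:
  assumes "J \<in> index_sets y" "y < x"
  shows "chain_pairs (insert x J) = (x, y) # chain_pairs J"
proof -
  have fin: "finite J" "y \<in> J" and le: "\<And>z. z \<in> J \<Longrightarrow> z \<le> y"
    using assms(1) by (auto simp: index_sets_def intro: finite_subset)
  have "sorted_list_of_set J = sorted_list_of_set (insert y (J - {y}))"
    using fin by (simp add: insert_absorb)
  also have "\<dots> = sorted_list_of_set (J - {y}) @ [y]"
    using fin le by (intro sorted_list_insert_greatest) (auto simp: less_le)
  finally have 1: "sorted_list_of_set J = sorted_list_of_set (J - {y}) @ [y]" .
  have 2: "sorted_list_of_set (insert x J) = sorted_list_of_set J @ [x]"
    using fin le assms(2) by (intro sorted_list_insert_greatest) fastforce+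
  show ?thesis unfolding chain_pairs_def 2 by (simp add: 1)
qed

text \<open>The new gaps all exceed the old ones, so they are appended at the end. This lets
  \<open>T_rec\<close> split off their factors on the right without commuting any
  \<open>a_elt\<close>.\<close>

lemma sorted_list_gap_insert:
  assumes "J \<in> index_sets y" "y < x"
  shows "sorted_list_of_set ({1..x} - insert x J) = sorted_list_of_set ({1..y} - J) @ [Suc y..<x]"
proof (rule sorted_distinct_set_unique)
  show "sorted (sorted_list_of_set ({1..y} - J) @ [Suc y..<x])"
    by (auto simp: sorted_append)
  show "set (sorted_list_of_set ({1..x} - insert x J))
      = set (sorted_list_of_set ({1..y} - J) @ [Suc y..<x])"
    using assms by (auto simp: index_sets_def)
qed auto

text \<open>Only the bracket relations of matrix units and a central image of the complex numbers
  are assumed. Both the enveloping algebras (\<open>E_prod\<close>) and the operators of the model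
  (\<open>gl_op\<close>) are instances, so \<open>T\<close> makes sense in both and can be carried
  from one to the other.\<close>

locale gl_elements =
  fixes m :: nat and E :: "nat \<Rightarrow> nat \<Rightarrow> 'a::ring_1" and sc :: "complex \<Rightarrow> 'a"
  assumes comm: "\<lbrakk>i \<in> {1..m}; j \<in> {1..m}; k \<in> {1..m}; l \<in> {1..m}\<rbrakk> \<Longrightarrow>
      E i j * E k l = E k l * E i j + (if j = k then E i l else 0) - (if l = i then E k j else 0)"
    and sc_1: "sc 1 = 1"
    and sc_add: "sc (c + d) = sc c + sc d"
    and sc_mult: "sc (c * d) = sc c * sc d"
    and sc_central: "sc c * x = x * sc c"
begin

lemma sc_0: "sc 0 = 0"
  using sc_add[of 0 0] by simp

lemma sc_uminus: "sc (- c) = - sc c"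
  using sc_add[of c "-c"] by (simp add: sc_0 eq_neg_iff_add_eq_0 add.commute)

lemma sc_diff: "sc (c - d) = sc c - sc d"
  using sc_add[of c "-d"] by (simp add: sc_uminus)

lemma sc_of_nat: "sc (of_nat n) = of_nat n"
  by (induction n) (simp_all add: sc_0 sc_1 sc_add)

text \<open>The constant \<open>x - 2\<close> is (rho, eps_1 - eps_x) - 1; compare
  \<open>rho_root\<close>.\<close>

definition a_elt :: "nat \<Rightarrow> 'a" where
  "a_elt x = E 1 1 - E x x + of_nat x - 2"

definition A_elt :: "nat \<Rightarrow> nat \<Rightarrow> 'a" where
  "A_elt y x = prod_list (map a_elt [Suc y..<x])"

definition path_prod :: "nat set \<Rightarrow> 'a" where
  "path_prod J = prod_list (map (\<lambda>(i, j). E i j) (chain_pairs J))"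

definition gap_prod :: "nat \<Rightarrow> nat set \<Rightarrow> 'a" where
  "gap_prod x J = prod_list (map a_elt (sorted_list_of_set ({1..x} - J)))"

definition T :: "nat \<Rightarrow> 'a" where
  "T x = (\<Sum>J\<in>index_sets x. path_prod J * gap_prod x J)"

lemma T_1: "T (Suc 0) = 1"
  using index_sets_1 by (simp add: T_def path_prod_def gap_prod_def chain_pairs_1)

lemma T_rec:
  assumes "1 < x"
  shows "T x = (\<Sum>y\<in>{1..<x}. E x y * T y * A_elt y x)"
  unfolding T_def sum_index_sets_rec[OF assms] sum_distrib_left sum_distrib_right
proof (intro sum.cong refl)
  fix y J assume "y \<in> {1..<x}" "J \<in> index_sets y"
  then show "path_prod (insert x J) * gap_prod x (insert x J)
      = E x y * (path_prod J * gap_prod y J) * A_elt y x"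
    by (simp add: path_prod_def gap_prod_def A_elt_def chain_pairs_insert
        sorted_list_gap_insert[simplified] mult.assoc)
qed

lemma E_diag_commute:
  assumes "i \<in> {1..m}" "j \<in> {1..m}"
  shows "E i i * E j j = E j j * E i i"
  using comm[OF assms(1) assms(1) assms(2) assms(2)] by simp

lemma E_diag_a_elt:
  assumes "j \<in> {1..m}" "x \<in> {1..m}"
  shows "E j j * a_elt x = a_elt x * E j j"
proof -
  have "1 \<in> {1..m}" using assms by auto
  then show ?thesis using E_diag_commute assms
    by (simp add: a_elt_def algebra_simps of_nat_mult mult_of_nat_commute
        mult_2 mult_2_right)
qed

lemma E_diag_A_elt:
  assumes "j \<in> {1..m}" "x \<le> m"
  shows "E j j * A_elt y x = A_elt y x * E j j"
proof -
  have "E j j * prod_list (map a_elt zs) = prod_list (map a_elt zs) * E j j"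
    if "set zs \<subseteq> {1..m}" for zs
    using that
  proof (induction zs)
    case (Cons z zs)
    then show ?case using E_diag_a_elt[of j z] assms
      by simp (metis mult.assoc)
  qed simp
  from this[of "[Suc y..<x]"] show ?thesis
    using assms unfolding A_elt_def by force
qed

lemma A_elt_Suc: "y < x \<Longrightarrow> A_elt y (Suc x) = A_elt y x * a_elt x"
  by (simp add: A_elt_def)

lemma A_elt_empty: "A_elt x (Suc x) = 1"
  by (simp add: A_elt_def)

text \<open>The weight is eps_x - eps_1: in each summand of \<open>T_rec\<close> the weights of
  \<open>E x y\<close> and \<open>T y\<close> telescope, and the factors \<open>A_elt\<close> have
  weight 0.\<close>

lemma E_diag_T:
  assumes "j \<in> {1..m}" "x \<in> {1..m}"
  shows "E j j * T x = T x * E j j + (if j = x then T x else 0) - (if j = 1 then T x else 0)"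
  using assms(2)
proof (induction x rule: less_induct)
  case (less x)
  show ?case
  proof (cases "x = 1")
    case True
    then show ?thesis by (simp add: T_1)
  next
    case False
    with less.prems have x: "1 < x" by simp
    have "E j j * (E x y * T y * A_elt y x) = E x y * T y * A_elt y x * E j j
       + (if j = x then E x y * T y * A_elt y x else 0) - (if j = 1 then E x y * T y * A_elt y x else 0)"
      if y: "y \<in> {1..<x}" for y
    proof -
      have ym: "y \<in> {1..m}" using y less.prems by auto
      have c: "E j j * E x y = E x y * E j j + (if j = x then E x y else 0) - (if y = j then E x y else 0)"
        using comm[of j j x y] assms ym less.prems by auto
      have "E j j * (E x y * T y * A_elt y x) = (E j j * E x y) * T y * A_elt y x"
        by (simp add: mult.assoc)
      also have "\<dots> = E x y * (E j j * T y) * A_elt y x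
         + (if j = x then E x y else 0) * T y * A_elt y x - (if y = j then E x y else 0) * T y * A_elt y x"
        unfolding c by (simp add: algebra_simps)
      also have "E j j * T y = T y * E j j + (if j = y then T y else 0) - (if j = 1 then T y else 0)"
        using less.IH[of y] y ym by simp
      also have "E x y * \<dots> * A_elt y x = E x y * T y * (E j j * A_elt y x)
         + (if j = y then E x y * T y * A_elt y x else 0) - (if j = 1 then E x y * T y * A_elt y x else 0)"
        by (simp add: algebra_simps)
      also have "E j j * A_elt y x = A_elt y x * E j j"
        using E_diag_A_elt assms less.prems by simp
      finally have "E j j * (E x y * T y * A_elt y x)
          = E x y * T y * (A_elt y x * E j j)
           + (if j = y then E x y * T y * A_elt y x else 0) - (if j = 1 then E x y * T y * A_elt y x else 0)
           + (if j = x then E x y * T y * A_elt y x else 0)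
           - (if y = j then E x y * T y * A_elt y x else 0)"
        by (simp only: if_zero_mult)
      then show ?thesis by (simp add: mult.assoc eq_commute[of y j])
    qed
    then show ?thesis
      unfolding T_rec[OF x] sum_distrib_left sum_distrib_right
      by (simp add: sum.distrib sum_subtractf)
  qed
qed

section \<open>The left ideal generated by the raising operators\<close>

inductive_set nil_ideal :: "'a set" where
  zero: "0 \<in> nil_ideal"
| gen: "\<lbrakk>1 \<le> i; i < j; j \<le> m\<rbrakk> \<Longrightarrow> u * E i j \<in> nil_ideal"
| add: "x \<in> nil_ideal \<Longrightarrow> y \<in> nil_ideal \<Longrightarrow> x + y \<in> nil_ideal"

lemma left_ideal_nil_ideal: "left_ideal_set nil_ideal"
proof -
  have "u * x \<in> nil_ideal" if "x \<in> nil_ideal" for u x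
    using that by induction (auto simp: distrib_left mult.assoc[symmetric] intro: nil_ideal.intros)
  then show ?thesis by (auto simp: left_ideal_set_def intro: nil_ideal.intros)
qed

lemma nil_ideal_least:
  assumes "left_ideal_set L" "\<And>i j. \<lbrakk>1 \<le> i; i < j; j \<le> m\<rbrakk> \<Longrightarrow> E i j \<in> L"
  shows "nil_ideal \<subseteq> L"
proof
  fix x assume "x \<in> nil_ideal"
  then show "x \<in> L"
    by induction (use assms in \<open>auto intro: left_ideal_setD\<close>)
qed

lemmas nil_idealD = left_ideal_setD[OF left_ideal_nil_ideal]

text \<open>Brackets of diagonal elements with n^+ stay in n^+, so the left ideal is also stable
  under diagonal elements on the right. That is where the factors \<open>A_elt\<close> of
  \<open>T_rec\<close> stand.\<close>

lemma nil_ideal_right_E_diag: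
  assumes "x \<in> nil_ideal" "k \<in> {1..m}"
  shows "x * E k k \<in> nil_ideal"
  using assms(1)
proof induction
  case (gen i j u)
  have "E i j * E k k = E k k * E i j + (if j = k then E i j else 0) - (if k = i then E i j else 0)"
    using comm[of i j k k] gen assms by auto
  then have "u * E i j * E k k = u * (E k k * E i j + (if j = k then E i j else 0)
     - (if k = i then E i j else 0))"
    by (simp only: mult.assoc)
  then have "u * E i j * E k k = u * E k k * E i j + (if j = k then u * E i j else 0)
     - (if k = i then u * E i j else 0)"
    by (simp add: distrib_left right_diff_distrib mult.assoc)
  then show ?case
    using nil_ideal.gen[OF gen, of "u * E k k"] nil_ideal.gen[OF gen, of u]
    by (cases "j = k"; cases "k = i") (simp_all add: nil_idealD(2,5))
qed (auto simp: distrib_right intro: nil_ideal.intros)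

lemma nil_ideal_right_of_nat:
  assumes "x \<in> nil_ideal"
  shows "x * of_nat n \<in> nil_ideal"
  using nil_idealD(3)[OF assms] by (simp add: mult_of_nat_commute[symmetric])

lemma nil_ideal_right_a_elt:
  assumes "x \<in> nil_ideal" "k \<in> {1..m}"
  shows "x * a_elt k \<in> nil_ideal"
proof -
  have "1 \<in> {1..m}" using assms by auto
  then have "x * E 1 1 - x * E k k + x * of_nat k - x * of_nat 2 \<in> nil_ideal"
    by (intro nil_idealD(2,5) nil_ideal_right_E_diag nil_ideal_right_of_nat assms)
  then show ?thesis by (simp add: a_elt_def algebra_simps)
qed

lemma nil_ideal_right_A_elt:
  assumes "u \<in> nil_ideal" "x \<le> m"
  shows "u * A_elt y x \<in> nil_ideal"
proof -
  have "u * prod_list (map a_elt zs) \<in> nil_ideal" if "set zs \<subseteq> {1..m}" "u \<in> nil_ideal" for zs u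
    using that
    by (induction zs arbitrary: u)
      (auto simp: mult.assoc[symmetric] intro: nil_ideal_right_a_elt[simplified])
  from this[of "[Suc y..<x]" u] show ?thesis
    using assms unfolding A_elt_def by force
qed

text \<open>Moving \<open>E k (Suc k)\<close> past \<open>E x y\<close> produces commutators only
  for \<open>Suc k = x\<close> and for \<open>y = k\<close>. If \<open>Suc k < x\<close>, the term
  \<open>y = k\<close> cancels what the induction hypothesis gives at \<open>y = Suc k\<close>; if
  \<open>Suc k = x\<close>, the remaining terms assemble to \<open>T k * a_elt x\<close>.\<close>

lemma simple_root_T:
  assumes "x \<in> {1..m}" "1 \<le> k" "k < m"
  shows "E k (Suc k) * T x - (if Suc k = x then T k * a_elt x else 0) \<in> nil_ideal"
  using assms(1)
proof (induction x rule: less_induct)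
  case (less x)
  show ?case
  proof (cases "x = 1")
    case True
    then show ?thesis using assms nil_ideal.gen[of k "Suc k" 1] by (simp add: T_1)
  next
    case False
    with less.prems have x: "1 < x" "x \<le> m" by auto
    \<comment> \<open>\<open>R y\<close> is the error term of the induction hypothesis, an element
      of the ideal. Keeping it as a summand makes the rest an exact identity.\<close>
    define R where "R y = E k (Suc k) * T y - (if Suc k = y then T k * a_elt y else 0)" for y
    have R: "R y \<in> nil_ideal" if "y \<in> {1..<x}" for y
      using less.IH[of y] that x by (auto simp: R_def)
    have "E k (Suc k) * (E x y * T y * A_elt y x)
        = E x y * R y * A_elt y x + (if Suc k = y then E x y * T k * a_elt y * A_elt y x else 0)
        + (if Suc k = x then E k y * T y * A_elt y x else 0)
        - (if k = y then E x (Suc k) * T k * A_elt k x else 0)"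
      if y: "y \<in> {1..<x}" for y
    proof -
      have c: "E k (Suc k) * E x y = E x y * E k (Suc k)
         + (if Suc k = x then E k y else 0) - (if k = y then E x (Suc k) else 0)"
        using comm[of k "Suc k" x y] assms x y by auto
      have "E k (Suc k) * (E x y * T y * A_elt y x) = (E k (Suc k) * E x y) * T y * A_elt y x"
        by (simp add: mult.assoc)
      also have "\<dots> = E x y * (E k (Suc k) * T y) * A_elt y x
         + (if Suc k = x then E k y else 0) * T y * A_elt y x
         - (if k = y then E x (Suc k) else 0) * T y * A_elt y x"
        unfolding c by (simp add: algebra_simps)
      also have "E k (Suc k) * T y = R y + (if Suc k = y then T k * a_elt y else 0)"
        by (simp add: R_def)
      finally have "E k (Suc k) * (E x y * T y * A_elt y x)
        = E x y * (R y + (if Suc k = y then T k * a_elt y else 0)) * A_elt y x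
         + (if Suc k = x then E k y * T y * A_elt y x else 0)
         - (if k = y then E x (Suc k) * T y * A_elt y x else 0)"
        by (simp only: if_zero_mult)
      moreover have "E x y * (R y + (if Suc k = y then T k * a_elt y else 0)) * A_elt y x
        = E x y * R y * A_elt y x + (if Suc k = y then E x y * T k * a_elt y * A_elt y x else 0)"
        by (simp add: distrib_left distrib_right mult.assoc)
      moreover have "(if k = y then E x (Suc k) * T y * A_elt y x else 0)
        = (if k = y then E x (Suc k) * T k * A_elt k x else 0)"
        by simp
      ultimately show ?thesis by (simp only:)
    qed
    then have "E k (Suc k) * T x = (\<Sum>y\<in>{1..<x}. E x y * R y * A_elt y x
        + (if Suc k = y then E x y * T k * a_elt y * A_elt y x else 0)
        + (if Suc k = x then E k y * T y * A_elt y x else 0)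
        - (if k = y then E x (Suc k) * T k * A_elt k x else 0))"
      unfolding T_rec[OF x(1)] sum_distrib_left by (intro sum.cong refl) blast
    also have "\<dots> = (\<Sum>y\<in>{1..<x}. E x y * R y * A_elt y x)
        + (if Suc k < x then E x (Suc k) * T k * (a_elt (Suc k) * A_elt (Suc k) x) else 0)
        + (if Suc k = x then \<Sum>y\<in>{1..<x}. E k y * T y * A_elt y x else 0)
        - (if k < x then E x (Suc k) * T k * A_elt k x else 0)"
      using assms by (auto simp: sum.distrib sum_subtractf mult.assoc)
    finally have eq: "E k (Suc k) * T x = (\<Sum>y\<in>{1..<x}. E x y * R y * A_elt y x)
        + (if Suc k < x then E x (Suc k) * T k * (a_elt (Suc k) * A_elt (Suc k) x) else 0)
        + (if Suc k = x then \<Sum>y\<in>{1..<x}. E k y * T y * A_elt y x else 0)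
        - (if k < x then E x (Suc k) * T k * A_elt k x else 0)" .
    have S: "(\<Sum>y\<in>{1..<x}. E x y * R y * A_elt y x) \<in> nil_ideal"
      using R x by (intro left_ideal_set_sum[OF left_ideal_nil_ideal] nil_ideal_right_A_elt nil_idealD(3))
    have "E k (Suc k) * T x - (if Suc k = x then T k * a_elt x else 0)
        = (\<Sum>y\<in>{1..<x}. E x y * R y * A_elt y x)"
    proof -
      consider "x \<le> k" | "Suc k < x" | "x = Suc k" by linarith
      then show ?thesis
      proof cases
        case 1
        then show ?thesis by (simp add: eq)
      next
        \<comment> \<open>The contributions of \<open>y = Suc k\<close> and \<open>y = k\<close> are
          opposite: the former receives the factor \<open>a_elt (Suc k)\<close> from the induction
          hypothesis, the latter has it as the leading factor of \<open>A_elt k x\<close>.\<close>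
        case 2
        have "[Suc k..<x] = Suc k # [Suc (Suc k)..<x]"
          using 2 by (rule upt_conv_Cons)
        then have "A_elt k x = a_elt (Suc k) * A_elt (Suc k) x"
          by (simp add: A_elt_def)
        then show ?thesis using 2 by (simp add: eq)
      next
        case 3
        have km: "k \<in> {1..m}" "x \<in> {1..m}" using assms less.prems by auto
        have "(\<Sum>y\<in>{1..<x}. E k y * T y * A_elt y x)
            = (\<Sum>y\<in>{1..<k}. E k y * T y * A_elt y x) + E k k * T k"
          using assms 3 by (simp add: A_elt_empty)
        \<comment> \<open>Compared with the recursion for \<open>T k\<close>, every product carries
          one more factor \<open>a_elt k\<close> at its end. For \<open>k = 1\<close> the sum is
          empty and the recursion does not apply, hence the case distinction below.\<close>
        also have "(\<Sum>y\<in>{1..<k}. E k y * T y * A_elt y x) = (\<Sum>y\<in>{1..<k}. E k y * T y * A_elt y k) * a_elt k"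
          unfolding sum_distrib_right 3 by (intro sum.cong) (auto simp: A_elt_Suc mult.assoc)
        also have "\<dots> = (if k = 1 then 0 else T k * a_elt k)"
          using T_rec[of k] assms by auto
        also have "E k k * T k = T k * E k k + (if k = 1 then 0 else T k)"
          using E_diag_T[OF km(1) km(1)] by simp
        finally have s: "(\<Sum>y\<in>{1..<x}. E k y * T y * A_elt y x)
          = (if k = 1 then 0 else T k * a_elt k) + (T k * E k k + (if k = 1 then 0 else T k))" .
        have t: "E x x * T k = T k * E x x"
          using E_diag_T[OF km(2) km(1)] 3 assms by simp
        \<comment> \<open>The weight of \<open>T k\<close> contributes the 1 that turns the constant
          \<open>k - 2\<close> of \<open>a_elt k\<close> into the constant of
          \<open>a_elt x\<close>. For \<open>k = 1\<close> both corrections are absent, in agreement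
          with \<open>a_elt 1 = -1\<close>.\<close>
        have "(if k = 1 then 0 else T k * a_elt k) + (T k * E k k + (if k = 1 then 0 else T k)) - T k * E x x
           = T k * a_elt x"
          unfolding a_elt_def 3 by (simp add: algebra_simps mult_2 mult_2_right)
        then show ?thesis unfolding eq s using 3 by (simp add: A_elt_empty t[unfolded 3])
      qed
    qed
    then show ?thesis using S by simp
  qed
qed

text \<open>The simple root vectors generate n^+, by e_{i,j+1} = [e_{i,j}, e_{j,j+1}], and the
  elements that multiply \<open>t\<close> into a left ideal are closed under commutators.\<close>

lemma pos_root_mult_mem:
  assumes L: "left_ideal_set L"
    and simple: "\<And>k. 1 \<le> k \<Longrightarrow> k < m \<Longrightarrow> E k (Suc k) * t \<in> L"
    and "1 \<le> i" "i < j" "j \<le> m"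
  shows "E i j * t \<in> L"
  using assms(4,5)
proof (induction j)
  case (Suc j)
  show ?case
  proof (cases "i = j")
    case True
    then show ?thesis using simple[of j] assms(3) Suc by simp
  next
    case False
    then have IH: "E i j * t \<in> L" using Suc by simp
    have s: "E j (Suc j) * t \<in> L" using simple Suc assms(3) False by simp
    have "E i j * E j (Suc j) = E j (Suc j) * E i j + E i (Suc j)"
      using comm[of i j j "Suc j"] assms(3) Suc False by simp
    then have "E i (Suc j) = E i j * E j (Suc j) - E j (Suc j) * E i j" by simp
    then have "E i (Suc j) * t = E i j * (E j (Suc j) * t) - E j (Suc j) * (E i j * t)"
      by (simp add: left_diff_distrib mult.assoc)
    then show ?thesis using IH s L by (simp add: left_ideal_setD)
  qed
qed simp

end


section \<open>A model of the highest weight modules\<close>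

text \<open>
  A vector \<open>F\<close> of \<open>fock\<close> is the linear functional on polynomials whose value on the monomial with
  exponents \<open>a\<close> is \<open>F a\<close>.  The transposes of multiplication by the variable \<open>i\<close> and of the
  derivative in that variable are the operators \<open>up_op i\<close> and \<open>down_op i\<close> below.
\<close>

type_synonym 'i fock = "('i \<Rightarrow> nat) \<Rightarrow> complex"

text \<open>Additivity is what makes composition distribute over pointwise sums from the left;
  homogeneity makes \<open>scale_op\<close> central.\<close>

typedef 'i fock_op = "{f :: 'i fock \<Rightarrow> 'i fock.
    (\<forall>x y. f (\<lambda>a. x a + y a) = (\<lambda>a. f x a + f y a)) \<and> (\<forall>c x. f (\<lambda>a. c * x a) = (\<lambda>a. c * f x a))}"
  by (rule exI[of _ "\<lambda>_ _. 0"]) simp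

setup_lifting type_definition_fock_op

instantiation fock_op :: (type) ring_1
begin
lift_definition zero_fock_op :: "'a fock_op" is "\<lambda>_ _. 0" by simp
lift_definition one_fock_op :: "'a fock_op" is "\<lambda>x. x" by simp
lift_definition plus_fock_op :: "'a fock_op \<Rightarrow> 'a fock_op \<Rightarrow> 'a fock_op"
  is "\<lambda>f g x a. f x a + g x a" by (simp add: algebra_simps)
lift_definition minus_fock_op :: "'a fock_op \<Rightarrow> 'a fock_op \<Rightarrow> 'a fock_op"
  is "\<lambda>f g x a. f x a - g x a" by (simp add: algebra_simps)
lift_definition uminus_fock_op :: "'a fock_op \<Rightarrow> 'a fock_op"
  is "\<lambda>f x a. - f x a" by simp
lift_definition times_fock_op :: "'a fock_op \<Rightarrow> 'a fock_op \<Rightarrow> 'a fock_op"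
  is "\<lambda>f g x. f (g x)" by simp
instance
proof
  show "(0::'a fock_op) \<noteq> 1"
    by transfer (auto simp: fun_eq_iff intro!: exI[of _ "\<lambda>_. 1"])
qed (transfer; simp add: algebra_simps fun_eq_iff)+
end

lift_definition op_apply :: "'i fock_op \<Rightarrow> 'i fock \<Rightarrow> 'i fock" is "\<lambda>f. f" .

lift_definition scale_op :: "complex \<Rightarrow> 'i fock_op" is "\<lambda>c x a. c * x a"
  by (simp add: algebra_simps)

lift_definition up_op :: "'i \<Rightarrow> 'i fock_op" is "\<lambda>i x a. x (a(i := a i + 1))"
  by simp

lift_definition down_op :: "'i \<Rightarrow> 'i fock_op" is "\<lambda>i x a. of_nat (a i) * x (a(i := a i - 1))"
  by (simp add: algebra_simps)

section \<open>Weyl algebra relations for the transposed operators\<close>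

lemma up_up: "up_op i * up_op j = up_op j * up_op i"
proof (cases "i = j")
  case False
  then show ?thesis by transfer (simp add: fun_eq_iff fun_upd_twist)
qed simp

lemma down_down: "down_op i * down_op j = down_op j * down_op i"
proof (cases "i = j")
  case False
  then show ?thesis by transfer (simp add: fun_eq_iff fun_upd_twist)
qed simp

lemma up_down: "up_op i * down_op j = down_op j * up_op i + (if i = j then 1 else 0)"
proof (cases "i = j")
  case True
  have "up_op j * down_op j = down_op j * up_op j + 1"
  proof transfer
    fix j :: 'a
    show "(\<lambda>x a. of_nat ((a(j := a j + 1)) j) * x ((a(j := a j + 1))(j := (a(j := a j + 1)) j - 1)))
      = (\<lambda>x a. of_nat (a j) * x ((a(j := a j - 1))(j := (a(j := a j - 1)) j + 1)) + x a :: complex)"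
    proof (intro ext)
      fix x :: "'a fock" and a
      show "of_nat ((a(j := a j + 1)) j) * x ((a(j := a j + 1))(j := (a(j := a j + 1)) j - 1))
        = of_nat (a j) * x ((a(j := a j - 1))(j := (a(j := a j - 1)) j + 1)) + x a"
        \<comment> \<open>At exponent 0 truncated subtraction does not lead back to
          \<open>a\<close>, but there the factor \<open>of_nat (a j)\<close> vanishes.\<close>
        by (cases "a j = 0") (simp_all add: algebra_simps fun_upd_idem)
    qed
  qed
  then show ?thesis using True by simp
next
  case False
  then have "up_op i * down_op j = down_op j * up_op i"
    by transfer (auto simp: fun_eq_iff fun_upd_twist)
  then show ?thesis using False by simp
qed

lemma scale_op_central: "scale_op c * x = x * scale_op c"
  by transfer (auto simp: fun_eq_iff)

lemma scale_op_hom: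
  "scale_op 1 = 1" "scale_op 0 = 0" "scale_op (c + d) = scale_op c + scale_op d"
  "scale_op (c * d) = scale_op c * scale_op d"
  by (transfer; simp add: algebra_simps fun_eq_iff)+

lemma op_apply_simps:
  "op_apply (x + y) f = (\<lambda>a. op_apply x f a + op_apply y f a)"
  "op_apply (x - y) f = (\<lambda>a. op_apply x f a - op_apply y f a)"
  "op_apply (x * y) f = op_apply x (op_apply y f)"
  "op_apply 0 f = (\<lambda>a. 0)"
  "op_apply 1 f = f"
  "op_apply (scale_op c) f = (\<lambda>a. c * f a)"
  "op_apply (up_op i) f = (\<lambda>a. f (a(i := a i + 1)))"
  "op_apply (down_op i) f = (\<lambda>a. of_nat (a i) * f (a(i := a i - 1)))"
  by (transfer; simp)+

lemma op_apply_zero: "op_apply x (\<lambda>a. 0) = (\<lambda>a. 0)"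
  using op_apply_simps(3)[of x 0 "\<lambda>_. 0"] by (simp add: op_apply_simps(4))

lemma op_apply_sum: "op_apply (sum g S) f = (\<lambda>a. \<Sum>i\<in>S. op_apply (g i) f a)"
  by (induction S rule: infinite_finite_induct) (simp_all add: op_apply_simps)

type_synonym vec_op = "(nat \<times> nat \<times> nat) fock_op"

text \<open>
  For fixed \<open>k\<close> the variables \<open>(k, p, q)\<close> with \<open>q \<le> k < p\<close> are the entries of the matrix \<open>Z\<close> in the big
  cell of the Grassmannian of \<open>k\<close>-dimensional subspaces.  A matrix with blocks \<open>A\<close>, \<open>B\<close>, \<open>C\<close>, \<open>D\<close> acts on
  functions of \<open>Z\<close> by the vector field \<open>C + D Z - Z A - Z B Z\<close> and the multiplier \<open>c k * tr (A + B Z)\<close>;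
  the operators \<open>gl_op_block m c k i j\<close> are the transposes for matrix units.
\<close>

definition coord :: "nat \<Rightarrow> nat \<Rightarrow> nat \<Rightarrow> vec_op" where
  "coord k j q = (if j \<le> k then if j = q then 1 else 0 else up_op (k, j, q))"

text \<open>Consider functions f of m x k matrices X with f(X g) = det(g)^c f(X) for g in GL_k; the
  operators sum_q x_{j,q} d/dx_{i,q} preserve them. On the slice where the top k rows of X form the
  identity, differentiating this equivariance expresses the derivatives in the top rows through
  those in the entries of Z. \<open>coord\<close> and \<open>mom\<close> are the transposes of
  x_{j,q} and d/dx_{i,q} on the slice.\<close>

definition mom :: "nat \<Rightarrow> (nat \<Rightarrow> complex) \<Rightarrow> nat \<Rightarrow> nat \<Rightarrow> nat \<Rightarrow> vec_op" where
  "mom m c k i q = (if i \<le> k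
     then scale_op (if i = q then c k else 0) - (\<Sum>p\<in>{k<..m}. down_op (k, p, q) * up_op (k, p, i))
     else down_op (k, i, q))"

definition gl_op_block :: "nat \<Rightarrow> (nat \<Rightarrow> complex) \<Rightarrow> nat \<Rightarrow> nat \<Rightarrow> nat \<Rightarrow> vec_op" where
  "gl_op_block m c k i j = (\<Sum>q\<in>{1..k}. mom m c k i q * coord k j q)"

definition gl_op :: "nat \<Rightarrow> (nat \<Rightarrow> complex) \<Rightarrow> nat \<Rightarrow> nat \<Rightarrow> vec_op" where
  "gl_op m c i j = (\<Sum>k\<in>{1..m}. gl_op_block m c k i j)"

section \<open>Commutators of coordinates and derivatives on a big cell\<close>

lemma coord_coord: "coord k j q * coord k' t s = coord k' t s * coord k j q"
  by (simp add: coord_def up_up)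

lemma up_quad:
  "up_op x * (down_op y * up_op z) = down_op y * up_op z * up_op x + (if x = y then up_op z else 0)"
proof -
  have "up_op x * (down_op y * up_op z) = (up_op x * down_op y) * up_op z" by (simp add: mult.assoc)
  also have "\<dots> = down_op y * (up_op x * up_op z) + (if x = y then up_op z else 0)"
    by (simp add: up_down distrib_right mult.assoc)
  finally show ?thesis by (simp add: up_up[of x z] mult.assoc)
qed

lemma quad_down:
  "down_op y * up_op z * down_op x = down_op x * (down_op y * up_op z) + (if x = z then down_op y else 0)"
proof -
  have "down_op y * up_op z * down_op x = down_op y * (up_op z * down_op x)" by (simp add: mult.assoc)
  also have "\<dots> = (down_op y * down_op x) * up_op z + (if x = z then down_op y else 0)"
    by (simp add: up_down distrib_left mult.assoc)
  finally show ?thesis by (simp add: down_down[of y x] mult.assoc)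
qed

text \<open>The products \<open>down_op y * up_op z\<close> satisfy the bracket relations of matrix
  units with indices \<open>y\<close>, \<open>z\<close>.\<close>

lemma quad_quad:
  "(down_op y * up_op z) * (down_op x * up_op w) = (down_op x * up_op w) * (down_op y * up_op z)
     + (if z = x then down_op y * up_op w else 0) - (if w = y then down_op x * up_op z else 0)"
proof -
  have "(down_op y * up_op z) * (down_op x * up_op w) = (down_op y * up_op z * down_op x) * up_op w"
    by (simp add: mult.assoc)
  also have "\<dots> = down_op x * down_op y * (up_op z * up_op w) + (if z = x then down_op y * up_op w else 0)"
    unfolding quad_down by (simp add: distrib_right mult.assoc eq_commute[of x z])
  also have "down_op x * down_op y * (up_op z * up_op w) = down_op x * (down_op y * up_op w) * up_op z"
    by (simp add: up_up[of z w] mult.assoc)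
  also have "\<dots> = down_op x * (up_op w * down_op y - (if w = y then 1 else 0)) * up_op z"
    by (simp add: up_down)
  also have "\<dots> = (down_op x * up_op w) * (down_op y * up_op z) - (if w = y then down_op x * up_op z else 0)"
    by (simp add: left_diff_distrib right_diff_distrib mult.assoc)
  finally show ?thesis by simp
qed

lemma sum_commute:
  fixes f :: "'b \<Rightarrow> 'a::ring_1"
  assumes "\<And>i. i \<in> S \<Longrightarrow> x * f i = f i * x + g i"
  shows "x * sum f S = sum f S * x + sum g S"
  using assms by (simp add: sum_distrib_left sum_distrib_right sum.distrib)

lemma scale_diff_comm:
  assumes "x * y = y * x + z"
  shows "(scale_op c - x) * y = y * (scale_op c - x) - z"
    and "(scale_op c - x) * (scale_op d - y) = (scale_op d - y) * (scale_op c - x) + z"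
proof -
  have "scale_op c * y = y * scale_op c" "scale_op d * x = x * scale_op d"
    "scale_op c * scale_op d = scale_op d * scale_op c"
    by (rule scale_op_central)+
  then show "(scale_op c - x) * y = y * (scale_op c - x) - z"
    "(scale_op c - x) * (scale_op d - y) = (scale_op d - y) * (scale_op c - x) + z"
    using assms by (simp_all add: left_diff_distrib right_diff_distrib)
qed

lemma mom_le:
  "i \<le> k \<Longrightarrow> mom m c k i q
    = scale_op (if i = q then c k else 0) - (\<Sum>p\<in>{k<..m}. down_op (k, p, q) * up_op (k, p, i))"
  and mom_gt: "\<not> i \<le> k \<Longrightarrow> mom m c k i q = down_op (k, i, q)"
  by (simp_all only: mom_def if_True if_False)

lemma coord_mom_other:
  assumes "k \<noteq> k'"
  shows "coord k j q * mom m c k' i s = mom m c k' i s * coord k j q"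
proof -
  have "up_op (k, j, q) * mom m c k' i s = mom m c k' i s * up_op (k, j, q)"
  proof (cases "i \<le> k'")
    case True
    have "(\<Sum>p\<in>{k'<..m}. down_op (k', p, s) * up_op (k', p, i)) * up_op (k, j, q)
      = up_op (k, j, q) * (\<Sum>p\<in>{k'<..m}. down_op (k', p, s) * up_op (k', p, i)) + 0"
      unfolding sum_distrib_left sum_distrib_right using assms by (simp add: up_quad)
    from scale_diff_comm(1)[OF this] show ?thesis
      by (simp only: mom_le[OF True] diff_0_right)
  next
    case False
    then show ?thesis using assms by (simp add: mom_gt up_down)
  qed
  then show ?thesis by (simp add: coord_def)
qed

lemma mom_mom_other:
  assumes "k \<noteq> k'"
  shows "mom m c k j q * mom m c k' i s = mom m c k' i s * mom m c k j q"
proof -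
  have 1: "(\<Sum>p\<in>P. down_op (k, p, q) * up_op (k, p, j)) * down_op (k', i, s)
     = down_op (k', i, s) * (\<Sum>p\<in>P. down_op (k, p, q) * up_op (k, p, j))"
    if "k \<noteq> k'" for P and k k' i j q s :: nat
    unfolding sum_distrib_left sum_distrib_right using that by (simp add: quad_down)
  have 2: "(\<Sum>p\<in>P. down_op (k, p, q) * up_op (k, p, j)) * (\<Sum>p\<in>P'. down_op (k', p, s) * up_op (k', p, i))
     = (\<Sum>p\<in>P'. down_op (k', p, s) * up_op (k', p, i)) * (\<Sum>p\<in>P. down_op (k, p, q) * up_op (k, p, j))"
    for P P'
  proof -
    have "down_op (k, p, q) * up_op (k, p, j) * (down_op (k', r, s) * up_op (k', r, i))
      = down_op (k', r, s) * up_op (k', r, i) * (down_op (k, p, q) * up_op (k, p, j))" for p r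
      using quad_quad[of "(k, p, q)"] assms by simp
    then show ?thesis
      unfolding sum_product by (subst sum.swap) (intro sum.cong refl)
  qed
  consider "j \<le> k" "i \<le> k'" | "j \<le> k" "\<not> i \<le> k'" | "\<not> j \<le> k" "i \<le> k'" | "\<not> j \<le> k" "\<not> i \<le> k'"
    by blast
  then show ?thesis
  proof cases
    case 1
    then show ?thesis
      using scale_diff_comm(2)[of _ _ 0, unfolded add_0_right, OF 2] by (simp only: mom_le)
  next
    case 2
    then show ?thesis
      using scale_diff_comm(1)[of _ _ 0, unfolded add_0_right diff_0_right, OF 1[of k k']] assms
      by (simp only: mom_le mom_gt simp_thms)
  next
    case 3
    then show ?thesis
      using scale_diff_comm(1)[of _ _ 0, unfolded add_0_right diff_0_right, OF 1[of k' k]] assms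
      by (simp only: mom_le mom_gt simp_thms)
  next
    case 4
    then show ?thesis by (simp only: mom_gt down_down simp_thms)
  qed
qed

text \<open>On all m x k matrices the commutator would be 1 for \<open>i = j\<close>,
  \<open>q = s\<close> and 0 otherwise. The extra term stems from the derivatives in the top rows;
  it makes the commutator vanish for \<open>j \<le> k\<close>, where the coordinate is
  constant.\<close>

lemma coord_mom:
  assumes "q \<in> {1..k}" "s \<in> {1..k}" "j \<in> {1..m}" "i \<in> {1..m}"
  shows "coord k j q * mom m c k i s = mom m c k i s * coord k j q
      + (if q = s then (if i = j then 1 else 0) - (if i \<le> k then coord k j i else 0) else 0)"
proof (cases "j \<le> k")
  case True
  then show ?thesis by (auto simp: coord_def)
next
  case False
  show ?thesis
  proof (cases "i \<le> k")
    case True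
    have "up_op (k, j, q) * (\<Sum>p\<in>{k<..m}. down_op (k, p, s) * up_op (k, p, i))
       = (\<Sum>p\<in>{k<..m}. down_op (k, p, s) * up_op (k, p, i)) * up_op (k, j, q)
       + (\<Sum>p\<in>{k<..m}. if p = j then if q = s then up_op (k, j, i) else 0 else 0)"
      by (intro sum_commute) (auto simp: up_quad)
    moreover have "j \<in> {k<..m}" using False assms by auto
    ultimately have "(\<Sum>p\<in>{k<..m}. down_op (k, p, s) * up_op (k, p, i)) * up_op (k, j, q)
       = up_op (k, j, q) * (\<Sum>p\<in>{k<..m}. down_op (k, p, s) * up_op (k, p, i))
         + - (if q = s then up_op (k, j, i) else 0)"
      by simp
    from scale_diff_comm(1)[OF this] show ?thesis
      using True False by (auto simp: coord_def mom_le)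
  next
    case False
    then show ?thesis using \<open>\<not> j \<le> k\<close> by (auto simp: coord_def mom_gt up_down)
  qed
qed

text \<open>Restriction to the slice destroys commutativity of the derivatives: for
  \<open>i \<le> k\<close> the operator \<open>mom m c k i q\<close> is, up to sign and a scalar,
  the transpose of an infinitesimal column operation on Z.\<close>

lemma mom_mom:
  assumes "q \<in> {1..k}" "s \<in> {1..k}" "j \<in> {1..m}" "i \<in> {1..m}"
  shows "mom m c k i q * mom m c k j s = mom m c k j s * mom m c k i q
      + (if j = q then mom m c k i s else 0) - (if i = s then mom m c k j q else 0)"
proof -
  let ?S = "\<lambda>q i. (\<Sum>p\<in>{k<..m}. down_op (k, p, q) * up_op (k, p, i))"
  have 1: "?S q i * down_op (k, r, s) = down_op (k, r, s) * ?S q i + (if i = s then down_op (k, r, q) else 0)"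
    if "r \<in> {k<..m}" for q i r s
  proof -
    have "?S q i * down_op (k, r, s) = (\<Sum>p\<in>{k<..m}. down_op (k, r, s) * (down_op (k, p, q) * up_op (k, p, i))
        + (if p = r then if i = s then down_op (k, r, q) else 0 else 0))"
      unfolding sum_distrib_right by (intro sum.cong) (auto simp: quad_down)
    then show ?thesis using that by (simp add: sum.distrib sum_distrib_left)
  qed
  have 2: "?S q i * ?S s j = ?S s j * ?S q i + (if i = s then ?S q j else 0) - (if j = q then ?S s i else 0)"
  proof -
    have "?S q i * ?S s j = (\<Sum>p\<in>{k<..m}. \<Sum>r\<in>{k<..m}.
        (down_op (k, r, s) * up_op (k, r, j)) * (down_op (k, p, q) * up_op (k, p, i))
        + (if r = p then if i = s then down_op (k, p, q) * up_op (k, p, j) else 0 else 0)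
        - (if r = p then if j = q then down_op (k, p, s) * up_op (k, p, i) else 0 else 0))"
      unfolding sum_product by (intro sum.cong refl, subst quad_quad) auto
    also have "\<dots> = (\<Sum>p\<in>{k<..m}. \<Sum>r\<in>{k<..m}.
        (down_op (k, r, s) * up_op (k, r, j)) * (down_op (k, p, q) * up_op (k, p, i)))
        + (\<Sum>p\<in>{k<..m}. if i = s then down_op (k, p, q) * up_op (k, p, j) else 0)
        - (\<Sum>p\<in>{k<..m}. if j = q then down_op (k, p, s) * up_op (k, p, i) else 0)"
      by (simp add: sum.distrib sum_subtractf)
    also have "(\<Sum>p\<in>{k<..m}. \<Sum>r\<in>{k<..m}.
        (down_op (k, r, s) * up_op (k, r, j)) * (down_op (k, p, q) * up_op (k, p, i))) = ?S s j * ?S q i"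
      unfolding sum_product by (rule sum.swap)
    finally show ?thesis by simp
  qed
  consider "i \<le> k" "j \<le> k" | "i \<le> k" "\<not> j \<le> k" | "\<not> i \<le> k" "j \<le> k" | "\<not> i \<le> k" "\<not> j \<le> k" by blast
  then show ?thesis
  proof cases
    case 1
    then have m: "mom m c k i q = scale_op (if i = q then c k else 0) - ?S q i"
      "mom m c k j s = scale_op (if j = s then c k else 0) - ?S s j"
      "mom m c k i s = scale_op (if i = s then c k else 0) - ?S s i"
      "mom m c k j q = scale_op (if j = q then c k else 0) - ?S q j"
      by (simp_all only: mom_def if_True)
    have e: "(if j = q then mom m c k i s else 0) - (if i = s then mom m c k j q else 0)
       = (if i = s then ?S q j else 0) - (if j = q then ?S s i else 0)"
      unfolding m(3,4) by (simp add: scale_op_hom(2))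
    have "?S q i * ?S s j = ?S s j * ?S q i + ((if i = s then ?S q j else 0) - (if j = q then ?S s i else 0))"
      using 2 by (simp only: add_diff_eq)
    from scale_diff_comm(2)[OF this] show ?thesis
      by (simp only: add_diff_eq[symmetric] e m(1,2))
  next
    case 2
    then show ?thesis
      using scale_diff_comm(1)[OF 1[of j q i s]] assms by (simp add: mom_le mom_gt)
  next
    case 3
    then show ?thesis
      using scale_diff_comm(1)[OF 1[of i s j q]] assms by (simp add: mom_le mom_gt)
  next
    case 4
    then show ?thesis using assms by (auto simp: mom_def down_down)
  qed
qed

text \<open>The Kronecker deltas in \<open>coord_mom\<close> give the relations of matrix units. Its
  extra terms cancel against those of \<open>mom_mom\<close>, which reflects that sum_q x_{j,q}
  d/dx_{i,q} commutes with GL_k acting on the right.\<close>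

lemma gl_op_block_comm:
  assumes "i \<in> {1..m}" "j \<in> {1..m}" "r \<in> {1..m}" "t \<in> {1..m}" "k \<in> {1..m}"
  shows "gl_op_block m c k i j * gl_op_block m c k r t = gl_op_block m c k r t * gl_op_block m c k i j
    + (if j = r then gl_op_block m c k i t else 0) - (if t = i then gl_op_block m c k r j else 0)"
proof -
  let ?N = "mom m c k" and ?G = "coord k"
  \<comment> \<open>\<open>gn\<close> and \<open>nn\<close> are the commutators of
    \<open>coord\<close> with \<open>mom\<close> and of \<open>mom\<close> with
    \<open>mom\<close>.\<close>
  define gn where "gn j q r s = (if q = s then (if r = j then 1 else 0) - (if r \<le> k then ?G j r else 0) else 0)"
    for j q r s :: nat
  define nn where "nn i q r s = (if r = q then ?N i s else 0) - (if i = s then ?N r q else 0)" for i q r s :: nat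
  have "(?N i q * ?G j q) * (?N r s * ?G t s) = (?N r s * ?G t s) * (?N i q * ?G j q)
      + ?N i q * gn j q r s * ?G t s - ?N r s * gn t s i q * ?G j q + nn i q r s * ?G j q * ?G t s"
    if qs: "q \<in> {1..k}" "s \<in> {1..k}" for q s
  proof -
    have 1: "?G j q * ?N r s = ?N r s * ?G j q + gn j q r s"
      using coord_mom[OF qs assms(2,3)] by (simp add: gn_def)
    have 2: "?N i q * ?G t s = ?G t s * ?N i q - gn t s i q"
      using coord_mom[OF qs(2,1) assms(4,1)] by (simp add: gn_def)
    have 3: "?N i q * ?N r s = ?N r s * ?N i q + nn i q r s"
      using mom_mom[OF qs assms(3,1)] by (simp add: nn_def)
    have "(?N i q * ?G j q) * (?N r s * ?G t s) = ?N i q * (?G j q * ?N r s) * ?G t s"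
      by (simp add: mult.assoc)
    also have "\<dots> = ?N i q * ?N r s * (?G j q * ?G t s) + ?N i q * gn j q r s * ?G t s"
      unfolding 1 by (simp add: distrib_left distrib_right mult.assoc)
    also have "?N i q * ?N r s * (?G j q * ?G t s)
        = ?N r s * ?N i q * (?G j q * ?G t s) + nn i q r s * ?G j q * ?G t s"
      unfolding 3 by (simp add: distrib_right mult.assoc)
    also have "?N r s * ?N i q * (?G j q * ?G t s) = ?N r s * (?N i q * ?G t s) * ?G j q"
      by (simp add: coord_coord[of k j q k t s] mult.assoc)
    also have "\<dots> = (?N r s * ?G t s) * (?N i q * ?G j q) - ?N r s * gn t s i q * ?G j q"
      unfolding 2 by (simp add: left_diff_distrib right_diff_distrib mult.assoc)
    finally show ?thesis by (simp add: algebra_simps)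
  qed
  then have "gl_op_block m c k i j * gl_op_block m c k r t
    = (\<Sum>q\<in>{1..k}. \<Sum>s\<in>{1..k}. (?N r s * ?G t s) * (?N i q * ?G j q)
      + ?N i q * gn j q r s * ?G t s - ?N r s * gn t s i q * ?G j q + nn i q r s * ?G j q * ?G t s)"
    unfolding gl_op_block_def sum_product by (intro sum.cong refl)
  also have "\<dots> = (\<Sum>q\<in>{1..k}. \<Sum>s\<in>{1..k}. (?N r s * ?G t s) * (?N i q * ?G j q))
      + (\<Sum>q\<in>{1..k}. \<Sum>s\<in>{1..k}. ?N i q * gn j q r s * ?G t s)
      - (\<Sum>q\<in>{1..k}. \<Sum>s\<in>{1..k}. ?N r s * gn t s i q * ?G j q)
      + (\<Sum>q\<in>{1..k}. \<Sum>s\<in>{1..k}. nn i q r s * ?G j q * ?G t s)"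
    by (simp add: sum.distrib sum_subtractf)
  also have "(\<Sum>q\<in>{1..k}. \<Sum>s\<in>{1..k}. (?N r s * ?G t s) * (?N i q * ?G j q))
      = gl_op_block m c k r t * gl_op_block m c k i j"
    unfolding gl_op_block_def sum_product by (rule sum.swap)
  also have "(\<Sum>q\<in>{1..k}. \<Sum>s\<in>{1..k}. ?N i q * gn j q r s * ?G t s)
      = (if j = r then gl_op_block m c k i t else 0)
        - (if r \<le> k then \<Sum>q\<in>{1..k}. ?N i q * ?G j r * ?G t q else 0)"
  proof -
    have "(\<Sum>q\<in>{1..k}. \<Sum>s\<in>{1..k}. ?N i q * gn j q r s * ?G t s)
      = (\<Sum>q\<in>{1..k}. \<Sum>s\<in>{1..k}. if q = s then ?N i q * gn j q r q * ?G t q else 0)"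
      by (intro sum.cong) (auto simp: gn_def)
    also have "\<dots> = (\<Sum>q\<in>{1..k}. ?N i q * gn j q r q * ?G t q)" by simp
    finally show ?thesis
      by (auto simp: gn_def gl_op_block_def left_diff_distrib right_diff_distrib sum_subtractf)
  qed
  also have "(\<Sum>q\<in>{1..k}. \<Sum>s\<in>{1..k}. ?N r s * gn t s i q * ?G j q)
      = (if t = i then gl_op_block m c k r j else 0)
        - (if i \<le> k then \<Sum>q\<in>{1..k}. ?N r q * ?G t i * ?G j q else 0)"
  proof -
    have "(\<Sum>q\<in>{1..k}. \<Sum>s\<in>{1..k}. ?N r s * gn t s i q * ?G j q)
      = (\<Sum>q\<in>{1..k}. \<Sum>s\<in>{1..k}. if q = s then ?N r q * gn t q i q * ?G j q else 0)"
      by (intro sum.cong) (auto simp: gn_def)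
    also have "\<dots> = (\<Sum>q\<in>{1..k}. ?N r q * gn t q i q * ?G j q)" by simp
    finally show ?thesis
      by (auto simp: gn_def gl_op_block_def left_diff_distrib right_diff_distrib sum_subtractf)
  qed
  \<comment> \<open>These are the corrections left over in the two preceding sums, with the opposite
    sign.\<close>
  also have "(\<Sum>q\<in>{1..k}. \<Sum>s\<in>{1..k}. nn i q r s * ?G j q * ?G t s)
     = (if r \<le> k then \<Sum>q\<in>{1..k}. ?N i q * ?G j r * ?G t q else 0)
      - (if i \<le> k then \<Sum>q\<in>{1..k}. ?N r q * ?G t i * ?G j q else 0)"
  proof -
    have "(\<Sum>q\<in>{1..k}. \<Sum>s\<in>{1..k}. nn i q r s * ?G j q * ?G t s)
      = (\<Sum>q\<in>{1..k}. \<Sum>s\<in>{1..k}. (if r = q then ?N i s * ?G j r * ?G t s else 0))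
        - (\<Sum>q\<in>{1..k}. \<Sum>s\<in>{1..k}. (if i = s then ?N r q * ?G t i * ?G j q else 0))"
      unfolding sum_subtractf[symmetric]
      by (intro sum.cong) (auto simp: nn_def left_diff_distrib mult.assoc coord_coord[of k t i k j])
    also have "(\<Sum>q\<in>{1..k}. \<Sum>s\<in>{1..k}. (if r = q then ?N i s * ?G j r * ?G t s else 0))
        = (\<Sum>q\<in>{1..k}. if r = q then \<Sum>s\<in>{1..k}. ?N i s * ?G j r * ?G t s else 0)"
      by (intro sum.cong) auto
    finally show ?thesis using assms by simp
  qed
  finally show ?thesis by (simp add: algebra_simps)
qed

lemma gl_op_block_other:
  assumes "k \<noteq> k'"
  shows "gl_op_block m c k i j * gl_op_block m c k' r t = gl_op_block m c k' r t * gl_op_block m c k i j"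
proof -
  have "(mom m c k i q * coord k j q) * (mom m c k' r s * coord k' t s)
      = (mom m c k' r s * coord k' t s) * (mom m c k i q * coord k j q)" for q s
  proof -
    have "(mom m c k i q * coord k j q) * (mom m c k' r s * coord k' t s)
       = mom m c k i q * (coord k j q * mom m c k' r s) * coord k' t s"
      by (simp add: mult.assoc)
    also have "\<dots> = mom m c k i q * mom m c k' r s * (coord k j q * coord k' t s)"
      by (simp add: coord_mom_other[OF assms] mult.assoc)
    also have "\<dots> = mom m c k' r s * (mom m c k i q * coord k' t s) * coord k j q"
      by (simp only: mom_mom_other[OF assms] coord_coord[of k j q] mult.assoc)
    also have "mom m c k i q * coord k' t s = coord k' t s * mom m c k i q"
      using coord_mom_other[of k' k] assms by simp
    finally show ?thesis by (simp add: mult.assoc)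
  qed
  then show ?thesis
    unfolding gl_op_block_def sum_product by (subst sum.swap) simp
qed

text \<open>Blocks with different \<open>k\<close> involve different variables and commute, so the
  sum over \<open>k\<close> is the action on a tensor product of representations.\<close>

lemma gl_elements_gl_op: "gl_elements m (gl_op m c) scale_op"
proof
  fix i j r t assume *: "i \<in> {1..m}" "j \<in> {1..m}" "r \<in> {1..m}" "t \<in> {1..m}"
  let ?B = "gl_op_block m c"
  have "gl_op m c i j * gl_op m c r t = (\<Sum>k\<in>{1..m}. \<Sum>k'\<in>{1..m}. ?B k' r t * ?B k i j +
      (if k = k' then (if j = r then ?B k i t else 0) - (if t = i then ?B k r j else 0) else 0))"
    unfolding gl_op_def sum_product
  proof (intro sum.cong refl)
    fix k k' assume "k \<in> {1..m}" "k' \<in> {1..m}"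
    then show "?B k i j * ?B k' r t = ?B k' r t * ?B k i j +
      (if k = k' then (if j = r then ?B k i t else 0) - (if t = i then ?B k r j else 0) else 0)"
      using gl_op_block_comm[OF *] gl_op_block_other[of k k'] by (cases "k = k'") simp_all
  qed
  also have "\<dots> = (\<Sum>k\<in>{1..m}. \<Sum>k'\<in>{1..m}. ?B k' r t * ?B k i j) +
      (\<Sum>k\<in>{1..m}. (if j = r then ?B k i t else 0) - (if t = i then ?B k r j else 0))"
    by (simp add: sum.distrib)
  also have "(\<Sum>k\<in>{1..m}. \<Sum>k'\<in>{1..m}. ?B k' r t * ?B k i j) = gl_op m c r t * gl_op m c i j"
    unfolding gl_op_def sum_product by (rule sum.swap)
  finally show "gl_op m c i j * gl_op m c r t = gl_op m c r t * gl_op m c i j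
      + (if j = r then gl_op m c i t else 0) - (if t = i then gl_op m c r j else 0)"
    by (simp add: gl_op_def sum_subtractf)
next
  show "scale_op c * x = x * scale_op c" for c and x :: vec_op
    by (rule scale_op_central)
qed (simp_all add: scale_op_hom)

text \<open>As a functional on polynomials this is evaluation at the origin, the point where all
  matrices Z are 0.\<close>

definition vacuum :: "'i fock" where
  "vacuum a = (if \<forall>i. a i = 0 then 1 else 0)"

lemma up_op_vacuum: "op_apply (up_op i) vacuum = (\<lambda>a. 0)"
  by (auto simp: op_apply_simps vacuum_def fun_eq_iff)

lemma coord_vacuum:
  "op_apply (coord k j q) vacuum = (if j = q \<and> j \<le> k then vacuum else (\<lambda>a. 0))"
  by (auto simp: coord_def up_op_vacuum op_apply_simps(4,5))

lemma mom_vacuum: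
  assumes "i \<le> k"
  shows "op_apply (mom m c k i q) vacuum = (\<lambda>a. (if i = q then c k else 0) * vacuum a)"
  using assms by (simp add: mom_def op_apply_simps op_apply_sum up_op_vacuum op_apply_zero
      del: op_apply_simps(7))

text \<open>At the origin only the constant coordinates and the multipliers survive. Solving for
  \<open>c\<close> realises every weight; the block \<open>k = m\<close> has no variables and
  supplies the multiples of the trace.\<close>

lemma gl_op_vacuum:
  assumes "1 \<le> i" "i \<le> j"
  shows "op_apply (gl_op m c i j) vacuum
    = (\<lambda>a. (if i = j then \<Sum>k\<in>{i..m}. c k else 0) * vacuum a)"
proof -
  have "op_apply (gl_op_block m c k i j) vacuum = (\<lambda>a. (if i = j \<and> j \<le> k then c k else 0) * vacuum a)" for k
  proof
    fix a
    have "op_apply (mom m c k i q * coord k j q) vacuum a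
       = (if q = j then if i = j \<and> j \<le> k then c k * vacuum a else 0 else 0)" for q
      using assms mom_vacuum[of i k m c q]
      by (auto simp: op_apply_simps(3) coord_vacuum op_apply_zero)
    then show "op_apply (gl_op_block m c k i j) vacuum a = (if i = j \<and> j \<le> k then c k else 0) * vacuum a"
      using assms by (simp add: gl_op_block_def op_apply_sum)
  qed
  then have "op_apply (gl_op m c i j) vacuum a
     = (\<Sum>k\<in>{1..m}. (if i = j \<and> j \<le> k then c k else 0)) * vacuum a" for a
    by (simp add: gl_op_def op_apply_sum sum_distrib_right)
  moreover have "(\<Sum>k\<in>{1..m}. if i \<le> k then c k else 0) = (\<Sum>k\<in>{i..m}. c k)"
    using assms by (intro sum.mono_neutral_cong_right) auto
  ultimately show ?thesis using assms by (auto simp: fun_eq_iff)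
qed

text \<open>Exponents of the product over 1 <= k < x of the entry (k + 1, k) of the k-th matrix Z.
  Stopping at \<open>x\<close> is what makes an induction along \<open>T_rec\<close>
  possible.\<close>

definition simple_exp :: "nat \<Rightarrow> nat \<times> nat \<times> nat \<Rightarrow> nat" where
  "simple_exp x = (\<lambda>(k, i, q). if 1 \<le> k \<and> k < x \<and> i = Suc k \<and> q = k then 1 else 0)"

text \<open>Blocks with \<open>k \<ge> i\<close> give nothing: the monomial contains no variable of
  theirs, and \<open>coord k j i\<close> is 0. For \<open>k < i\<close> the operator differentiates
  in row \<open>i\<close> of Z, which the monomial meets only for \<open>k = i - 1\<close> in column
  \<open>k\<close>; as \<open>coord k j k\<close> is 0 for \<open>j < k\<close>, only
  \<open>j = k\<close> survives, and removing that variable leaves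
  \<open>simple_exp j\<close>.\<close>

lemma gl_op_simple_exp:
  assumes "1 \<le> j" "j < i" "i \<le> m"
  shows "op_apply (gl_op m c i j) f (simple_exp i) = (if i = Suc j then f (simple_exp j) else 0)"
proof -
  have "op_apply (mom m c k i q * coord k j q) f (simple_exp i)
     = (if q = k then if k = j \<and> i = Suc j then f (simple_exp j) else 0 else 0)" if "q \<in> {1..k}" for k q
  proof (cases "i \<le> k")
    case True
    have "op_apply (mom m c k i q) g (simple_exp i) = 0" if "i \<noteq> q" for g
      using that True by (simp add: mom_def op_apply_simps op_apply_sum simple_exp_def)
    moreover have "coord k j i = 0" using True assms by (simp add: coord_def)
    ultimately show ?thesis using True assms
      by (cases "q = i") (auto simp: op_apply_simps op_apply_zero mom_def op_apply_sum)
  next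
    case False
    have "(simple_exp i)((k, i, q) := 0) = simple_exp j" if "q = k" "k = j" "i = Suc j"
      using that by (auto simp: simple_exp_def fun_eq_iff)
    moreover have "op_apply (mom m c k i q) g (simple_exp i)
        = (if i = Suc k \<and> q = k then g ((simple_exp i)((k, i, q) := 0)) else 0)" for g
      using False that by (auto simp: mom_def op_apply_simps simple_exp_def)
    ultimately show ?thesis using False assms
      by (auto simp: op_apply_simps coord_def)
  qed
  then have "op_apply (gl_op_block m c k i j) f (simple_exp i)
      = (if k = j then if i = Suc j then f (simple_exp j) else 0 else 0)" if "k \<in> {1..m}" for k
    using that by (simp add: gl_op_block_def op_apply_sum)
  then show ?thesis using assms by (simp add: gl_op_def op_apply_sum)
qed

text \<open>In the recursion only \<open>y = x - 1\<close> contributes, and there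
  \<open>A_elt\<close> is an empty product, so the value is the same for every
  \<open>c\<close>.\<close>

lemma T_vacuum:
  assumes "x \<in> {1..m}"
  shows "op_apply (gl_elements.T (gl_op m c) x) vacuum (simple_exp x) = 1"
  using assms
proof (induction x rule: less_induct)
  case (less x)
  interpret gl_elements m "gl_op m c" scale_op by (rule gl_elements_gl_op)
  show ?case
  proof (cases "x = 1")
    case True
    then show ?thesis by (simp add: T_1 op_apply_simps vacuum_def simple_exp_def)
  next
    case False
    then have x: "1 < x" "x \<le> m" using less.prems by auto
    have "op_apply (T x) vacuum (simple_exp x)
      = (\<Sum>y\<in>{1..<x}. if y = x - 1 then op_apply (T y * A_elt y x) vacuum (simple_exp y) else 0)"
      unfolding T_rec[OF x(1)] op_apply_sum mult.assoc op_apply_simps(3)[of "gl_op _ _ _ _"]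
      using x by (intro sum.cong refl) (auto simp: gl_op_simple_exp)
    also have "\<dots> = op_apply (T (x - 1)) vacuum (simple_exp (x - 1))"
      using x A_elt_empty[of "x - 1"] by simp
    also have "\<dots> = 1"
    proof (rule less.IH)
      show "x - 1 < x" "x - 1 \<in> {1..m}" using x by auto
    qed
    finally show ?thesis .
  qed
qed


section \<open>The universal property of the enveloping algebra\<close>

lemma poly_mapping_sum_single:
  "p = (\<Sum>w\<in>Poly_Mapping.keys p. Poly_Mapping.single w (Poly_Mapping.lookup p w))"
proof (rule poly_mapping_eqI)
  fix k
  have "(\<Sum>w\<in>Poly_Mapping.keys p. Poly_Mapping.lookup p w when w = k) = Poly_Mapping.lookup p k"
    by (simp add: when_def in_keys_iff)
  then show "Poly_Mapping.lookup p k
      = Poly_Mapping.lookup (\<Sum>w\<in>Poly_Mapping.keys p. Poly_Mapping.single w (Poly_Mapping.lookup p w)) k"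
    by (simp add: lookup_sum lookup_single)
qed

lemma Ugl_carrier_coset:
  assumes "X \<in> carrier (Ugl m)"
  obtains p where "p \<in> carrier (free_algebra (gl m))"
    "X = env_ideal m +>\<^bsub>free_algebra (gl m)\<^esub> p"
  using assms by (auto simp: Ugl_def FactRing_def A_RCOSETS_def')

lemma env_ideal_least:
  assumes "ideal I (free_algebra (gl m))" "env_relations m \<subseteq> I"
  shows "env_ideal m \<subseteq> I"
  unfolding env_ideal_def using ring.genideal_minimal[OF ring_free_algebra assms] .

context gl_elements
begin

definition eval_mat :: "complex mat \<Rightarrow> 'a" where
  "eval_mat A = (\<Sum>i\<in>{1..m}. \<Sum>j\<in>{1..m}. sc (A $$ (i - 1, j - 1)) * E i j)"

definition eval_word :: "complex mat free_monoid \<Rightarrow> 'a" where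
  "eval_word w = prod_list (map eval_mat (letters w))"

definition eval_free :: "complex mat free_alg \<Rightarrow> 'a" where
  "eval_free p = (\<Sum>w\<in>Poly_Mapping.keys p. sc (Poly_Mapping.lookup p w) * eval_word w)"

lemma eval_free_superset:
  assumes "finite S" "Poly_Mapping.keys p \<subseteq> S"
  shows "eval_free p = (\<Sum>w\<in>S. sc (Poly_Mapping.lookup p w) * eval_word w)"
  unfolding eval_free_def using assms
  by (intro sum.mono_neutral_left) (auto simp: sc_0 in_keys_iff)

lemma eval_free_add: "eval_free (p + q) = eval_free p + eval_free q"
proof -
  let ?S = "Poly_Mapping.keys p \<union> Poly_Mapping.keys q"
  have "eval_free r = (\<Sum>w\<in>?S. sc (Poly_Mapping.lookup r w) * eval_word w)"
    if "r \<in> {p, q, p + q}" for r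
    using that Poly_Mapping.keys_add[of p q] by (intro eval_free_superset) auto
  then show ?thesis
    by (simp add: lookup_add sc_add distrib_right sum.distrib)
qed

lemma eval_free_0: "eval_free 0 = 0"
  by (simp add: eval_free_def)

lemma eval_free_uminus: "eval_free (- p) = - eval_free p"
  using eval_free_add[of p "- p"] by (simp add: eval_free_0 eq_neg_iff_add_eq_0 add.commute)

lemma eval_free_diff: "eval_free (p - q) = eval_free p - eval_free q"
  using eval_free_add[of p "- q"] by (simp add: eval_free_uminus)

lemma eval_free_sum: "eval_free (sum f S) = (\<Sum>x\<in>S. eval_free (f x))"
  by (induction S rule: infinite_finite_induct) (simp_all add: eval_free_0 eval_free_add)

lemma eval_free_single: "eval_free (Poly_Mapping.single w c) = sc c * eval_word w"
  by (simp add: eval_free_def sc_0)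

lemma eval_word_plus: "eval_word (v + w) = eval_word v * eval_word w"
  by (simp add: eval_word_def plus_free_monoid_def)

lemma eval_free_mult: "eval_free (p * q) = eval_free p * eval_free q"
proof -
  let ?l = "Poly_Mapping.lookup" and ?k = "Poly_Mapping.keys"
  have "p * q = (\<Sum>v\<in>?k p. \<Sum>w\<in>?k q. Poly_Mapping.single (v + w) (?l p v * ?l q w))"
    by (subst poly_mapping_sum_single[of p], subst poly_mapping_sum_single[of q])
      (simp add: sum_product mult_single)
  then have "eval_free (p * q)
      = (\<Sum>v\<in>?k p. \<Sum>w\<in>?k q. sc (?l p v * ?l q w) * eval_word (v + w))"
    by (simp add: eval_free_sum eval_free_single)
  also have "\<dots> = (\<Sum>v\<in>?k p. \<Sum>w\<in>?k q. (sc (?l p v) * eval_word v) * (sc (?l q w) * eval_word w))"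
  proof (intro sum.cong refl)
    fix v w
    have "sc (?l p v) * eval_word v * (sc (?l q w) * eval_word w)
        = sc (?l p v) * (eval_word v * sc (?l q w)) * eval_word w" by (simp add: mult.assoc)
    also have "eval_word v * sc (?l q w) = sc (?l q w) * eval_word v"
      by (rule sc_central[symmetric])
    finally show "sc (?l p v * ?l q w) * eval_word (v + w)
        = sc (?l p v) * eval_word v * (sc (?l q w) * eval_word w)"
      by (simp add: sc_mult eval_word_plus mult.assoc)
  qed
  finally show ?thesis by (simp add: eval_free_def sum_product)
qed

lemma eval_free_1: "eval_free 1 = 1"
proof -
  have "eval_word 0 = 1" by (simp add: eval_word_def zero_free_monoid_def)
  then show ?thesis using eval_free_single[of 0 1] by (simp add: sc_1)
qed

lemma eval_free_gen: "eval_free (free_gen A) = eval_mat A"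
  by (simp add: free_gen_def eval_free_single sc_1 eval_word_def)

lemma eval_free_scal: "eval_free (free_scal c) = sc c"
  by (simp add: free_scal_def eval_free_single eval_word_def zero_free_monoid_def)

lemma eval_mat_add:
  assumes "A \<in> gl m" "B \<in> gl m"
  shows "eval_mat (A + B) = eval_mat A + eval_mat B"
proof -
  have "(A + B) $$ (i - 1, j - 1) = A $$ (i - 1, j - 1) + B $$ (i - 1, j - 1)"
    if "i \<in> {1..m}" "j \<in> {1..m}" for i j
  proof -
    have "i - 1 < m" "j - 1 < m" using that by auto
    then show ?thesis using assms by (simp add: gl_def)
  qed
  then show ?thesis
    by (simp add: eval_mat_def sc_add distrib_right sum.distrib)
qed

lemma eval_mat_smult:
  assumes "A \<in> gl m"
  shows "eval_mat (c \<cdot>\<^sub>m A) = sc c * eval_mat A"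
proof -
  have "(c \<cdot>\<^sub>m A) $$ (i - 1, j - 1) = c * A $$ (i - 1, j - 1)"
    if "i \<in> {1..m}" "j \<in> {1..m}" for i j
  proof -
    have "i - 1 < m" "j - 1 < m" using that by auto
    then show ?thesis using assms by (simp add: gl_def)
  qed
  then show ?thesis
    by (simp add: eval_mat_def sc_mult sum_distrib_left mult.assoc)
qed

lemma sum_shift: "(\<Sum>i\<in>{1..m}. f (i - 1)) = (\<Sum>i\<in>{0..<m}. f i)" for f :: "nat \<Rightarrow> 'b::comm_monoid_add"
  by (rule sum.reindex_bij_witness[of _ Suc "\<lambda>i. i - 1"]) auto

lemma sc_sum: "sc (sum f S) = (\<Sum>x\<in>S. sc (f x))"
  by (induction S rule: infinite_finite_induct) (simp_all add: sc_0 sc_add)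

lemma eval_mat_times:
  assumes "A \<in> gl m" "B \<in> gl m"
  shows "eval_mat (A * B) = (\<Sum>i\<in>{1..m}. \<Sum>l\<in>{1..m}. \<Sum>j\<in>{1..m}.
    sc (A $$ (i - 1, j - 1) * B $$ (j - 1, l - 1)) * E i l)"
proof -
  have "(A * B) $$ (i - 1, l - 1) = (\<Sum>j\<in>{1..m}. A $$ (i - 1, j - 1) * B $$ (j - 1, l - 1))"
    if "i \<in> {1..m}" "l \<in> {1..m}" for i l
  proof -
    have "i - 1 < m" "l - 1 < m" using that by auto
    then have "(A * B) $$ (i - 1, l - 1) = (\<Sum>j\<in>{0..<m}. A $$ (i - 1, j) * B $$ (j, l - 1))"
      using assms by (simp add: gl_def scalar_prod_def)
    then show ?thesis by (simp only: sum_shift[of "\<lambda>j. A $$ (i - 1, j) * B $$ (j, l - 1)"])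
  qed
  then show ?thesis
    by (simp add: eval_mat_def sc_sum sum_distrib_right)
qed

lemma eval_mat_bracket:
  assumes "A \<in> gl m" "B \<in> gl m"
  shows "eval_mat (lie_bracket A B) = eval_mat A * eval_mat B - eval_mat B * eval_mat A"
proof -
  define a where "a i j = A $$ (i - 1, j - 1)" for i j
  define b where "b i j = B $$ (i - 1, j - 1)" for i j
  let ?I = "{1..m}"
  have AB: "A * B \<in> gl m" "B * A \<in> gl m" using assms by (auto simp: gl_def)
  have minus: "A * B - B * A = A * B + (-1) \<cdot>\<^sub>m (B * A)"
    using AB unfolding gl_def by (intro eq_matI) auto
  have "eval_mat (lie_bracket A B) = eval_mat (A * B) - eval_mat (B * A)"
    unfolding lie_bracket_def minus using AB
    by (subst eval_mat_add) (auto simp: eval_mat_smult sc_uminus sc_1 gl_def)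
  \<comment> \<open>Both products are written as sums over the same four indices with Kronecker
    deltas, so that the bracket relation \<open>comm\<close> can be applied term by term.\<close>
  also have "eval_mat (A * B) = (\<Sum>i\<in>?I. \<Sum>j\<in>?I. \<Sum>k\<in>?I. \<Sum>l\<in>?I. if j = k then sc (a i j * b k l) * E i l else 0)"
  proof -
    have "(\<Sum>i\<in>?I. \<Sum>j\<in>?I. \<Sum>k\<in>?I. \<Sum>l\<in>?I. if j = k then sc (a i j * b k l) * E i l else 0)
        = (\<Sum>i\<in>?I. \<Sum>j\<in>?I. \<Sum>l\<in>?I. sc (a i j * b j l) * E i l)"
    proof (rule sum.cong[OF refl], rule sum.cong[OF refl])
      fix i j assume "i \<in> ?I" "j \<in> ?I"
      have "(\<Sum>k\<in>?I. \<Sum>l\<in>?I. if j = k then sc (a i j * b k l) * E i l else 0)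
          = (\<Sum>k\<in>?I. if j = k then \<Sum>l\<in>?I. sc (a i j * b k l) * E i l else 0)"
        by (intro sum.cong) auto
      then show "(\<Sum>k\<in>?I. \<Sum>l\<in>?I. if j = k then sc (a i j * b k l) * E i l else 0)
          = (\<Sum>l\<in>?I. sc (a i j * b j l) * E i l)"
        using \<open>j \<in> ?I\<close> by simp
    qed
    also have "\<dots> = (\<Sum>i\<in>?I. \<Sum>l\<in>?I. \<Sum>j\<in>?I. sc (a i j * b j l) * E i l)"
      by (rule sum.cong[OF refl], rule sum.swap)
    finally show ?thesis using eval_mat_times[OF assms] by (simp add: a_def b_def)
  qed
  also have "eval_mat (B * A) = (\<Sum>i\<in>?I. \<Sum>j\<in>?I. \<Sum>k\<in>?I. \<Sum>l\<in>?I. if l = i then sc (a i j * b k l) * E k j else 0)"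
  proof -
    have "(\<Sum>i\<in>?I. \<Sum>j\<in>?I. \<Sum>k\<in>?I. \<Sum>l\<in>?I. if l = i then sc (a i j * b k l) * E k j else 0)
        = (\<Sum>i\<in>?I. \<Sum>j\<in>?I. \<Sum>k\<in>?I. sc (b k i * a i j) * E k j)"
      by (intro sum.cong) (auto simp: mult.commute)
    also have "\<dots> = (\<Sum>i\<in>?I. \<Sum>k\<in>?I. \<Sum>j\<in>?I. sc (b k i * a i j) * E k j)"
      by (rule sum.cong[OF refl], rule sum.swap)
    also have "\<dots> = (\<Sum>k\<in>?I. \<Sum>i\<in>?I. \<Sum>j\<in>?I. sc (b k i * a i j) * E k j)"
      by (rule sum.swap)
    also have "\<dots> = (\<Sum>k\<in>?I. \<Sum>j\<in>?I. \<Sum>i\<in>?I. sc (b k i * a i j) * E k j)"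
      by (rule sum.cong[OF refl], rule sum.swap)
    finally show ?thesis using eval_mat_times[OF assms(2,1)] by (simp add: a_def b_def)
  qed
  also have "(\<Sum>i\<in>?I. \<Sum>j\<in>?I. \<Sum>k\<in>?I. \<Sum>l\<in>?I. if j = k then sc (a i j * b k l) * E i l else 0)
      - (\<Sum>i\<in>?I. \<Sum>j\<in>?I. \<Sum>k\<in>?I. \<Sum>l\<in>?I. if l = i then sc (a i j * b k l) * E k j else 0)
     = (\<Sum>i\<in>?I. \<Sum>j\<in>?I. \<Sum>k\<in>?I. \<Sum>l\<in>?I. (sc (a i j) * E i j) * (sc (b k l) * E k l)
          - (sc (b k l) * E k l) * (sc (a i j) * E i j))"
    unfolding sum_subtractf[symmetric]
  proof (intro sum.cong refl)
    fix i j k l assume *: "i \<in> ?I" "j \<in> ?I" "k \<in> ?I" "l \<in> ?I"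
    have "(sc (a i j) * E i j) * (sc (b k l) * E k l) = sc (a i j) * (E i j * sc (b k l)) * E k l"
      "(sc (b k l) * E k l) * (sc (a i j) * E i j) = sc (b k l) * (E k l * sc (a i j)) * E i j"
      by (simp_all add: mult.assoc)
    then have "(sc (a i j) * E i j) * (sc (b k l) * E k l) = sc (a i j * b k l) * (E i j * E k l)"
      "(sc (b k l) * E k l) * (sc (a i j) * E i j) = sc (b k l * a i j) * (E k l * E i j)"
      unfolding sc_central[of "b k l" "E i j", symmetric] sc_central[of "a i j" "E k l", symmetric] sc_mult
      by (simp_all only: mult.assoc)
    moreover have "b k l * a i j = a i j * b k l" by (rule mult.commute)
    ultimately show "(if j = k then sc (a i j * b k l) * E i l else 0) - (if l = i then sc (a i j * b k l) * E k j else 0)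
       = (sc (a i j) * E i j) * (sc (b k l) * E k l) - (sc (b k l) * E k l) * (sc (a i j) * E i j)"
      using comm[OF *] by (auto simp: distrib_left right_diff_distrib)
  qed
  also have "\<dots> = eval_mat A * eval_mat B - eval_mat B * eval_mat A"
  proof -
    have A: "eval_mat A = (\<Sum>i\<in>?I. \<Sum>j\<in>?I. sc (a i j) * E i j)"
      and B: "eval_mat B = (\<Sum>k\<in>?I. \<Sum>l\<in>?I. sc (b k l) * E k l)"
      by (simp_all add: eval_mat_def a_def b_def)
    have "eval_mat A * eval_mat B = (\<Sum>i\<in>?I. \<Sum>j\<in>?I. (sc (a i j) * E i j) * eval_mat B)"
      unfolding A by (simp only: sum_distrib_right)
    then have 1: "eval_mat A * eval_mat B
      = (\<Sum>i\<in>?I. \<Sum>j\<in>?I. \<Sum>k\<in>?I. \<Sum>l\<in>?I. (sc (a i j) * E i j) * (sc (b k l) * E k l))"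
      unfolding B by (simp only: sum_distrib_left)
    have "eval_mat B * eval_mat A = (\<Sum>i\<in>?I. \<Sum>j\<in>?I. eval_mat B * (sc (a i j) * E i j))"
      unfolding A by (simp only: sum_distrib_left)
    then have 2: "eval_mat B * eval_mat A
      = (\<Sum>i\<in>?I. \<Sum>j\<in>?I. \<Sum>k\<in>?I. \<Sum>l\<in>?I. (sc (b k l) * E k l) * (sc (a i j) * E i j))"
      unfolding B by (simp only: sum_distrib_right)
    show ?thesis unfolding 1 2 by (simp add: sum_subtractf)
  qed
  finally show ?thesis .
qed

text \<open>The kernel of the evaluation is an ideal and contains the defining relations.\<close>

lemma eval_free_env_ideal:
  assumes "p \<in> env_ideal m"
  shows "eval_free p = 0"
proof -
  let ?F = "free_algebra (gl m)"
  let ?K = "{p \<in> carrier ?F. eval_free p = 0}"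
  interpret F: ring ?F by (rule ring_free_algebra)
  have "ideal ?K ?F"
  proof (rule idealI[OF ring_free_algebra])
    show "subgroup ?K (add_monoid ?F)"
    proof (rule F.add.subgroupI)
      fix p assume p: "p \<in> ?K"
      have "- p \<oplus>\<^bsub>?F\<^esub> p = \<zero>\<^bsub>?F\<^esub>" by (simp add: free_algebra_simps)
      then have "\<ominus>\<^bsub>?F\<^esub> p = - p"
        using p free_algebra_closed(3)[of p] by (intro F.minus_equality) auto
      then show "\<ominus>\<^bsub>?F\<^esub> p \<in> ?K"
        using p free_algebra_closed(3)[of p] by (auto simp: eval_free_uminus)
    qed (use free_algebra_closed(4) free_algebra_closed(1) eval_free_0 in
        \<open>auto simp: free_algebra_simps(3) eval_free_add\<close>)
  qed (auto simp: free_algebra_simps(2) eval_free_mult intro: free_algebra_closed(2))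
  moreover have "env_relations m \<subseteq> ?K"
  proof
    fix p assume p: "p \<in> env_relations m"
    then have "eval_free p = 0"
      unfolding env_relations_def
      by (auto simp: eval_free_diff eval_free_mult eval_free_gen eval_free_scal eval_mat_add
        eval_mat_smult eval_mat_bracket)
    then show "p \<in> ?K" using p env_relations_subset by blast
  qed
  ultimately show ?thesis using env_ideal_least assms by blast
qed

text \<open>The value is independent of the chosen representative because the evaluation kills
  \<open>env_ideal m\<close>.\<close>

definition eval_Ugl :: "complex mat free_alg set \<Rightarrow> 'a" where
  "eval_Ugl X = eval_free (SOME p. p \<in> X)"

lemma eval_Ugl_coset:
  assumes "p \<in> carrier (free_algebra (gl m))"
  shows "eval_Ugl (env_ideal m +>\<^bsub>free_algebra (gl m)\<^esub> p) = eval_free p"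
proof -
  interpret I: ideal "env_ideal m" "free_algebra (gl m)" by (rule ideal_env_ideal)
  have "p \<in> env_ideal m +>\<^bsub>free_algebra (gl m)\<^esub> p"
    using I.a_rcos_self assms by blast
  then have "(SOME q. q \<in> env_ideal m +>\<^bsub>free_algebra (gl m)\<^esub> p) \<in> env_ideal m +>\<^bsub>free_algebra (gl m)\<^esub> p"
    by (rule someI)
  then show ?thesis
    by (auto simp: eval_Ugl_def a_r_coset_def' free_algebra_simps eval_free_add eval_free_env_ideal)
qed

lemma eval_Ugl_hom:
  assumes "X \<in> carrier (Ugl m)" "Y \<in> carrier (Ugl m)"
  shows "eval_Ugl (X \<otimes>\<^bsub>Ugl m\<^esub> Y) = eval_Ugl X * eval_Ugl Y"
    and "eval_Ugl (X \<oplus>\<^bsub>Ugl m\<^esub> Y) = eval_Ugl X + eval_Ugl Y"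
proof -
  let ?F = "free_algebra (gl m)"
  interpret I: ideal "env_ideal m" ?F by (rule ideal_env_ideal)
  obtain p q where p: "p \<in> carrier ?F" "X = env_ideal m +>\<^bsub>?F\<^esub> p"
    and q: "q \<in> carrier ?F" "Y = env_ideal m +>\<^bsub>?F\<^esub> q"
    using Ugl_carrier_coset assms by metis
  have hom: "ring_hom_ring ?F (Ugl m) ((+>\<^bsub>?F\<^esub>) (env_ideal m))"
    unfolding Ugl_def by (rule I.rcos_ring_hom_ring)
  then interpret h: ring_hom_ring ?F "Ugl m" "(+>\<^bsub>?F\<^esub>) (env_ideal m)" .
  show "eval_Ugl (X \<otimes>\<^bsub>Ugl m\<^esub> Y) = eval_Ugl X * eval_Ugl Y"
    using p q h.hom_mult[of p q] free_algebra_closed(2)[OF p(1) q(1)]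
    by (simp add: eval_Ugl_coset free_algebra_simps(2) eval_free_mult flip: h.hom_mult)
  show "eval_Ugl (X \<oplus>\<^bsub>Ugl m\<^esub> Y) = eval_Ugl X + eval_Ugl Y"
    using p q free_algebra_closed(1)[OF p(1) q(1)]
    by (simp add: eval_Ugl_coset free_algebra_simps(3) eval_free_add flip: h.hom_add)
qed

lemma eval_Ugl_simps:
  "eval_Ugl \<one>\<^bsub>Ugl m\<^esub> = 1"
  "eval_Ugl \<zero>\<^bsub>Ugl m\<^esub> = 0"
  "A \<in> gl m \<Longrightarrow> eval_Ugl (ugl_inc m A) = eval_mat A"
  "eval_Ugl (ugl_scal m c) = sc c"
proof -
  let ?F = "free_algebra (gl m)"
  interpret I: ideal "env_ideal m" ?F by (rule ideal_env_ideal)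
  have hom: "ring_hom_ring ?F (Ugl m) ((+>\<^bsub>?F\<^esub>) (env_ideal m))"
    unfolding Ugl_def by (rule I.rcos_ring_hom_ring)
  then interpret h: ring_hom_ring ?F "Ugl m" "(+>\<^bsub>?F\<^esub>) (env_ideal m)" .
  show "eval_Ugl \<one>\<^bsub>Ugl m\<^esub> = 1"
    using eval_Ugl_coset[OF free_algebra_closed(5)] h.hom_one
    by (simp add: free_algebra_simps(4) eval_free_1)
  show "eval_Ugl \<zero>\<^bsub>Ugl m\<^esub> = 0"
    using eval_Ugl_coset[OF free_algebra_closed(4)] h.hom_zero
    by (simp add: free_algebra_simps(5) eval_free_0)
  show "A \<in> gl m \<Longrightarrow> eval_Ugl (ugl_inc m A) = eval_mat A"
    by (simp add: ugl_inc_def eval_Ugl_coset free_algebra_closed eval_free_gen)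
  show "eval_Ugl (ugl_scal m c) = sc c"
    by (simp add: ugl_scal_def eval_Ugl_coset free_algebra_closed eval_free_scal)
qed

lemma eval_mat_unit:
  assumes "i \<in> {1..m}" "j \<in> {1..m}"
  shows "eval_mat (mat_unit m i j) = E i j"
proof -
  have "mat_unit m i j $$ (a - 1, b - 1) = (if a = i then if b = j then 1 else 0 else 0)"
    if "a \<in> {1..m}" "b \<in> {1..m}" for a b
  proof -
    have "a - 1 < m" "b - 1 < m" using that by auto
    then show ?thesis using that by (auto simp: mat_unit_def)
  qed
  then have "eval_mat (mat_unit m i j)
      = (\<Sum>a\<in>{1..m}. \<Sum>b\<in>{1..m}. if b = j then if a = i then E i j else 0 else 0)"
    unfolding eval_mat_def by (intro sum.cong refl) (auto simp: sc_0 sc_1)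
  then show ?thesis using assms by simp
qed

text \<open>The subalgebra generated by the scalars and the \<open>E i j\<close>, built by left
  multiplication with generators, since the spanning argument inducts on the leftmost letter. The
  ambient ring type may be larger, as the product of all \<open>Ugl n\<close> is.\<close>

inductive_set gen :: "'a set" where
  scalar: "sc c \<in> gen"
| E_mult: "\<lbrakk>i \<in> {1..m}; j \<in> {1..m}; u \<in> gen\<rbrakk> \<Longrightarrow> E i j * u \<in> gen"
| add: "u \<in> gen \<Longrightarrow> v \<in> gen \<Longrightarrow> u + v \<in> gen"

lemma gen_sum: "(\<And>x. x \<in> S \<Longrightarrow> f x \<in> gen) \<Longrightarrow> sum f S \<in> gen"
  using gen.scalar[of 0] by (induction S rule: infinite_finite_induct) (auto simp: sc_0 intro: gen.add)

lemma gen_sc_mult: "u \<in> gen \<Longrightarrow> sc c * u \<in> gen"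
proof (induction rule: gen.induct)
  case (scalar d)
  then show ?case using gen.scalar[of "c * d"] by (simp add: sc_mult)
next
  case (E_mult i j u)
  have "sc c * (E i j * u) = E i j * (sc c * u)"
    using sc_central[of c "E i j"] by (metis mult.assoc)
  then show ?case using gen.E_mult[OF E_mult(1,2) E_mult.IH] by simp
qed (auto simp: distrib_left intro: gen.add)

lemma eval_free_gen_mem: "eval_free p \<in> gen"
proof -
  have "eval_word w \<in> gen" for w
  proof (cases w)
    case (Free_Monoid xs)
    have "prod_list (map eval_mat xs) \<in> gen"
    proof (induction xs)
      case Nil
      then show ?case using gen.scalar[of 1] by (simp add: sc_1)
    next
      case (Cons A xs)
      have "(\<Sum>i\<in>{1..m}. \<Sum>j\<in>{1..m}. sc (A $$ (i - 1, j - 1)) * (E i j * prod_list (map eval_mat xs))) \<in> gen"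
        by (intro gen_sum gen_sc_mult gen.E_mult Cons)
      then show ?case by (simp add: eval_mat_def[of A] sum_distrib_right mult.assoc)
    qed
    then show ?thesis by (simp add: eval_word_def Free_Monoid)
  qed
  then show ?thesis unfolding eval_free_def by (intro gen_sum gen_sc_mult)
qed

text \<open>The first argument is the height of the weight of the word, up to sign.\<close>

inductive neg_word :: "nat \<Rightarrow> 'a \<Rightarrow> bool" where
  one: "neg_word 0 1"
| mult: "\<lbrakk>neg_word d w; 1 \<le> j; j < i; i \<le> m\<rbrakk> \<Longrightarrow> neg_word (d + (i - j)) (E i j * w)"

lemma neg_word_0: "neg_word 0 w \<Longrightarrow> w = 1"
  by (cases rule: neg_word.cases) auto

text \<open>That this set contains \<open>gen\<close> (\<open>gen_subset_neg_span\<close>) is the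
  spanning half of the triangular decomposition: modulo \<open>L\<close>, words in the lowering
  operators suffice.\<close>

inductive_set neg_span :: "'a set \<Rightarrow> 'a set" for L where
  ideal: "u \<in> L \<Longrightarrow> u \<in> neg_span L"
| word: "neg_word d w \<Longrightarrow> sc c * w \<in> neg_span L"
| add: "u \<in> neg_span L \<Longrightarrow> v \<in> neg_span L \<Longrightarrow> u + v \<in> neg_span L"

section \<open>Vectors of weight \<open>lam\<close> modulo a left ideal of Verma type\<close>

context
  fixes L :: "'a set" and lam :: "nat \<Rightarrow> complex"
  assumes L: "left_ideal_set L"
    and L_raise: "\<And>i j. \<lbrakk>1 \<le> i; i < j; j \<le> m\<rbrakk> \<Longrightarrow> E i j \<in> L"
    and L_weight: "\<And>i. i \<in> {1..m} \<Longrightarrow> E i i - sc (lam i) \<in> L"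
begin

lemma neg_span_sc_mult: "u \<in> neg_span L \<Longrightarrow> sc c * u \<in> neg_span L"
proof (induction rule: neg_span.induct)
  case (word d w c')
  then show ?case using neg_span.word[of d w "c * c'" L] by (simp add: sc_mult mult.assoc)
qed (auto simp: distrib_left intro: neg_span.intros left_ideal_setD(3)[OF L])

lemma neg_span_diff: "u \<in> neg_span L \<Longrightarrow> v \<in> neg_span L \<Longrightarrow> u - v \<in> neg_span L"
  using neg_span.add[of u L "- v"] neg_span_sc_mult[of v "-1"] by (simp add: sc_uminus sc_1)

lemma neg_span_lower:
  assumes "u \<in> neg_span L" "1 \<le> l" "l < k" "k \<le> m"
  shows "E k l * u \<in> neg_span L"
  using assms(1)
proof (induction rule: neg_span.induct)
  case (word d w c)
  have "E k l * (sc c * w) = sc c * (E k l * w)"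
    using sc_central[of c "E k l"] by (metis mult.assoc)
  then show ?case
    using neg_span.word[OF neg_word.mult[OF word assms(2-4)], of c L] by simp
qed (auto simp: distrib_left intro: neg_span.intros left_ideal_setD(3)[OF L])

text \<open>A new letter is moved past the leading letter of the word. The commutator again puts a
  single letter in front of a shorter word, hence the induction for all \<open>i\<close> and
  \<open>j\<close> at once; a letter that reaches the end becomes a scalar, a lowering operator or
  an element of \<open>L\<close>.\<close>

lemma neg_span_E_word:
  assumes "neg_word d w" "i \<in> {1..m}" "j \<in> {1..m}"
  shows "E i j * w \<in> neg_span L"
  using assms
proof (induction arbitrary: i j rule: neg_word.induct)
  case one
  consider "i < j" | "i = j" | "j < i" by linarith
  then show ?case
  proof cases
    case 1
    then show ?thesis using L_raise[of i j] one by (auto intro: neg_span.ideal)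
  next
    case 2
    have "(E i i - sc (lam i)) + sc (lam i) * 1 \<in> neg_span L"
      using L_weight one by (intro neg_span.add neg_span.ideal neg_span.word[of 0] neg_word.one)
    then show ?thesis using 2 by simp
  next
    case 3
    then show ?thesis
      using neg_span.word[OF neg_word.mult[OF neg_word.one, of j i], of 1 L] one by (simp add: sc_1)
  qed
next
  case (mult d w l k)
  have kl: "k \<in> {1..m}" "l \<in> {1..m}" using mult.hyps by auto
  have eq: "E i j * (E k l * w) = E k l * (E i j * w) + (if j = k then E i l * w else 0)
      - (if l = i then E k j * w else 0)"
    using arg_cong[OF comm[OF mult.prems kl], of "\<lambda>z. z * w"]
    by (simp add: mult.assoc distrib_right left_diff_distrib if_zero_mult)
  have "0 \<in> neg_span L" using left_ideal_setD(1)[OF L] by (rule neg_span.ideal)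
  then have "(if j = k then E i l * w else 0) \<in> neg_span L" "(if l = i then E k j * w else 0) \<in> neg_span L"
    using mult.IH mult.prems kl by auto
  moreover have "E k l * (E i j * w) \<in> neg_span L"
    by (rule neg_span_lower[OF mult.IH[OF mult.prems] mult.hyps(2-4)])
  ultimately show ?case
    unfolding eq by (intro neg_span_diff neg_span.add)
qed

lemma gen_subset_neg_span: "gen \<subseteq> neg_span L"
proof
  fix u assume "u \<in> gen"
  then show "u \<in> neg_span L"
  proof (induction rule: gen.induct)
    case (scalar c)
    then show ?case using neg_span.word[OF neg_word.one, of c L] by simp
  next
    case (E_mult i j u)
    from E_mult.IH show ?case
    proof (induction rule: neg_span.induct)
      case (word d w c)
      have "E i j * (sc c * w) = sc c * (E i j * w)"
        using sc_central[of c "E i j"] by (metis mult.assoc)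
      then show ?case
        using neg_span_sc_mult[OF neg_span_E_word[OF word E_mult(1,2)]] by simp
    qed (auto simp: distrib_left intro: neg_span.intros left_ideal_setD(3)[OF L])
  qed (auto intro: neg_span.add)
qed

text \<open>The coefficients \<open>i\<close> are chosen so that the sum of the i e_{i,i} takes the
  value k - l on the weight eps_k - eps_l of \<open>E k l\<close>. Subtracting \<open>lam i\<close>
  gives the generator the eigenvalue 0.\<close>

definition height_elt :: 'a where
  "height_elt = (\<Sum>i\<in>{1..m}. of_nat i * (E i i - sc (lam i)))"

lemma height_elt_mem: "height_elt \<in> L"
  unfolding height_elt_def
  by (intro left_ideal_set_sum[OF L] left_ideal_setD(3)[OF L] L_weight)

lemma height_elt_E:
  assumes "1 \<le> l" "l < k" "k \<le> m"
  shows "height_elt * E k l = E k l * height_elt + sc (of_nat (k - l)) * E k l"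
proof -
  have kl: "k \<in> {1..m}" "l \<in> {1..m}" using assms by auto
  have "of_nat i * (E i i - sc (lam i)) * E k l = E k l * (of_nat i * (E i i - sc (lam i)))
      + ((if i = k then of_nat k * E k l else 0) - (if i = l then of_nat l * E k l else 0))"
    if i: "i \<in> {1..m}" for i
  proof -
    have "(E i i - sc (lam i)) * E k l = E k l * (E i i - sc (lam i))
       + (if i = k then E k l else 0) - (if i = l then E k l else 0)"
      using comm[OF i i kl] sc_central[of "lam i" "E k l"]
      by (auto simp: left_diff_distrib right_diff_distrib)
    then have "of_nat i * ((E i i - sc (lam i)) * E k l) = of_nat i * E k l * (E i i - sc (lam i))
       + ((if i = k then of_nat k * E k l else 0) - (if i = l then of_nat l * E k l else 0))"
      by (auto simp: distrib_left right_diff_distrib mult.assoc)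
    also have "of_nat i * E k l = E k l * of_nat i" by (rule mult_of_nat_commute)
    finally show ?thesis by (simp add: mult.assoc)
  qed
  then have "height_elt * E k l = (\<Sum>i\<in>{1..m}. E k l * (of_nat i * (E i i - sc (lam i)))
      + ((if i = k then of_nat k * E k l else 0) - (if i = l then of_nat l * E k l else 0)))"
    unfolding height_elt_def sum_distrib_right by (intro sum.cong refl)
  also have "\<dots> = E k l * height_elt + (of_nat k * E k l - of_nat l * E k l)"
    using kl by (simp add: sum.distrib sum_subtractf height_elt_def sum_distrib_left)
  also have "of_nat k * E k l - of_nat l * E k l = sc (of_nat (k - l)) * E k l"
    unfolding sc_of_nat using assms by (simp add: left_diff_distrib)
  finally show ?thesis .
qed

lemma height_elt_word:
  assumes "neg_word d w"
  shows "(height_elt - sc (of_nat d)) * w \<in> L"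
  using assms
proof (induction rule: neg_word.induct)
  case one
  then show ?case using height_elt_mem by (simp add: sc_0)
next
  case (mult d w j i)
  have "(height_elt - sc (of_nat (d + (i - j)))) * (E i j * w)
      = (height_elt * E i j - sc (of_nat (i - j)) * E i j - sc (of_nat d) * E i j) * w"
    by (simp add: sc_add left_diff_distrib distrib_right mult.assoc)
  also have "\<dots> = (E i j * height_elt - E i j * sc (of_nat d)) * w"
    using height_elt_E[OF mult.hyps(2-4)] sc_central[of "of_nat d" "E i j"] by simp
  also have "\<dots> = E i j * ((height_elt - sc (of_nat d)) * w)"
    by (simp add: left_diff_distrib right_diff_distrib mult.assoc)
  finally show ?case using left_ideal_setD(3)[OF L mult.IH] by simp
qed

text \<open>
  Modulo \<open>L\<close>, the element \<open>height_elt\<close> multiplies a word of height \<open>d\<close> by \<open>d\<close> and a vector of weight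
  \<open>lam\<close> by \<open>0\<close>.  Hence \<open>height_poly D\<close> kills all words of height \<open>1, \<dots>, D\<close> and multiplies vectors
  of weight \<open>lam\<close> by a nonzero scalar.
\<close>

primrec height_poly :: "nat \<Rightarrow> 'a" where
  "height_poly 0 = 1"
| "height_poly (Suc D) = height_poly D * (height_elt - sc (of_nat (Suc D)))"

lemma height_poly_eigen:
  assumes "(height_elt - sc \<mu>) * x \<in> L"
  shows "height_poly D * x - sc (\<Prod>e\<in>{1..D}. \<mu> - of_nat e) * x \<in> L"
proof (induction D)
  case 0
  then show ?case using left_ideal_setD(1)[OF L] by (simp add: sc_1)
next
  case (Suc D)
  define c where "c = \<mu> - of_nat (Suc D)"
  have "height_elt - sc (of_nat (Suc D)) = (height_elt - sc \<mu>) + sc c"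
    by (simp only: c_def sc_diff) simp
  then have "height_poly (Suc D) * x = height_poly D * ((height_elt - sc \<mu>) * x) + height_poly D * sc c * x"
    by (simp only: height_poly.simps distrib_left distrib_right mult.assoc)
  then have 1: "height_poly (Suc D) * x = height_poly D * ((height_elt - sc \<mu>) * x) + sc c * (height_poly D * x)"
    by (simp only: sc_central[of c "height_poly D", symmetric] mult.assoc)
  have 2: "sc (\<Prod>e\<in>{1..Suc D}. \<mu> - of_nat e) * x = sc c * (sc (\<Prod>e\<in>{1..D}. \<mu> - of_nat e) * x)"
    by (simp add: c_def mult.commute flip: mult.assoc sc_mult)
  have "height_poly (Suc D) * x - sc (\<Prod>e\<in>{1..Suc D}. \<mu> - of_nat e) * x
      = height_poly D * ((height_elt - sc \<mu>) * x)
        + sc c * (height_poly D * x - sc (\<Prod>e\<in>{1..D}. \<mu> - of_nat e) * x)"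
    unfolding 1 2 by (simp add: right_diff_distrib)
  then show ?case using Suc assms L by (simp add: left_ideal_setD)
qed

text \<open>The scalar \<open>c\<close> collects the words of height 0, all equal to 1. The claim
  holds for all large \<open>D\<close> so that two summands can share one \<open>D\<close>.\<close>

lemma neg_span_height_poly:
  assumes "x \<in> neg_span L"
  shows "\<exists>c D0. \<forall>D\<ge>D0. height_poly D * (x - sc c) \<in> L"
  using assms
proof (induction rule: neg_span.induct)
  case (ideal u)
  then have "\<forall>D\<ge>0. height_poly D * (u - sc 0) \<in> L"
    using left_ideal_setD(3)[OF L] by (simp add: sc_0)
  then show ?case by blast
next
  case (word d w c)
  show ?case
  proof (cases "d = 0")
    case True
    then have "w = 1" using neg_word_0 word by simp
    then have "\<forall>D\<ge>0. height_poly D * (sc c * w - sc c) \<in> L"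
      using left_ideal_setD(1)[OF L] by simp
    then show ?thesis by blast
  next
    case False
    have "height_poly D * (sc c * w - sc 0) \<in> L" if "d \<le> D" for D
    proof -
      \<comment> \<open>The factor \<open>e = d\<close> is 0, as 1 <= d <= D.\<close>
      have z: "(\<Prod>e\<in>{1..D}. of_nat d - of_nat e :: complex) = 0"
        using that False by (intro prod_zero) auto
      then have "height_poly D * w \<in> L"
        using height_poly_eigen[OF height_elt_word[OF word], of D] unfolding z by (simp add: sc_0)
      moreover have "height_poly D * (sc c * w) = sc c * (height_poly D * w)"
        using sc_central[of c "height_poly D"] by (metis mult.assoc)
      ultimately show ?thesis using left_ideal_setD(3)[OF L] by (simp add: sc_0)
    qed
    then show ?thesis by blast
  qed
next
  case (add u v)
  then obtain c D0 c' D0' where "\<forall>D\<ge>D0. height_poly D * (u - sc c) \<in> L"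
    "\<forall>D\<ge>D0'. height_poly D * (v - sc c') \<in> L" by blast
  then have "\<forall>D\<ge>max D0 D0'. height_poly D * (u - sc c) + height_poly D * (v - sc c') \<in> L"
    using left_ideal_setD(2)[OF L] by simp
  then have "\<forall>D\<ge>max D0 D0'. height_poly D * (u + v - sc (c + c')) \<in> L"
    by (simp add: sc_add algebra_simps)
  then show ?case by blast
qed

text \<open>Modulo \<open>L\<close>, the element \<open>x - sc c\<close> is killed by
  \<open>height_poly D\<close>. It also has eigenvalue 0 for \<open>height_elt\<close>, so
  \<open>height_poly D\<close> multiplies it by the product of -1, ..., -D, which is
  invertible.\<close>

lemma highest_weight_scalar:
  assumes "x \<in> gen" and weight: "\<And>i. i \<in> {1..m} \<Longrightarrow> (E i i - sc (lam i)) * x \<in> L"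
  shows "\<exists>c. x - sc c \<in> L"
proof -
  obtain c D where D: "height_poly D * (x - sc c) \<in> L"
    using neg_span_height_poly assms(1) gen_subset_neg_span by blast
  define p where "p = (\<Prod>e\<in>{1..D}. 0 - of_nat e :: complex)"
  have "p \<noteq> 0" unfolding p_def by (subst prod_zero_iff) auto
  have "height_elt * x \<in> L"
    unfolding height_elt_def sum_distrib_right mult.assoc
    by (intro left_ideal_set_sum[OF L] left_ideal_setD(3)[OF L] weight)
  moreover have "height_elt * sc c \<in> L"
    using left_ideal_setD(3)[OF L height_elt_mem, of "sc c"] by (simp add: sc_central)
  ultimately have "height_elt * x - height_elt * sc c \<in> L"
    by (rule left_ideal_setD(5)[OF L])
  then have "(height_elt - sc 0) * (x - sc c) \<in> L"
    by (simp add: sc_0 right_diff_distrib)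
  from height_poly_eigen[OF this, of D]
  have "height_poly D * (x - sc c) - sc p * (x - sc c) \<in> L" unfolding p_def .
  then have "height_poly D * (x - sc c) - (height_poly D * (x - sc c) - sc p * (x - sc c)) \<in> L"
    by (rule left_ideal_setD(5)[OF L D])
  then have "sc (inverse p) * (sc p * (x - sc c)) \<in> L"
    unfolding diff_diff_eq2 add_diff_cancel_left' by (rule left_ideal_setD(3)[OF L])
  also have "sc (inverse p) * (sc p * (x - sc c)) = x - sc c"
    using \<open>p \<noteq> 0\<close> by (simp add: mult.assoc[symmetric] sc_1 flip: sc_mult)
  finally show ?thesis by blast
qed

end

end


section \<open>The enveloping algebras as one ring type\<close>

definition Ugl_proj :: "nat \<Rightarrow> complex mat free_alg \<Rightarrow> complex mat free_alg set" where
  "Ugl_proj m p = env_ideal m +>\<^bsub>free_algebra (gl m)\<^esub> p"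

lemma ugl_inc_proj: "ugl_inc m A = Ugl_proj m (free_gen A)"
  and ugl_scal_proj: "ugl_scal m c = Ugl_proj m (free_scal c)"
  by (simp_all add: ugl_inc_def ugl_scal_def Ugl_proj_def)

lemma Ugl_proj_ring_hom: "ring_hom_ring (free_algebra (gl m)) (Ugl m) (Ugl_proj m)"
  using ideal.rcos_ring_hom_ring[OF ideal_env_ideal] unfolding Ugl_proj_def Ugl_def .

lemma Ugl_proj_closed: "p \<in> carrier (free_algebra (gl m)) \<Longrightarrow> Ugl_proj m p \<in> carrier (Ugl m)"
  using ring_hom_ring.homh[OF Ugl_proj_ring_hom] by (rule ring_hom_closed)

lemma Ugl_proj_0: "Ugl_proj m 0 = \<zero>\<^bsub>Ugl m\<^esub>"
  and Ugl_proj_1: "Ugl_proj m 1 = \<one>\<^bsub>Ugl m\<^esub>"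
proof -
  interpret h: ring_hom_ring "free_algebra (gl m)" "Ugl m" "Ugl_proj m" by (rule Ugl_proj_ring_hom)
  show "Ugl_proj m 0 = \<zero>\<^bsub>Ugl m\<^esub>" "Ugl_proj m 1 = \<one>\<^bsub>Ugl m\<^esub>"
    using h.hom_zero h.hom_one by (simp_all add: free_algebra_simps)
qed

lemma Ugl_proj_hom:
  assumes "p \<in> carrier (free_algebra (gl m))" "q \<in> carrier (free_algebra (gl m))"
  shows "Ugl_proj m (p + q) = Ugl_proj m p \<oplus>\<^bsub>Ugl m\<^esub> Ugl_proj m q"
    and "Ugl_proj m (p - q) = Ugl_proj m p \<ominus>\<^bsub>Ugl m\<^esub> Ugl_proj m q"
    and "Ugl_proj m (p * q) = Ugl_proj m p \<otimes>\<^bsub>Ugl m\<^esub> Ugl_proj m q"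
proof -
  interpret h: ring_hom_ring "free_algebra (gl m)" "Ugl m" "Ugl_proj m" by (rule Ugl_proj_ring_hom)
  have add: "Ugl_proj m (p + q) = Ugl_proj m p \<oplus>\<^bsub>Ugl m\<^esub> Ugl_proj m q"
    if "p \<in> carrier (free_algebra (gl m))" "q \<in> carrier (free_algebra (gl m))" for p q
    using h.hom_add[OF that] by (simp add: free_algebra_simps)
  show "Ugl_proj m (p + q) = Ugl_proj m p \<oplus>\<^bsub>Ugl m\<^esub> Ugl_proj m q"
    by (rule add[OF assms])
  have "Ugl_proj m p = Ugl_proj m (p - q) \<oplus>\<^bsub>Ugl m\<^esub> Ugl_proj m q"
    using add[OF free_algebra_diff_closed[OF assms] assms(2)] by simp
  then show "Ugl_proj m (p - q) = Ugl_proj m p \<ominus>\<^bsub>Ugl m\<^esub> Ugl_proj m q"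
    using Ugl_proj_closed assms free_algebra_diff_closed[OF assms]
    by (simp add: h.S.minus_eq h.S.a_assoc h.S.r_neg)
  show "Ugl_proj m (p * q) = Ugl_proj m p \<otimes>\<^bsub>Ugl m\<^esub> Ugl_proj m q"
    using h.hom_mult[OF assms] by (simp add: free_algebra_simps)
qed

lemma Ugl_proj_eq_zero:
  assumes "p \<in> env_ideal m"
  shows "Ugl_proj m p = \<zero>\<^bsub>Ugl m\<^esub>"
proof -
  interpret I: ideal "env_ideal m" "free_algebra (gl m)" by (rule ideal_env_ideal)
  show ?thesis using assms I.a_rcos_const by (simp add: Ugl_proj_def Ugl_def FactRing_def)
qed

lemma env_relations_ideal: "env_relations m \<subseteq> env_ideal m"
  unfolding env_ideal_def by (rule ring.genideal_self[OF ring_free_algebra env_relations_subset])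

lemma Ugl_carrierE:
  assumes "X \<in> carrier (Ugl m)"
  obtains p where "p \<in> carrier (free_algebra (gl m))" "X = Ugl_proj m p"
  using Ugl_carrier_coset[OF assms] unfolding Ugl_proj_def by metis

lemma ugl_inc_carrier: "A \<in> gl m \<Longrightarrow> ugl_inc m A \<in> carrier (Ugl m)"
  and ugl_scal_carrier: "ugl_scal m c \<in> carrier (Ugl m)"
  by (simp_all add: ugl_inc_proj ugl_scal_proj Ugl_proj_closed free_algebra_closed)

lemma ring_Ugl_diff_zero:
  assumes "x \<in> carrier (Ugl m)" "y \<in> carrier (Ugl m)" "x \<ominus>\<^bsub>Ugl m\<^esub> y = \<zero>\<^bsub>Ugl m\<^esub>"
  shows "x = y"
  using ring.r_right_minus_eq[OF ring_Ugl] assms by metis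

lemma ugl_inc_add:
  assumes "A \<in> gl m" "B \<in> gl m"
  shows "ugl_inc m (A + B) = ugl_inc m A \<oplus>\<^bsub>Ugl m\<^esub> ugl_inc m B"
proof (rule ring_Ugl_diff_zero)
  have AB: "A + B \<in> gl m" using assms by (simp add: gl_def)
  show "ugl_inc m (A + B) \<in> carrier (Ugl m)" by (rule ugl_inc_carrier[OF AB])
  show "ugl_inc m A \<oplus>\<^bsub>Ugl m\<^esub> ugl_inc m B \<in> carrier (Ugl m)"
    using ring.ring_simprules(1)[OF ring_Ugl] ugl_inc_carrier assms by blast
  have "free_gen (A + B) - (free_gen A + free_gen B) \<in> env_ideal m"
    using env_relations_ideal assms unfolding env_relations_def by (fastforce simp: diff_diff_eq)
  from Ugl_proj_eq_zero[OF this]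
  show "ugl_inc m (A + B) \<ominus>\<^bsub>Ugl m\<^esub> (ugl_inc m A \<oplus>\<^bsub>Ugl m\<^esub> ugl_inc m B) = \<zero>\<^bsub>Ugl m\<^esub>"
    using assms AB by (simp add: Ugl_proj_hom free_algebra_closed ugl_inc_proj)
qed

lemma ugl_inc_smult:
  assumes "A \<in> gl m"
  shows "ugl_inc m (c \<cdot>\<^sub>m A) = ugl_scal m c \<otimes>\<^bsub>Ugl m\<^esub> ugl_inc m A"
proof (rule ring_Ugl_diff_zero)
  have cA: "c \<cdot>\<^sub>m A \<in> gl m" using assms by (simp add: gl_def)
  show "ugl_inc m (c \<cdot>\<^sub>m A) \<in> carrier (Ugl m)" by (rule ugl_inc_carrier[OF cA])
  show "ugl_scal m c \<otimes>\<^bsub>Ugl m\<^esub> ugl_inc m A \<in> carrier (Ugl m)"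
    using ring.ring_simprules(5)[OF ring_Ugl] ugl_inc_carrier ugl_scal_carrier assms by blast
  have "free_gen (c \<cdot>\<^sub>m A) - free_scal c * free_gen A \<in> env_ideal m"
    using env_relations_ideal assms unfolding env_relations_def by blast
  from Ugl_proj_eq_zero[OF this]
  show "ugl_inc m (c \<cdot>\<^sub>m A) \<ominus>\<^bsub>Ugl m\<^esub> (ugl_scal m c \<otimes>\<^bsub>Ugl m\<^esub> ugl_inc m A) = \<zero>\<^bsub>Ugl m\<^esub>"
    using assms cA by (simp add: Ugl_proj_hom free_algebra_closed ugl_inc_proj ugl_scal_proj)
qed

lemma lie_bracket_closed: "A \<in> gl m \<Longrightarrow> B \<in> gl m \<Longrightarrow> lie_bracket A B \<in> gl m"
  unfolding gl_def lie_bracket_def by (intro minus_carrier_mat mult_carrier_mat)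

lemma ugl_inc_bracket:
  assumes "A \<in> gl m" "B \<in> gl m"
  shows "ugl_inc m A \<otimes>\<^bsub>Ugl m\<^esub> ugl_inc m B \<ominus>\<^bsub>Ugl m\<^esub> ugl_inc m B \<otimes>\<^bsub>Ugl m\<^esub> ugl_inc m A
    = ugl_inc m (lie_bracket A B)"
proof (rule ring_Ugl_diff_zero)
  note AB = lie_bracket_closed[OF assms]
  have *: "free_gen A * free_gen B - free_gen B * free_gen A \<in> carrier (free_algebra (gl m))"
    using assms by (simp add: free_algebra_closed free_algebra_diff_closed)
  have **: "Ugl_proj m (free_gen A * free_gen B - free_gen B * free_gen A)
     = ugl_inc m A \<otimes>\<^bsub>Ugl m\<^esub> ugl_inc m B \<ominus>\<^bsub>Ugl m\<^esub> ugl_inc m B \<otimes>\<^bsub>Ugl m\<^esub> ugl_inc m A"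
    using assms by (simp add: Ugl_proj_hom free_algebra_closed ugl_inc_proj)
  show "ugl_inc m (lie_bracket A B) \<in> carrier (Ugl m)" by (rule ugl_inc_carrier[OF AB])
  show "ugl_inc m A \<otimes>\<^bsub>Ugl m\<^esub> ugl_inc m B \<ominus>\<^bsub>Ugl m\<^esub> ugl_inc m B \<otimes>\<^bsub>Ugl m\<^esub> ugl_inc m A \<in> carrier (Ugl m)"
    using Ugl_proj_closed[OF *] by (simp only: **)
  have "free_gen A * free_gen B - free_gen B * free_gen A - free_gen (lie_bracket A B) \<in> env_ideal m"
    using env_relations_ideal assms unfolding env_relations_def by blast
  from Ugl_proj_eq_zero[OF this]
  show "ugl_inc m A \<otimes>\<^bsub>Ugl m\<^esub> ugl_inc m B \<ominus>\<^bsub>Ugl m\<^esub> ugl_inc m B \<otimes>\<^bsub>Ugl m\<^esub> ugl_inc m A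
      \<ominus>\<^bsub>Ugl m\<^esub> ugl_inc m (lie_bracket A B) = \<zero>\<^bsub>Ugl m\<^esub>"
    using Ugl_proj_hom(2)[OF * free_algebra_closed(6)[OF AB]] by (simp only: ** ugl_inc_proj)
qed

lemma free_scal_central: "free_scal c * p = p * free_scal c"
proof -
  have "free_scal c * Poly_Mapping.single w d = Poly_Mapping.single w d * free_scal c" for w d
    by (simp add: free_scal_def mult_single mult.commute)
  then show ?thesis
    by (subst (1 2) poly_mapping_sum_single[of p], unfold sum_distrib_left sum_distrib_right)
      (intro sum.cong refl)
qed

lemma ugl_scal_hom:
  "ugl_scal m 1 = \<one>\<^bsub>Ugl m\<^esub>"
  "ugl_scal m (c + d) = ugl_scal m c \<oplus>\<^bsub>Ugl m\<^esub> ugl_scal m d"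
  "ugl_scal m (c * d) = ugl_scal m c \<otimes>\<^bsub>Ugl m\<^esub> ugl_scal m d"
  "X \<in> carrier (Ugl m) \<Longrightarrow> ugl_scal m c \<otimes>\<^bsub>Ugl m\<^esub> X = X \<otimes>\<^bsub>Ugl m\<^esub> ugl_scal m c"
proof -
  have "free_scal (c + d) = free_scal c + (free_scal d :: complex mat free_alg)"
    "free_scal (c * d) = free_scal c * (free_scal d :: complex mat free_alg)"
    "free_scal 1 = (1 :: complex mat free_alg)"
    by (simp_all add: free_scal_def single_add mult_single)
  then show "ugl_scal m 1 = \<one>\<^bsub>Ugl m\<^esub>"
    "ugl_scal m (c + d) = ugl_scal m c \<oplus>\<^bsub>Ugl m\<^esub> ugl_scal m d"
    "ugl_scal m (c * d) = ugl_scal m c \<otimes>\<^bsub>Ugl m\<^esub> ugl_scal m d"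
    using Ugl_proj_hom[OF free_algebra_closed(7) free_algebra_closed(7), of m] Ugl_proj_1
    by (simp_all add: ugl_scal_proj)
  show "ugl_scal m c \<otimes>\<^bsub>Ugl m\<^esub> X = X \<otimes>\<^bsub>Ugl m\<^esub> ugl_scal m c" if X: "X \<in> carrier (Ugl m)"
  proof -
    obtain p where p: "p \<in> carrier (free_algebra (gl m))" "X = Ugl_proj m p"
      using X by (rule Ugl_carrierE)
    show ?thesis
      unfolding ugl_scal_proj p(2) Ugl_proj_hom(3)[OF free_algebra_closed(7) p(1), symmetric]
        Ugl_proj_hom(3)[OF p(1) free_algebra_closed(7), symmetric] by (simp only: free_scal_central)
  qed
qed

text \<open>A unital homomorphism to a nonzero ring separates 1 from 0; the model with all exponents
  0 provides one.\<close>

lemma Ugl_nontrivial: "\<one>\<^bsub>Ugl m\<^esub> \<noteq> \<zero>\<^bsub>Ugl m\<^esub>"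
proof
  interpret gl_elements m "gl_op m (\<lambda>_. 0)" scale_op by (rule gl_elements_gl_op)
  assume "\<one>\<^bsub>Ugl m\<^esub> = \<zero>\<^bsub>Ugl m\<^esub>"
  then show False using eval_Ugl_simps(1,2) by simp
qed

text \<open>
  The ring \<open>Ugl m\<close> depends on the value \<open>m\<close> and is not a type.  The product of all these rings is a
  type of class \<^class>\<open>ring_1\<close>, and its component homomorphisms carry the identities proved for
  such types over to \<open>Ugl m\<close>.
\<close>

typedef ugl_prod = "{f. \<forall>n. f n \<in> carrier (Ugl n)}"
proof
  show "(\<lambda>n. \<one>\<^bsub>Ugl n\<^esub>) \<in> {f. \<forall>n. f n \<in> carrier (Ugl n)}"
    using ring.ring_simprules(6)[OF ring_Ugl] by blast
qed

definition ugl_comp :: "nat \<Rightarrow> ugl_prod \<Rightarrow> complex mat free_alg set" where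
  "ugl_comp m f = Rep_ugl_prod f m"

lemma ugl_comp_closed: "ugl_comp m f \<in> carrier (Ugl m)"
  using Rep_ugl_prod[of f] by (simp add: ugl_comp_def)

lemma ugl_prod_eqI: "(\<And>n. ugl_comp n f = ugl_comp n g) \<Longrightarrow> f = g"
  unfolding ugl_comp_def by (metis Rep_ugl_prod_inject ext)

lemma ugl_comp_Abs:
  "(\<And>n. f n \<in> carrier (Ugl n)) \<Longrightarrow> ugl_comp m (Abs_ugl_prod f) = f m"
  by (simp add: ugl_comp_def Abs_ugl_prod_inverse)

instantiation ugl_prod :: ring_1
begin

definition "0 = Abs_ugl_prod (\<lambda>n. \<zero>\<^bsub>Ugl n\<^esub>)"
definition "1 = Abs_ugl_prod (\<lambda>n. \<one>\<^bsub>Ugl n\<^esub>)"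
definition "f + g = Abs_ugl_prod (\<lambda>n. ugl_comp n f \<oplus>\<^bsub>Ugl n\<^esub> ugl_comp n g)"
definition "f * g = Abs_ugl_prod (\<lambda>n. ugl_comp n f \<otimes>\<^bsub>Ugl n\<^esub> ugl_comp n g)"
definition "- f = Abs_ugl_prod (\<lambda>n. \<ominus>\<^bsub>Ugl n\<^esub> ugl_comp n f)"
definition "f - g = Abs_ugl_prod (\<lambda>n. ugl_comp n f \<ominus>\<^bsub>Ugl n\<^esub> ugl_comp n g)"

lemma ugl_comp_ring_simps:
  "ugl_comp m 0 = \<zero>\<^bsub>Ugl m\<^esub>"
  "ugl_comp m 1 = \<one>\<^bsub>Ugl m\<^esub>"
  "ugl_comp m (f + g) = ugl_comp m f \<oplus>\<^bsub>Ugl m\<^esub> ugl_comp m g"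
  "ugl_comp m (f * g) = ugl_comp m f \<otimes>\<^bsub>Ugl m\<^esub> ugl_comp m g"
  "ugl_comp m (- f) = \<ominus>\<^bsub>Ugl m\<^esub> ugl_comp m f"
  "ugl_comp m (f - g) = ugl_comp m f \<ominus>\<^bsub>Ugl m\<^esub> ugl_comp m g"
proof -
  interpret R: ring "Ugl n" for n by (rule ring_Ugl)
  note c = ugl_comp_closed
  show "ugl_comp m 0 = \<zero>\<^bsub>Ugl m\<^esub>" "ugl_comp m 1 = \<one>\<^bsub>Ugl m\<^esub>"
    "ugl_comp m (f + g) = ugl_comp m f \<oplus>\<^bsub>Ugl m\<^esub> ugl_comp m g"
    "ugl_comp m (f * g) = ugl_comp m f \<otimes>\<^bsub>Ugl m\<^esub> ugl_comp m g"
    "ugl_comp m (- f) = \<ominus>\<^bsub>Ugl m\<^esub> ugl_comp m f"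
    "ugl_comp m (f - g) = ugl_comp m f \<ominus>\<^bsub>Ugl m\<^esub> ugl_comp m g"
    by (simp_all add: zero_ugl_prod_def one_ugl_prod_def plus_ugl_prod_def times_ugl_prod_def
        uminus_ugl_prod_def minus_ugl_prod_def ugl_comp_Abs c)
qed

instance
proof
  interpret R: ring "Ugl n" for n by (rule ring_Ugl)
  fix a b c :: ugl_prod
  note s = ugl_comp_ring_simps ugl_comp_closed
  show "a + b + c = a + (b + c)" by (rule ugl_prod_eqI) (simp add: s R.a_assoc)
  show "a + b = b + a" by (rule ugl_prod_eqI) (simp add: s R.a_comm)
  show "0 + a = a" by (rule ugl_prod_eqI) (simp add: s)
  show "- a + a = 0" by (rule ugl_prod_eqI) (simp add: s R.l_neg)
  show "a - b = a + - b" by (rule ugl_prod_eqI) (simp add: s R.minus_eq)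
  show "a * b * c = a * (b * c)" by (rule ugl_prod_eqI) (simp add: s R.m_assoc)
  show "1 * a = a" by (rule ugl_prod_eqI) (simp add: s)
  show "a * 1 = a" by (rule ugl_prod_eqI) (simp add: s)
  show "(a + b) * c = a * c + b * c" by (rule ugl_prod_eqI) (simp add: s R.l_distr)
  show "a * (b + c) = a * b + a * c" by (rule ugl_prod_eqI) (simp add: s R.r_distr)
  show "(0::ugl_prod) \<noteq> 1" using Ugl_nontrivial by (metis s(1,2))
qed

end

section \<open>Elements of one component inside the product ring\<close>

definition ugl_lift :: "nat \<Rightarrow> complex mat free_alg set \<Rightarrow> ugl_prod" where
  "ugl_lift m u = Abs_ugl_prod (\<lambda>n. if n = m then u else \<zero>\<^bsub>Ugl n\<^esub>)"

text \<open>Scalars are placed in every component, in contrast to \<open>ugl_lift\<close>, because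
  \<open>scal_prod 1\<close> has to be the unit of the product ring.\<close>

definition scal_prod :: "complex \<Rightarrow> ugl_prod" where
  "scal_prod c = Abs_ugl_prod (\<lambda>n. ugl_scal n c)"

lemma ugl_comp_lift:
  assumes "u \<in> carrier (Ugl m)"
  shows "ugl_comp n (ugl_lift m u) = (if n = m then u else \<zero>\<^bsub>Ugl n\<^esub>)"
proof -
  interpret R: ring "Ugl n" for n by (rule ring_Ugl)
  show ?thesis unfolding ugl_lift_def by (subst ugl_comp_Abs) (use assms in auto)
qed

lemma ugl_comp_scal: "ugl_comp m (scal_prod c) = ugl_scal m c"
  by (simp add: scal_prod_def ugl_comp_Abs ugl_scal_carrier)

lemmas ugl_comp_simps = ugl_comp_ring_simps ugl_comp_closed ugl_comp_scal

lemma ugl_lift_hom: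
  assumes "u \<in> carrier (Ugl m)" "v \<in> carrier (Ugl m)"
  shows "ugl_lift m (u \<oplus>\<^bsub>Ugl m\<^esub> v) = ugl_lift m u + ugl_lift m v"
    and "ugl_lift m (u \<otimes>\<^bsub>Ugl m\<^esub> v) = ugl_lift m u * ugl_lift m v"
    and "ugl_lift m (u \<ominus>\<^bsub>Ugl m\<^esub> v) = ugl_lift m u - ugl_lift m v"
    and "ugl_lift m (ugl_scal m c \<otimes>\<^bsub>Ugl m\<^esub> v) = scal_prod c * ugl_lift m v"
proof -
  interpret R: ring "Ugl n" for n by (rule ring_Ugl)
  have s: "ugl_scal n c \<in> carrier (Ugl n)" for n by (rule ugl_scal_carrier)
  show "ugl_lift m (u \<oplus>\<^bsub>Ugl m\<^esub> v) = ugl_lift m u + ugl_lift m v"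
    "ugl_lift m (u \<otimes>\<^bsub>Ugl m\<^esub> v) = ugl_lift m u * ugl_lift m v"
    "ugl_lift m (u \<ominus>\<^bsub>Ugl m\<^esub> v) = ugl_lift m u - ugl_lift m v"
    "ugl_lift m (ugl_scal m c \<otimes>\<^bsub>Ugl m\<^esub> v) = scal_prod c * ugl_lift m v"
    by (rule ugl_prod_eqI; use assms s in \<open>simp add: ugl_comp_simps ugl_comp_lift R.minus_eq\<close>)+
qed

definition inc_prod :: "nat \<Rightarrow> complex mat \<Rightarrow> ugl_prod" where
  "inc_prod m A = ugl_lift m (ugl_inc m A)"

lemma ugl_comp_inc_prod: "A \<in> gl m \<Longrightarrow> ugl_comp m (inc_prod m A) = ugl_inc m A"
  by (simp add: inc_prod_def ugl_comp_lift ugl_inc_carrier)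

lemma inc_prod_hom:
  assumes "A \<in> gl m" "B \<in> gl m"
  shows "inc_prod m (A + B) = inc_prod m A + inc_prod m B"
    and "inc_prod m (c \<cdot>\<^sub>m A) = scal_prod c * inc_prod m A"
    and "inc_prod m A * inc_prod m B - inc_prod m B * inc_prod m A = inc_prod m (lie_bracket A B)"
proof -
  have c: "ugl_inc m A \<in> carrier (Ugl m)" "ugl_inc m B \<in> carrier (Ugl m)"
    using assms ugl_inc_carrier by auto
  then have "ugl_inc m A \<otimes>\<^bsub>Ugl m\<^esub> ugl_inc m B \<in> carrier (Ugl m)"
    "ugl_inc m B \<otimes>\<^bsub>Ugl m\<^esub> ugl_inc m A \<in> carrier (Ugl m)"
    using ring.ring_simprules(5)[OF ring_Ugl] by blast+
  then show "inc_prod m A * inc_prod m B - inc_prod m B * inc_prod m A = inc_prod m (lie_bracket A B)"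
    using c by (simp add: inc_prod_def ugl_lift_hom flip: ugl_inc_bracket[OF assms])
  show "inc_prod m (A + B) = inc_prod m A + inc_prod m B"
    "inc_prod m (c \<cdot>\<^sub>m A) = scal_prod c * inc_prod m A"
    using c by (simp_all add: inc_prod_def ugl_inc_add ugl_inc_smult assms ugl_lift_hom)
qed

lemma scal_prod_hom:
  "scal_prod 1 = 1" "scal_prod (c + d) = scal_prod c + scal_prod d"
  "scal_prod (c * d) = scal_prod c * scal_prod d" "scal_prod c * f = f * scal_prod c"
proof -
  show "scal_prod 1 = 1" "scal_prod (c + d) = scal_prod c + scal_prod d"
    "scal_prod (c * d) = scal_prod c * scal_prod d"
    by (rule ugl_prod_eqI; simp add: ugl_comp_simps ugl_scal_hom(1-3))+
  show "scal_prod c * f = f * scal_prod c"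
    by (rule ugl_prod_eqI) (simp only: ugl_comp_simps ugl_scal_hom(4)[OF ugl_comp_closed])
qed

lemma scal_prod_0: "scal_prod 0 = 0"
  using scal_prod_hom(2)[of 0 0] by simp

lemma mat_unit_gl: "mat_unit m i j \<in> gl m"
  by (simp add: mat_unit_def gl_def)

lemma inc_prod_zero: "inc_prod m (0\<^sub>m m m) = 0"
proof -
  have "0 \<cdot>\<^sub>m 0\<^sub>m m m = (0\<^sub>m m m :: complex mat)" by (intro eq_matI) auto
  then show ?thesis
    using inc_prod_hom(2)[of "0\<^sub>m m m" m "0\<^sub>m m m" 0] by (simp add: gl_def scal_prod_0)
qed

lemma mat_unit_mult:
  assumes "j \<in> {1..m}" "k \<in> {1..m}"
  shows "mat_unit m i j * mat_unit m k l = (if j = k then mat_unit m i l else 0\<^sub>m m m)"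
proof (rule eq_matI)
  fix a b assume ab: "a < dim_row (if j = k then mat_unit m i l else 0\<^sub>m m m)"
    "b < dim_col (if j = k then mat_unit m i l else 0\<^sub>m m m)"
  then have "a < m" "b < m" by (auto simp: mat_unit_def split: if_splits)
  then have "(mat_unit m i j * mat_unit m k l) $$ (a, b)
     = (\<Sum>x = 0..<m. mat_unit m i j $$ (a, x) * mat_unit m k l $$ (x, b))"
    by (simp add: mat_unit_def scalar_prod_def)
  also have "\<dots> = (\<Sum>x = 0..<m. if x = j - 1 then if a + 1 = i \<and> b + 1 = l \<and> j = k then 1 else 0 else 0)"
    using assms \<open>a < m\<close> \<open>b < m\<close> by (intro sum.cong refl) (auto simp: mat_unit_def)
  also have "\<dots> = (if a + 1 = i \<and> b + 1 = l \<and> j = k then 1 else 0)"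
  proof -
    have "j - 1 \<in> {0..<m}" using assms by auto
    then show ?thesis by simp
  qed
  finally show "(mat_unit m i j * mat_unit m k l) $$ (a, b)
      = (if j = k then mat_unit m i l else 0\<^sub>m m m) $$ (a, b)"
    using \<open>a < m\<close> \<open>b < m\<close> by (simp add: mat_unit_def)
qed (auto simp: mat_unit_def)

definition E_prod :: "nat \<Rightarrow> nat \<Rightarrow> nat \<Rightarrow> ugl_prod" where
  "E_prod m i j = inc_prod m (mat_unit m i j)"

lemma inc_prod_minus:
  assumes "A \<in> gl m" "B \<in> gl m"
  shows "inc_prod m (A - B) = inc_prod m A - inc_prod m B"
proof -
  have "A - B = A + (-1) \<cdot>\<^sub>m B" using assms by (intro eq_matI) (auto simp: gl_def)
  moreover have "(-1) \<cdot>\<^sub>m B \<in> gl m" using assms by (simp add: gl_def)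
  moreover have "scal_prod (-1) = -1"
    using scal_prod_hom(2)[of 1 "-1"] by (simp add: scal_prod_0 scal_prod_hom(1) eq_neg_iff_add_eq_0 add.commute)
  ultimately show ?thesis
    using assms by (simp add: inc_prod_hom(1) inc_prod_hom(2)[OF assms(2,2)])
qed

lemma gl_elements_E_prod: "gl_elements m (E_prod m) scal_prod"
proof
  fix i j k l assume "i \<in> {1..m}" "j \<in> {1..m}" "k \<in> {1..m}" "l \<in> {1..m}"
  have z: "0\<^sub>m m m \<in> gl m" by (simp add: gl_def)
  have "E_prod m i j * E_prod m k l - E_prod m k l * E_prod m i j
      = inc_prod m (lie_bracket (mat_unit m i j) (mat_unit m k l))"
    unfolding E_prod_def by (rule inc_prod_hom(3)[OF mat_unit_gl mat_unit_gl])
  also have "lie_bracket (mat_unit m i j) (mat_unit m k l)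
      = (if j = k then mat_unit m i l else 0\<^sub>m m m) - (if l = i then mat_unit m k j else 0\<^sub>m m m)"
    unfolding lie_bracket_def using mat_unit_mult \<open>i \<in> _\<close> \<open>j \<in> _\<close> \<open>k \<in> _\<close> \<open>l \<in> _\<close> by simp
  also have "inc_prod m \<dots> = (if j = k then E_prod m i l else 0) - (if l = i then E_prod m k j else 0)"
    by (subst inc_prod_minus) (auto simp: mat_unit_gl z E_prod_def inc_prod_zero)
  finally show "E_prod m i j * E_prod m k l = E_prod m k l * E_prod m i j
      + (if j = k then E_prod m i l else 0) - (if l = i then E_prod m k j else 0)"
    by (simp add: algebra_simps)
next
  show "scal_prod c * x = x * scal_prod c" for c x by (rule scal_prod_hom(4))
qed (simp_all add: scal_prod_hom(1-3))

lemma inc_prod_eval_mat: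
  assumes "A \<in> gl m"
  shows "inc_prod m A = gl_elements.eval_mat m (E_prod m) scal_prod A"
proof -
  interpret gl_elements m "E_prod m" scal_prod by (rule gl_elements_E_prod)
  \<comment> \<open>\<open>M S\<close> keeps the entries of \<open>A\<close> at the positions in
    \<open>S\<close>; letting \<open>S\<close> grow one position at a time expands \<open>A\<close>
    into matrix units.\<close>
  define M where "M S = mat m m (\<lambda>(a, b). if (a + 1, b + 1) \<in> S then A $$ (a, b) else 0)" for S
  have MG: "M S \<in> gl m" for S by (simp add: M_def gl_def)
  have "inc_prod m (M S) = (\<Sum>(i, j)\<in>S. scal_prod (A $$ (i - 1, j - 1)) * E_prod m i j)"
    if "S \<subseteq> {1..m} \<times> {1..m}" for S
  proof -
    have "finite S" using that by (rule finite_subset) simp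
    then show ?thesis using that
    proof (induction S rule: finite_induct)
      case empty
      have "M {} = 0\<^sub>m m m" by (intro eq_matI) (auto simp: M_def)
      then show ?case by (simp add: inc_prod_zero)
    next
      case (insert x S)
      obtain i j where x: "x = (i, j)" by fastforce
      have "M (insert x S) = M S + A $$ (i - 1, j - 1) \<cdot>\<^sub>m mat_unit m i j"
        using insert.hyps(2) x by (intro eq_matI) (auto simp: M_def mat_unit_def)
      moreover have "A $$ (i - 1, j - 1) \<cdot>\<^sub>m mat_unit m i j \<in> gl m"
        using mat_unit_gl[of m i j] by (simp add: gl_def)
      ultimately have "inc_prod m (M (insert x S)) = inc_prod m (M S) + scal_prod (A $$ (i - 1, j - 1)) * E_prod m i j"
        using inc_prod_hom(1)[OF MG] inc_prod_hom(2)[OF mat_unit_gl mat_unit_gl] by (simp add: E_prod_def)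
      then show ?case using insert x by simp
    qed
  qed
  moreover have "M ({1..m} \<times> {1..m}) = A" using assms by (intro eq_matI) (auto simp: M_def gl_def)
  ultimately show ?thesis
    by (force simp: eval_mat_def sum.cartesian_product)
qed

lemma ugl_comp_sum: "finite S \<Longrightarrow> ugl_comp m (sum f S) = (\<Oplus>\<^bsub>Ugl m\<^esub>x\<in>S. ugl_comp m (f x))"
proof -
  interpret R: ring "Ugl m" by (rule ring_Ugl)
  show ?thesis if "finite S"
    using that by (induction S rule: finite_induct) (simp_all add: ugl_comp_simps R.finsum_insert)
qed

lemma ugl_comp_prod_list: "ugl_comp m (prod_list xs) = Ugl_prod_list m (map (ugl_comp m) xs)"
  by (induction xs) (simp_all add: ugl_comp_simps Ugl_prod_list_def)

lemma ugl_comp_power: "ugl_comp m (f ^ n) = ugl_comp m f [^]\<^bsub>Ugl m\<^esub> n"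
proof -
  interpret R: ring "Ugl m" by (rule ring_Ugl)
  show ?thesis
    by (induction n) (simp_all add: ugl_comp_simps power_Suc2 del: power_Suc)
qed

text \<open>Both sides respect sums, products and scalars and agree on generators. As evaluations
  lie in \<open>gen\<close>, every element of \<open>Ugl m\<close> is the component of an element of
  \<open>gen\<close>, which makes the weight argument available for \<open>Ugl m\<close>.\<close>

lemma ugl_comp_eval_free:
  assumes "p \<in> carrier (free_algebra (gl m))"
  shows "ugl_comp m (gl_elements.eval_free m (E_prod m) scal_prod p) = Ugl_proj m p"
proof -
  interpret gl_elements m "E_prod m" scal_prod by (rule gl_elements_E_prod)
  have hom: "Ugl_proj m (p * q) = Ugl_proj m p \<otimes>\<^bsub>Ugl m\<^esub> Ugl_proj m q"
    if "p \<in> carrier (free_algebra (gl m))" "q \<in> carrier (free_algebra (gl m))" for p q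
    using Ugl_proj_hom(3) that .
  let ?F = "free_algebra (gl m)"
  have word: "Poly_Mapping.single (Free_Monoid xs) 1 \<in> carrier ?F \<and>
      ugl_comp m (eval_word (Free_Monoid xs)) = Ugl_proj m (Poly_Mapping.single (Free_Monoid xs) 1)"
    if "set xs \<subseteq> gl m" for xs
    using that
  proof (induction xs)
    case Nil
    have "Poly_Mapping.single (Free_Monoid []) 1 = (1 :: complex mat free_alg)"
      by (simp add: zero_free_monoid_def flip: single_one)
    then show ?case
      by (simp add: eval_word_def ugl_comp_simps free_algebra_closed(5) Ugl_proj_1)
  next
    case (Cons A xs)
    have s: "Poly_Mapping.single (Free_Monoid (A # xs)) 1
        = free_gen A * Poly_Mapping.single (Free_Monoid xs) (1 :: complex)"
      by (simp add: free_gen_def mult_single plus_free_monoid_def)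
    have A: "free_gen A \<in> carrier ?F" using Cons.prems by (simp add: free_algebra_closed(6))
    have "ugl_comp m (eval_mat A) = ugl_inc m A"
      using inc_prod_eval_mat[of A m] ugl_comp_inc_prod[of A m] Cons.prems by simp
    then show ?case
      using Cons A free_algebra_closed(2)[OF A] unfolding s
      by (simp add: hom eval_word_def ugl_comp_simps ugl_inc_proj)
  qed
  have one: "Poly_Mapping.single w c \<in> carrier ?F \<and>
      ugl_comp m (scal_prod c * eval_word w) = Ugl_proj m (Poly_Mapping.single w c)"
    if "set (letters w) \<subseteq> gl m" for w c
  proof -
    have "Poly_Mapping.single w c = free_scal c * Poly_Mapping.single (Free_Monoid (letters w)) 1"
      by (simp add: free_scal_def mult_single)
    moreover have "Poly_Mapping.single w 1 \<in> carrier ?F"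
      "ugl_comp m (eval_word w) = Ugl_proj m (Poly_Mapping.single w 1)"
      using word[OF that] by simp_all
    moreover from this have "free_scal c * Poly_Mapping.single w 1 \<in> carrier ?F"
      by (intro free_algebra_closed(2,7))
    ultimately show ?thesis
      by (simp add: hom free_algebra_closed(7) ugl_comp_simps ugl_scal_proj)
  qed
  have "(\<Sum>w\<in>S. Poly_Mapping.single w (c w)) \<in> carrier ?F \<and>
    ugl_comp m (\<Sum>w\<in>S. scal_prod (c w) * eval_word w) = Ugl_proj m (\<Sum>w\<in>S. Poly_Mapping.single w (c w))"
    if "finite S" "\<forall>w\<in>S. set (letters w) \<subseteq> gl m" for S and c :: "complex mat free_monoid \<Rightarrow> complex"
    using that
  proof (induction S rule: finite_induct)
    case empty
    then show ?case
      by (simp add: ugl_comp_simps free_algebra_closed(4) Ugl_proj_0)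
  next
    case (insert w S)
    then show ?case
      using one[of w "c w"] free_algebra_closed(1) by (auto simp: ugl_comp_simps Ugl_proj_hom(1))
  qed
  from this[of "Poly_Mapping.keys p" "Poly_Mapping.lookup p"]
  show ?thesis
    using assms unfolding eval_free_def poly_mapping_sum_single[of p, symmetric]
    by (simp add: free_algebra_simps(1))
qed

lemma ugl_comp_gen:
  assumes "u \<in> carrier (Ugl m)"
  obtains f where "f \<in> gl_elements.gen m (E_prod m) scal_prod" "ugl_comp m f = u"
proof -
  obtain p where p: "p \<in> carrier (free_algebra (gl m))" "u = Ugl_proj m p"
    using assms by (rule Ugl_carrierE)
  show ?thesis
  proof (rule that)
    show "gl_elements.eval_free m (E_prod m) scal_prod p \<in> gl_elements.gen m (E_prod m) scal_prod"
      by (rule gl_elements.eval_free_gen_mem[OF gl_elements_E_prod])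
    show "ugl_comp m (gl_elements.eval_free m (E_prod m) scal_prod p) = u"
      using ugl_comp_eval_free p by simp
  qed
qed


section \<open>Transfer to the elements of \<open>Ugl m\<close>\<close>

text \<open>\<open>T\<close> is made from matrix units and integers by ring operations alone. This
  carries Theta from \<open>Ugl m\<close> to the operators of the model, where its value on the
  vacuum is known.\<close>

lemma T_ring_hom:
  assumes E: "gl_elements m E sc" and E': "gl_elements m E' sc'"
    and add: "\<And>x y. h (x + y) = h x + h y" and mult: "\<And>x y. h (x * y) = h x * h y"
    and one: "h 1 = 1"
    and h_E: "\<And>i j. i \<in> {1..m} \<Longrightarrow> j \<in> {1..m} \<Longrightarrow> h (E i j) = E' i j"
    and "x \<in> {1..m}"
  shows "h (gl_elements.T E x) = gl_elements.T E' x"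
  using assms(7)
proof (induction x rule: less_induct)
  case (less x)
  interpret A: gl_elements m E sc by (rule E)
  interpret B: gl_elements m E' sc' by (rule E')
  have zero: "h 0 = 0" using add[of 0 0] by simp
  have diff: "h (u - v) = h u - h v" for u v using add[of "u - v" v] by (simp add: eq_diff_eq)
  have of_nat: "h (of_nat n) = of_nat n" for n by (induction n) (simp_all add: zero add one)
  have sum: "h (sum f S) = (\<Sum>x\<in>S. h (f x))" for f and S :: "nat set"
    by (induction S rule: infinite_finite_induct) (simp_all add: zero add)
  have prod: "h (prod_list xs) = prod_list (map h xs)" for xs
    by (induction xs) (simp_all add: one mult)
  have a: "h (A.a_elt z) = B.a_elt z" if "z \<in> {1..m}" for z
  proof -
    have "1 \<in> {1..m}" using that by auto
    moreover have "h 2 = 2" using of_nat[of 2] by simp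
    ultimately show ?thesis
      using that by (simp add: A.a_elt_def B.a_elt_def add diff of_nat h_E)
  qed
  have A: "h (A.A_elt y x) = B.A_elt y x" for y
    using less.prems unfolding A.A_elt_def B.A_elt_def prod map_map
    by (intro arg_cong[where f = prod_list] map_cong refl) (auto simp: a)
  show ?case
  proof (cases "x = 1")
    case True
    then show ?thesis using A.T_1 B.T_1 one by simp
  next
    case False
    then have x: "1 < x" "x \<le> m" using less.prems by auto
    have "h (E x y * A.T y * A.A_elt y x) = E' x y * B.T y * B.A_elt y x" if "y \<in> {1..<x}" for y
      using that x less.IH[of y] by (simp add: mult A h_E)
    then show ?thesis
      unfolding A.T_rec[OF x(1)] B.T_rec[OF x(1)] sum by (intro sum.cong) auto
  qed
qed

lemma n_plus_gl: "A \<in> n_plus m \<Longrightarrow> A \<in> gl m"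
  and cartan_gl: "A \<in> cartan m \<Longrightarrow> A \<in> gl m"
  by (auto simp: n_plus_def cartan_def)

context gl_elements
begin

lemma eval_mat_n_plus:
  assumes "A \<in> n_plus m"
  shows "eval_mat A = (\<Sum>i\<in>{1..m}. \<Sum>j\<in>{i<..m}. sc (A $$ (i - 1, j - 1)) * E i j)"
proof -
  have z: "A $$ (i - 1, j - 1) = 0" if "i \<in> {1..m}" "j \<in> {1..m}" "j \<le> i" for i j
  proof -
    have "i - 1 < m" "j - 1 < m" "j - 1 \<le> i - 1" using that by auto
    then show ?thesis using assms by (auto simp: n_plus_def)
  qed
  show ?thesis unfolding eval_mat_def
  proof (rule sum.cong[OF refl], rule sum.mono_neutral_right)
    fix i assume i: "i \<in> {1..m}"
    show "\<forall>j\<in>{1..m} - {i<..m}. sc (A $$ (i - 1, j - 1)) * E i j = 0"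
      using z[OF i] by (auto simp: sc_0)
    show "{i<..m} \<subseteq> {1..m}" using i by auto
  qed simp
qed

lemma eval_mat_cartan:
  assumes "A \<in> cartan m"
  shows "eval_mat A = (\<Sum>i\<in>{1..m}. sc (A $$ (i - 1, i - 1)) * E i i)"
proof -
  have z: "A $$ (i - 1, j - 1) = 0" if "i \<in> {1..m}" "j \<in> {1..m}" "i \<noteq> j" for i j
  proof -
    have "i - 1 < m" "j - 1 < m" "i - 1 \<noteq> j - 1" using that by auto
    then show ?thesis using assms by (auto simp: cartan_def gl_def diagonal_mat_def)
  qed
  have "eval_mat A = (\<Sum>i\<in>{1..m}. \<Sum>j\<in>{1..m}. if i = j then sc (A $$ (i - 1, i - 1)) * E i i else 0)"
    unfolding eval_mat_def by (intro sum.cong refl) (auto simp: z[simplified] sc_0)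
  then show ?thesis by simp
qed

lemma eval_mat_n_plus_mem:
  assumes "A \<in> n_plus m" "left_ideal_set L" "\<And>i j. \<lbrakk>1 \<le> i; i < j; j \<le> m\<rbrakk> \<Longrightarrow> E i j \<in> L"
  shows "eval_mat A \<in> L"
  unfolding eval_mat_n_plus[OF assms(1)]
  by (intro left_ideal_set_sum[OF assms(2)] left_ideal_setD(3)[OF assms(2)] assms(3)) auto

lemma eval_mat_cartan_T:
  assumes "h \<in> cartan m" "1 \<le> m"
  shows "eval_mat h * T m = T m * eval_mat h + sc (h $$ (m - 1, m - 1) - h $$ (0, 0)) * T m"
proof -
  let ?h = "\<lambda>i. sc (h $$ (i - 1, i - 1))"
  have m: "m \<in> {1..m}" "1 \<in> {1..m}" using assms(2) by auto
  have "?h i * E i i * T m = T m * (?h i * E i i) + ((if i = m then ?h m * T m else 0)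
      - (if i = 1 then ?h 1 * T m else 0))" if "i \<in> {1..m}" for i
  proof -
    have "?h i * E i i * T m = ?h i * (T m * E i i) + ((if i = m then ?h m * T m else 0)
      - (if i = 1 then ?h 1 * T m else 0))"
      unfolding mult.assoc E_diag_T[OF that m(1)] by (simp add: distrib_left right_diff_distrib)
    also have "?h i * (T m * E i i) = T m * (?h i * E i i)"
      by (simp only: mult.assoc[symmetric] sc_central[of _ "T m"])
    finally show ?thesis .
  qed
  then have "eval_mat h * T m = (\<Sum>i\<in>{1..m}. T m * (?h i * E i i) + ((if i = m then ?h m * T m else 0)
      - (if i = 1 then ?h 1 * T m else 0)))"
    unfolding eval_mat_cartan[OF assms(1)] sum_distrib_right by (intro sum.cong refl)
  also have "\<dots> = T m * eval_mat h + (?h m * T m - ?h 1 * T m)"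
    using m unfolding eval_mat_cartan[OF assms(1)]
    by (simp add: sum.distrib sum_subtractf sum_distrib_left)
  finally show ?thesis by (simp add: sc_diff left_diff_distrib)
qed

end

section \<open>Weights, rho, and the identification of Theta with \<open>T m\<close>\<close>

lemma root_wt_carrier: "root_wt m \<alpha> \<in> carrier_vec m"
  by (simp add: root_wt_def eps_def)

lemma root_wt_index:
  assumes "a < m"
  shows "root_wt m (i, j) $ a = (if a = i - 1 then 1 else 0) - (if a = j - 1 then 1 else 0)"
  using assms by (simp add: root_wt_def eps_def unit_vec_def)

lemma root_wt_index_fst_snd:
  assumes "a < m"
  shows "root_wt m \<alpha> $ a = (if a = fst \<alpha> - 1 then 1 else 0) - (if a = snd \<alpha> - 1 then 1 else 0)"
  using root_wt_index[OF assms, of "fst \<alpha>" "snd \<alpha>"] by simp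

lemma scalar_prod_root_wt:
  assumes "v \<in> carrier_vec m" "i \<in> {1..m}" "j \<in> {1..m}"
  shows "v \<bullet> root_wt m (i, j) = v $ (i - 1) - v $ (j - 1)"
proof -
  have "i - 1 < m" "j - 1 < m" using assms by auto
  have "v \<bullet> root_wt m (i, j) = (\<Sum>a\<in>{0..<m}. v $ a * root_wt m (i, j) $ a)"
    using root_wt_carrier[of m "(i, j)"] by (simp add: scalar_prod_def)
  also have "\<dots> = (\<Sum>a\<in>{0..<m}. (if a = i - 1 then v $ (i - 1) else 0) - (if a = j - 1 then v $ (j - 1) else 0))"
    by (intro sum.cong refl) (auto simp: root_wt_index)
  also have "\<dots> = v $ (i - 1) - v $ (j - 1)"
    using \<open>i - 1 < m\<close> \<open>j - 1 < m\<close> by (simp add: sum_subtractf)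
  finally show ?thesis .
qed

lemma pos_roots_Sigma: "pos_roots m = (SIGMA i:{1..m}. {i<..m})"
  by (auto simp: pos_roots_def)

lemma finite_pos_roots: "finite (pos_roots m)"
  by (simp add: pos_roots_Sigma)

lemma rho_carrier: "rho m \<in> carrier_vec m"
proof -
  have "root_wt m \<in> pos_roots m \<rightarrow> carrier_vec m" using root_wt_carrier by blast
  then show ?thesis unfolding rho_def by (intro smult_carrier_vec[THEN iffD2] finsum_vec_closed)
qed

lemma rho_index:
  assumes "a < m"
  shows "rho m $ a = (of_nat m - 1) / 2 - of_nat a"
proof -
  have "rho m $ a = 1 / 2 * (\<Sum>\<alpha>\<in>pos_roots m. root_wt m \<alpha> $ a)"
  proof -
    have *: "root_wt m \<in> pos_roots m \<rightarrow> carrier_vec m" using root_wt_carrier by blast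
    show ?thesis
      using assms carrier_vecD[OF finsum_vec_closed[OF *]]
      by (simp add: rho_def index_finsum_vec[OF finite_pos_roots _ *])
  qed
  also have "(\<Sum>\<alpha>\<in>pos_roots m. root_wt m \<alpha> $ a)
     = (\<Sum>i\<in>{1..m}. \<Sum>j\<in>{i<..m}. (if a = i - 1 then 1 else 0) - (if a = j - 1 then 1 else 0))"
    unfolding pos_roots_Sigma
    by (subst sum.Sigma) (simp_all add: root_wt_index_fst_snd[OF assms] split_def)
  \<comment> \<open>Coordinate \<open>a\<close> belongs to eps_{a+1}, which occurs with sign + in m
    - a - 1 positive roots and with sign - in \<open>a\<close> of them.\<close>
  also have "\<dots> = (\<Sum>i\<in>{1..m}. \<Sum>j\<in>{i<..m}. if i = Suc a then 1 else 0)
      - (\<Sum>i\<in>{1..m}. \<Sum>j\<in>{i<..m}. if j = Suc a then 1 else 0)"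
    unfolding sum_subtractf[symmetric] by (intro sum.cong refl) auto
  also have "(\<Sum>i\<in>{1..m}. \<Sum>j\<in>{i<..m}. if i = Suc a then 1 else 0 :: complex)
      = (\<Sum>i\<in>{1..m}. if i = Suc a then of_nat (m - Suc a) else 0)"
    by (intro sum.cong) auto
  also have "\<dots> = of_nat m - of_nat (Suc a)" using assms by (simp add: of_nat_diff)
  also have "(\<Sum>i\<in>{1..m}. \<Sum>j\<in>{i<..m}. if j = Suc a then 1 else 0 :: complex)
      = (\<Sum>i\<in>{1..m}. if i \<in> {1..a} then 1 else 0)"
    using assms by (intro sum.cong) auto
  also have "\<dots> = (\<Sum>i\<in>{1..a}. 1)"
    using assms by (intro sum.mono_neutral_cong_right) auto
  finally show ?thesis by (simp add: field_simps)
qed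

lemma rho_root:
  assumes "j \<in> {1..m}"
  shows "rho m \<bullet> root_wt m (1, j) = of_nat j - 1"
proof -
  have *: "j - 1 < m" "0 < m" "1 \<in> {1..m}" using assms by auto
  have "rho m \<bullet> root_wt m (1, j) = rho m $ 0 - rho m $ (j - 1)"
    using scalar_prod_root_wt[OF rho_carrier *(3) assms] by simp
  also have "\<dots> = of_nat (j - 1)"
    unfolding rho_index[OF *(1)] rho_index[OF *(2)] by simp
  finally show ?thesis using assms by (simp add: of_nat_diff)
qed

lemma weight_eval_mat_unit:
  assumes "i \<in> {1..m}" "lam \<in> carrier_vec m"
  shows "weight_eval lam (mat_unit m i i) = lam $ (i - 1)"
proof -
  have "i - 1 < m" using assms by auto
  have "weight_eval lam (mat_unit m i i) = (\<Sum>k<m. if k = i - 1 then lam $ (i - 1) else 0)"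
    unfolding weight_eval_def using assms by (intro sum.cong) (auto simp: mat_unit_def)
  then show ?thesis using \<open>i - 1 < m\<close> by simp
qed

lemma mat_unit_n_plus: "i < j \<Longrightarrow> mat_unit m i j \<in> n_plus m"
  by (auto simp: mat_unit_def n_plus_def gl_def)

lemma mat_unit_cartan: "mat_unit m i i \<in> cartan m"
  by (auto simp: mat_unit_def cartan_def gl_def diagonal_mat_def)

lemma h_elt_root:
  assumes "i \<in> {1..m}" "j \<in> {1..m}"
  shows "h_elt (root_wt m (i, j)) = mat_unit m i i - mat_unit m j j"
proof (rule eq_matI)
  fix a b assume "a < dim_row (mat_unit m i i - mat_unit m j j)" "b < dim_col (mat_unit m i i - mat_unit m j j)"
  then have "a < m" "b < m" by (auto simp: mat_unit_def)
  moreover have "dim_vec (root_wt m (i, j)) = m" using root_wt_carrier by (rule carrier_vecD)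
  ultimately show "h_elt (root_wt m (i, j)) $$ (a, b) = (mat_unit m i i - mat_unit m j j) $$ (a, b)"
    using assms by (cases "a = b") (auto simp: h_elt_def root_wt_index mat_unit_def)
qed (auto simp: h_elt_def root_wt_def eps_def mat_unit_def)

lemma scal_prod_of_nat: "scal_prod (of_nat n) = of_nat n"
  using gl_elements.sc_of_nat[OF gl_elements_E_prod] .

lemma hk_eq:
  assumes "1 \<le> k" "k < m"
  shows "hk m k = ugl_comp m (gl_elements.a_elt (E_prod m) (Suc k))"
proof -
  interpret gl_elements m "E_prod m" scal_prod by (rule gl_elements_E_prod)
  have k: "Suc k \<in> {1..m}" "1 \<in> {1..m}" using assms by auto
  have gl: "mat_unit m 1 1 - mat_unit m (Suc k) (Suc k) \<in> gl m"
    using mat_unit_gl unfolding gl_def by (rule minus_carrier_mat)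
  have e1: "ugl_comp m (E_prod m 1 1 - E_prod m (Suc k) (Suc k)) = ugl_inc m (h_elt (root_wt m (1, k + 1)))"
    unfolding Suc_eq_plus1[symmetric] h_elt_root[OF k(2,1)] ugl_comp_inc_prod[OF gl, symmetric]
      inc_prod_minus[OF mat_unit_gl mat_unit_gl] E_prod_def ..
  have e2: "scal_prod (rho m \<bullet> root_wt m (1, k + 1) - 1) = of_nat (Suc k) - 2"
  proof -
    have "rho m \<bullet> root_wt m (1, k + 1) - 1 = of_nat (Suc k) - of_nat 2"
      using rho_root[OF k(1)] by simp
    then have "scal_prod (rho m \<bullet> root_wt m (1, k + 1) - 1) = of_nat (Suc k) - of_nat 2"
      by (simp only: sc_diff scal_prod_of_nat)
    then show ?thesis by (simp only: of_nat_numeral)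
  qed
  show ?thesis
    unfolding hk_def e1[symmetric] ugl_comp_scal[symmetric] e2 ugl_comp_ring_simps(3)[symmetric] a_elt_def
    by (simp only: add_diff_eq)
qed

lemma sorted_list_of_set_pred:
  fixes S :: "nat set"
  assumes "finite S" "0 \<notin> S"
  shows "sorted_list_of_set ((\<lambda>x. x - 1) ` S) = map (\<lambda>x. x - 1) (sorted_list_of_set S)"
proof (rule sorted_distinct_set_unique)
  have "inj_on (\<lambda>x. x - 1) S" using assms(2) by (auto simp: inj_on_def neq0_conv) (metis Suc_pred neq0_conv)
  then show "distinct (map (\<lambda>x. x - 1) (sorted_list_of_set S))"
    using assms by (simp add: distinct_map)
  have "sorted_wrt (\<le>) (sorted_list_of_set S)" by simp
  then show "sorted (map (\<lambda>x. x - 1) (sorted_list_of_set S))"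
    unfolding sorted_map by (rule sorted_wrt_mono_rel[rotated]) (simp add: diff_le_mono)
qed (use assms in auto)

lemma H_elt_eq:
  assumes "J \<in> index_sets m"
  shows "H_elt m J = ugl_comp m (gl_elements.gap_prod (E_prod m) m J)"
proof -
  interpret gl_elements m "E_prod m" scal_prod by (rule gl_elements_E_prod)
  have "r_set m J = (\<lambda>x. x - 1) ` ({1..m} - J)" by (auto simp: r_set_def)
  then have "sorted_list_of_set (r_set m J) = map (\<lambda>x. x - 1) (sorted_list_of_set ({1..m} - J))"
    by (simp only:) (rule sorted_list_of_set_pred, auto)
  moreover have "hk m (x - 1) = ugl_comp m (a_elt x)" if "x \<in> {1..m} - J" for x
  proof -
    have "x \<noteq> 1" using that assms by (auto simp: index_sets_def)
    then have "1 \<le> x - 1" "x - 1 < m" "Suc (x - 1) = x" using that by auto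
    then show ?thesis using hk_eq[of "x - 1" m] by simp
  qed
  then have "map (hk m) (map (\<lambda>x. x - 1) (sorted_list_of_set ({1..m} - J)))
      = map (ugl_comp m) (map a_elt (sorted_list_of_set ({1..m} - J)))"
    by simp
  ultimately show ?thesis
    by (simp only: H_elt_def gap_prod_def ugl_comp_prod_list)
qed

lemma f_elt_eq: "f_elt m J = ugl_comp m (gl_elements.path_prod (E_prod m) J)"
proof -
  interpret gl_elements m "E_prod m" scal_prod by (rule gl_elements_E_prod)
  show ?thesis
    by (simp add: f_elt_def path_prod_def ugl_comp_prod_list chain_pairs_def Let_def E_prod_def o_def
        split_def ugl_comp_inc_prod mat_unit_gl)
qed

lemma Theta_eq: "Theta m = ugl_comp m (gl_elements.T (E_prod m) m)"
proof -
  interpret gl_elements m "E_prod m" scal_prod by (rule gl_elements_E_prod)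
  interpret R: ring "Ugl m" by (rule ring_Ugl)
  show ?thesis
    unfolding Theta_def T_def ugl_comp_sum[OF finite_index_sets]
    by (intro R.finsum_cong') (auto simp: f_elt_eq H_elt_eq ugl_comp_simps)
qed

section \<open>The Verma ideal as a left ideal of the product ring\<close>

lemma left_ideal_pullback:
  assumes "S \<subseteq> carrier (Ugl m)"
  shows "left_ideal_set {f. ugl_comp m f \<in> left_ideal m S}"
proof -
  interpret J: additive_subgroup "left_ideal m S" "Ugl m" by (rule left_ideal_props(1)[OF assms])
  show ?thesis
    using left_ideal_props(3)[OF assms ugl_comp_closed]
    by (auto simp: left_ideal_set_def ugl_comp_simps)
qed

definition verma_gens :: "nat \<Rightarrow> complex vec \<Rightarrow> complex mat free_alg set set" where
  "verma_gens m lam = ugl_inc m ` n_plus m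
     \<union> {ugl_inc m h \<ominus>\<^bsub>Ugl m\<^esub> ugl_scal m (weight_eval lam h) | h. h \<in> cartan m}"

lemma verma_ideal_gens: "verma_ideal m lam = left_ideal m (verma_gens m lam)"
  by (simp add: verma_ideal_def verma_gens_def)

lemma verma_gens_carrier: "verma_gens m lam \<subseteq> carrier (Ugl m)"
proof -
  interpret R: ring "Ugl m" by (rule ring_Ugl)
  show ?thesis
    unfolding verma_gens_def using ugl_inc_carrier n_plus_gl cartan_gl ugl_scal_carrier by auto
qed

definition verma_pullback :: "nat \<Rightarrow> complex vec \<Rightarrow> ugl_prod set" where
  "verma_pullback m lam = {f. ugl_comp m f \<in> verma_ideal m lam}"

lemma left_ideal_verma_pullback: "left_ideal_set (verma_pullback m lam)"
  unfolding verma_pullback_def verma_ideal_gens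
  by (rule left_ideal_pullback[OF verma_gens_carrier])

lemma verma_pullback_n_plus: "A \<in> n_plus m \<Longrightarrow> inc_prod m A \<in> verma_pullback m lam"
  using left_ideal_props(2)[OF verma_gens_carrier]
  by (auto simp: verma_pullback_def verma_ideal_gens ugl_comp_inc_prod n_plus_gl verma_gens_def)

lemma verma_pullback_cartan:
  "h \<in> cartan m \<Longrightarrow> inc_prod m h - scal_prod (weight_eval lam h) \<in> verma_pullback m lam"
  using left_ideal_props(2)[OF verma_gens_carrier, of m lam]
  by (auto simp: verma_pullback_def verma_ideal_gens ugl_comp_inc_prod cartan_gl verma_gens_def
      ugl_comp_simps)

lemma verma_pullback_E:
  "i < j \<Longrightarrow> E_prod m i j \<in> verma_pullback m lam"
  "\<lbrakk>i \<in> {1..m}; lam \<in> carrier_vec m\<rbrakk> \<Longrightarrow> E_prod m i i - scal_prod (lam $ (i - 1)) \<in> verma_pullback m lam"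
  unfolding E_prod_def
  using verma_pullback_n_plus[OF mat_unit_n_plus] verma_pullback_cartan[OF mat_unit_cartan, of m i lam]
  by (auto simp: weight_eval_mat_unit)

text \<open>Applying elements of \<open>Ugl m\<close> to the vacuum kills the generators of the
  Verma ideal, hence the whole left ideal, whereas the image of \<open>T m\<close> has the value 1
  at \<open>simple_exp m\<close>.\<close>

lemma Theta_not_in_verma_ideal:
  assumes "1 \<le> m" "lam \<in> carrier_vec m"
  shows "gl_elements.T (E_prod m) m \<notin> verma_pullback m lam"
proof
  \<comment> \<open>\<open>l\<close> continues the coordinates of \<open>lam\<close> by 0 at the
    index m + 1, so that the sums of \<open>c\<close> over {i..m} telescope to the i-th
    coordinate.\<close>
  define l where "l k = (if k \<in> {1..m} then lam $ (k - 1) else 0)" for k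
  define c where "c k = l k - l (Suc k)" for k
  interpret W: gl_elements m "gl_op m c" scale_op by (rule gl_elements_gl_op)
  interpret R: ring "Ugl m" by (rule ring_Ugl)
  have sum_c: "(\<Sum>k\<in>{i..m}. c k) = lam $ (i - 1)" if "i \<in> {1..m}" for i
  proof -
    have "(\<Sum>k\<in>{i..m}. c k) = - (\<Sum>k = i..m. l (Suc k) - l k)"
      by (simp add: c_def sum_negf[symmetric])
    also have "\<dots> = l i - l (Suc m)" using that by (subst sum_Suc_diff) auto
    finally show ?thesis using that by (simp add: l_def)
  qed
  let ?\<psi> = "W.eval_Ugl"
  have kill_n_plus: "op_apply (W.eval_mat A) vacuum = (\<lambda>a. 0)" if "A \<in> n_plus m" for A
    unfolding W.eval_mat_n_plus[OF that]
    by (auto simp: op_apply_sum op_apply_simps(3,6) gl_op_vacuum intro!: ext sum.neutral)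
  have kill_cartan: "op_apply (W.eval_mat h - scale_op (weight_eval lam h)) vacuum = (\<lambda>a. 0)"
    if "h \<in> cartan m" for h
  proof
    fix a
    have "op_apply (W.eval_mat h) vacuum a = (\<Sum>i\<in>{1..m}. h $$ (i - 1, i - 1) * (lam $ (i - 1) * vacuum a))"
      unfolding W.eval_mat_cartan[OF that] op_apply_sum op_apply_simps(3,6)
      by (intro sum.cong refl) (auto simp: gl_op_vacuum sum_c[simplified])
    also have "\<dots> = (\<Sum>i\<in>{0..<m}. h $$ (i, i) * (lam $ i * vacuum a))"
      by (rule W.sum_shift)
    also have "\<dots> = weight_eval lam h * vacuum a"
      using assms(2) by (simp add: weight_eval_def sum_distrib_left atLeast0LessThan ac_simps)
    finally show "op_apply (W.eval_mat h - scale_op (weight_eval lam h)) vacuum a = 0"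
      by (simp add: op_apply_simps(2,6))
  qed
  have uminus: "?\<psi> (\<ominus>\<^bsub>Ugl m\<^esub> u) = - ?\<psi> u" if "u \<in> carrier (Ugl m)" for u
    using W.eval_Ugl_hom(2)[OF that R.a_inv_closed[OF that]] that
    by (simp add: R.r_neg W.eval_Ugl_simps eq_neg_iff_add_eq_0 add.commute)
  have gens: "op_apply (?\<psi> s) vacuum = (\<lambda>a. 0)" if s: "s \<in> verma_gens m lam" for s
  proof -
    consider (n) A where "A \<in> n_plus m" "s = ugl_inc m A"
      | (h) h where "h \<in> cartan m" "s = ugl_inc m h \<ominus>\<^bsub>Ugl m\<^esub> ugl_scal m (weight_eval lam h)"
      using s unfolding verma_gens_def by blast
    then show ?thesis
    proof cases
      case n
      then show ?thesis using kill_n_plus by (simp add: W.eval_Ugl_simps n_plus_gl)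
    next
      case h
      then have "?\<psi> s = W.eval_mat h - scale_op (weight_eval lam h)"
        by (simp add: R.minus_eq W.eval_Ugl_hom ugl_inc_carrier cartan_gl ugl_scal_carrier uminus
            W.eval_Ugl_simps)
      then show ?thesis using kill_cartan h by simp
    qed
  qed
  have G: "{u \<otimes>\<^bsub>Ugl m\<^esub> s | u s. u \<in> carrier (Ugl m) \<and> s \<in> verma_gens m lam} \<subseteq> carrier (Ugl m)"
    using verma_gens_carrier by auto
  have prod: "op_apply (?\<psi> (u \<otimes>\<^bsub>Ugl m\<^esub> s)) vacuum = (\<lambda>a. 0)"
    if "u \<in> carrier (Ugl m)" "s \<in> verma_gens m lam" for u s
    using gens[OF that(2)] that verma_gens_carrier[of m lam]
    by (simp add: W.eval_Ugl_hom subsetD op_apply_simps(3) op_apply_zero)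
  have kill: "op_apply (?\<psi> u) vacuum = (\<lambda>a. 0)" if "u \<in> verma_ideal m lam" for u
    using that unfolding verma_ideal_gens left_ideal_def
  proof (induction rule: generate.induct)
    case one
    then show ?case by (simp add: W.eval_Ugl_simps op_apply_simps)
  next
    case (incl h)
    then show ?case using prod by auto
  next
    case (inv h)
    then have h: "h \<in> carrier (Ugl m)" "op_apply (?\<psi> h) vacuum = (\<lambda>a. 0)"
      using G prod by blast+
    have "inv\<^bsub>add_monoid (Ugl m)\<^esub> h = \<ominus>\<^bsub>Ugl m\<^esub> h" by (simp add: a_inv_def)
    then show ?case
      using h op_apply_simps(2)[of 0 "?\<psi> h" vacuum] by (simp add: uminus op_apply_simps(4))
  next
    case (eng h1 h2)
    then have "h1 \<in> carrier (Ugl m)" "h2 \<in> carrier (Ugl m)"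
      using R.add.generate_in_carrier[OF G] by auto
    then show ?case using eng.IH by (simp add: W.eval_Ugl_hom op_apply_simps(1))
  qed
  have "?\<psi> (ugl_comp m (gl_elements.T (E_prod m) m)) = W.T m"
  proof (rule T_ring_hom[OF gl_elements_E_prod gl_elements_gl_op, where h = "\<lambda>f. ?\<psi> (ugl_comp m f)"])
    show "?\<psi> (ugl_comp m (E_prod m i j)) = gl_op m c i j" if "i \<in> {1..m}" "j \<in> {1..m}" for i j
      using that by (simp add: E_prod_def ugl_comp_inc_prod mat_unit_gl W.eval_Ugl_simps W.eval_mat_unit)
  qed (use assms in \<open>auto simp: ugl_comp_simps W.eval_Ugl_hom W.eval_Ugl_simps\<close>)
  moreover assume "gl_elements.T (E_prod m) m \<in> verma_pullback m lam"
  ultimately have "op_apply (W.T m) vacuum = (\<lambda>a. 0)"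
    using kill by (simp add: verma_pullback_def) metis
  then show False using T_vacuum[of m m c] assms by simp
qed


section \<open>Highest weight vectors in Verma modules\<close>

definition verma_vec :: "nat \<Rightarrow> complex vec \<Rightarrow> ugl_prod \<Rightarrow> complex mat free_alg set set" where
  "verma_vec m lam f = verma_ideal m lam +>\<^bsub>Ugl m\<^esub> ugl_comp m f"

lemma verma_vec_eq_iff: "verma_vec m lam f = verma_vec m lam g \<longleftrightarrow> f - g \<in> verma_pullback m lam"
  and verma_vec_zero_iff: "verma_vec m lam f = verma_ideal m lam \<longleftrightarrow> f \<in> verma_pullback m lam"
proof -
  interpret R: ring "Ugl m" by (rule ring_Ugl)
  let ?J = "verma_ideal m lam"
  interpret J: additive_subgroup ?J "Ugl m"
    unfolding verma_ideal_gens by (rule left_ideal_props(1)[OF verma_gens_carrier])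
  interpret J: abelian_subgroup ?J "Ugl m"
    by (rule abelian_subgroupI3[OF J.additive_subgroup_axioms R.abelian_group_axioms])
  note c = ugl_comp_closed[of m]
  have zero: "verma_vec m lam 0 = ?J"
    using J.a_rcos_const[OF J.zero_closed] by (simp add: verma_vec_def ugl_comp_simps)
  have iff: "verma_vec m lam f = verma_vec m lam g \<longleftrightarrow> f - g \<in> verma_pullback m lam" for f g
  proof
    assume "verma_vec m lam f = verma_vec m lam g"
    then have "ugl_comp m f \<in> ?J +>\<^bsub>Ugl m\<^esub> ugl_comp m g"
      using J.a_rcos_self[OF c[of f]] by (simp add: verma_vec_def)
    then obtain j where j: "j \<in> ?J" "ugl_comp m f = j \<oplus>\<^bsub>Ugl m\<^esub> ugl_comp m g"
      by (auto simp: a_r_coset_def')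
    then have "j \<in> carrier (Ugl m)" using J.a_subset by blast
    then have "ugl_comp m (f - g) = j"
      using c by (simp add: ugl_comp_simps(6) j(2) R.minus_eq R.a_assoc R.r_neg)
    then show "f - g \<in> verma_pullback m lam" using j by (simp add: verma_pullback_def)
  next
    assume "f - g \<in> verma_pullback m lam"
    then have "ugl_comp m (f - g) \<in> ?J" by (simp add: verma_pullback_def)
    moreover have "ugl_comp m f = ugl_comp m (f - g) \<oplus>\<^bsub>Ugl m\<^esub> ugl_comp m g"
      by (simp flip: ugl_comp_simps(3))
    ultimately have "ugl_comp m f \<in> ?J +>\<^bsub>Ugl m\<^esub> ugl_comp m g"
      by (auto simp: a_r_coset_def')
    then have "?J +>\<^bsub>Ugl m\<^esub> ugl_comp m g = ?J +>\<^bsub>Ugl m\<^esub> ugl_comp m f"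
      using c by (rule J.a_repr_independence')
    then show "verma_vec m lam f = verma_vec m lam g" by (simp add: verma_vec_def)
  qed
  show "verma_vec m lam f = verma_vec m lam g \<longleftrightarrow> f - g \<in> verma_pullback m lam" by (rule iff)
  show "verma_vec m lam f = verma_ideal m lam \<longleftrightarrow> f \<in> verma_pullback m lam"
    using iff[of f 0] zero by simp
qed

lemma verma_act_vec: "verma_act m lam (ugl_comp m u) (verma_vec m lam f) = verma_vec m lam (u * f)"
  unfolding verma_vec_def by (simp add: verma_act_coset ugl_comp_simps)

lemma verma_vec_in_verma: "verma_vec m lam f \<in> verma m lam"
  unfolding verma_def verma_vec_def A_RCOSETS_def' using ugl_comp_closed by blast

lemma vermaE:
  assumes "v \<in> verma m lam"
  obtains f where "f \<in> gl_elements.gen m (E_prod m) scal_prod" "v = verma_vec m lam f"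
proof -
  obtain x where x: "x \<in> carrier (Ugl m)" "v = verma_ideal m lam +>\<^bsub>Ugl m\<^esub> x"
    using assms by (auto simp: verma_def A_RCOSETS_def')
  obtain f where "f \<in> gl_elements.gen m (E_prod m) scal_prod" "ugl_comp m f = x"
    using ugl_comp_gen[OF x(1)] .
  then show ?thesis using that x by (simp add: verma_vec_def)
qed

lemma highest_weight_vector_vec_iff:
  "highest_weight_vector m lam \<mu> (verma_vec m lam f) \<longleftrightarrow>
     f \<notin> verma_pullback m lam \<and>
     (\<forall>A\<in>n_plus m. inc_prod m A * f \<in> verma_pullback m lam) \<and>
     (\<forall>h\<in>cartan m. (inc_prod m h - scal_prod (weight_eval \<mu> h)) * f \<in> verma_pullback m lam)"
proof -
  have 1: "verma_act m lam (ugl_inc m A) (verma_vec m lam f) = verma_vec m lam (inc_prod m A * f)"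
    if "A \<in> gl m" for A
    using verma_act_vec[of m lam "inc_prod m A" f] by (simp add: ugl_comp_inc_prod that)
  have 2: "verma_act m lam (ugl_scal m c) (verma_vec m lam f) = verma_vec m lam (scal_prod c * f)" for c
    using verma_act_vec[of m lam "scal_prod c" f] by (simp add: ugl_comp_scal)
  show ?thesis
    unfolding highest_weight_vector_def
    using 1 2 n_plus_gl cartan_gl verma_vec_in_verma
    by (simp add: verma_vec_eq_iff verma_vec_zero_iff left_diff_distrib)
qed

context
  fixes m :: nat
  assumes m: "2 \<le> m"
begin

interpretation gl_elements m "E_prod m" scal_prod by (rule gl_elements_E_prod)

lemma simple_root_Theta:
  assumes "left_ideal_set L" "\<And>i j. \<lbrakk>1 \<le> i; i < j; j \<le> m\<rbrakk> \<Longrightarrow> E_prod m i j \<in> L"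
    and "1 \<le> k" "k < m" "Suc k = m \<Longrightarrow> a_elt m \<in> L"
  shows "E_prod m k (Suc k) * T m \<in> L"
proof -
  have "E_prod m k (Suc k) * T m - (if Suc k = m then T k * a_elt m else 0) \<in> L"
    using simple_root_T[of m k] nil_ideal_least[OF assms(1,2)] assms(3,4) m by auto
  moreover have "(if Suc k = m then T k * a_elt m else 0) \<in> L"
    using assms(5) left_ideal_setD(1,3)[OF assms(1)] by auto
  ultimately have "E_prod m k (Suc k) * T m - (if Suc k = m then T k * a_elt m else 0)
      + (if Suc k = m then T k * a_elt m else 0) \<in> L"
    by (rule left_ideal_setD(2)[OF assms(1)])
  then show ?thesis by simp
qed

text \<open>The weight equation for \<open>v\<close>, read on a representative in
  \<open>gen\<close>, is the hypothesis of \<open>highest_weight_scalar\<close>; the scalar is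
  nonzero because \<open>v\<close> is.\<close>

lemma highest_weight_vector_scalar:
  assumes lam: "lam \<in> carrier_vec m" and v: "highest_weight_vector m lam lam v"
  obtains c f where "c \<noteq> 0" "v = verma_vec m lam f" "f - scal_prod c \<in> verma_pullback m lam"
proof -
  let ?V = "verma_pullback m lam"
  obtain f where f: "f \<in> gen" "v = verma_vec m lam f"
    using v vermaE unfolding highest_weight_vector_def by metis
  have hw: "f \<notin> ?V" "\<And>h. h \<in> cartan m \<Longrightarrow> (inc_prod m h - scal_prod (weight_eval lam h)) * f \<in> ?V"
    using v unfolding f(2) highest_weight_vector_vec_iff by auto
  have "\<exists>c. f - scal_prod c \<in> ?V"
  proof (rule highest_weight_scalar[where lam = "\<lambda>i. lam $ (i - 1)", OF left_ideal_verma_pullback])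
    show "E_prod m i j \<in> ?V" if "i < j" for i j using that by (rule verma_pullback_E)
    show "E_prod m i i - scal_prod (lam $ (i - 1)) \<in> ?V" if "i \<in> {1..m}" for i
      using that lam by (rule verma_pullback_E)
    show "(E_prod m i i - scal_prod (lam $ (i - 1))) * f \<in> ?V" if "i \<in> {1..m}" for i
      using hw(2)[OF mat_unit_cartan[of m i]] weight_eval_mat_unit[OF that lam] by (simp add: E_prod_def)
  qed (rule f)
  then obtain c where c: "f - scal_prod c \<in> ?V" by blast
  have "c \<noteq> 0" using c hw(1) by (auto simp: sc_0)
  then show ?thesis using that f(2) c by blast
qed

text \<open>Scalars are central, so \<open>g * f\<close> agrees with \<open>g\<close> up to an
  invertible scalar modulo the left ideal. Claims about Theta applied to \<open>v\<close> thus
  become claims about multiples of \<open>T m\<close>.\<close>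

lemma mult_mem_verma_pullback_iff:
  assumes "c \<noteq> 0" "f - scal_prod c \<in> verma_pullback m lam"
  shows "g * f \<in> verma_pullback m lam \<longleftrightarrow> g \<in> verma_pullback m lam"
proof -
  note V = left_ideal_setD[OF left_ideal_verma_pullback[of m lam]]
  have eq: "g * f = g * (f - scal_prod c) + scal_prod c * g"
    by (simp add: right_diff_distrib sc_central[of c g])
  show ?thesis
  proof
    assume "g \<in> verma_pullback m lam"
    then show "g * f \<in> verma_pullback m lam" unfolding eq by (intro V(2) V(3)[OF assms(2)] V(3))
  next
    assume "g * f \<in> verma_pullback m lam"
    then have "g * f - g * (f - scal_prod c) \<in> verma_pullback m lam" using V(3)[OF assms(2)] by (rule V(5))
    then have "scal_prod (inverse c) * (scal_prod c * g) \<in> verma_pullback m lam"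
      unfolding eq add_diff_cancel_left' by (rule V(3))
    also have "scal_prod (inverse c) * (scal_prod c * g) = g"
      using assms(1) by (simp add: mult.assoc[symmetric] sc_1 flip: sc_mult)
    finally show "g \<in> verma_pullback m lam" .
  qed
qed

lemma simple_root_Theta_verma:
  assumes lam: "lam \<in> carrier_vec m" and v: "highest_weight_vector m lam lam v"
    and k: "1 \<le> k" "k \<le> m - 2"
  shows "verma_act m lam (ugl_inc m (mat_unit m k (k + 1))) (verma_act m lam (Theta m) v) = verma_ideal m lam"
proof -
  obtain c f where cf: "c \<noteq> 0" "v = verma_vec m lam f" "f - scal_prod c \<in> verma_pullback m lam"
    using highest_weight_vector_scalar[OF lam v] .
  have "k < m" "Suc k \<noteq> m" using k m by auto
  then have "E_prod m k (Suc k) * T m \<in> verma_pullback m lam"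
    using k by (intro simple_root_Theta left_ideal_verma_pullback verma_pullback_E) auto
  then have "E_prod m k (Suc k) * (T m * f) \<in> verma_pullback m lam"
    using mult_mem_verma_pullback_iff[OF cf(1,3)] by (simp flip: mult.assoc)
  then show ?thesis
    unfolding Theta_eq cf(2) ugl_comp_inc_prod[OF mat_unit_gl, symmetric] verma_act_vec verma_vec_zero_iff
    by (simp add: E_prod_def)
qed

lemma weight_eval_diff_root:
  assumes "lam \<in> carrier_vec m"
  shows "weight_eval (lam - root_wt m (1, m)) h = weight_eval lam h - h $$ (0, 0) + h $$ (m - 1, m - 1)"
proof -
  have dim: "dim_vec lam = m" "dim_vec (root_wt m (1, m)) = m"
    using assms root_wt_carrier by (auto intro: carrier_vecD)
  have "weight_eval (lam - root_wt m (1, m)) h = (\<Sum>k<m. lam $ k * h $$ (k, k)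
      - (if k = 0 then h $$ (0, 0) else 0) + (if k = m - 1 then h $$ (m - 1, m - 1) else 0))"
    unfolding weight_eval_def using dim m
    by (intro sum.cong) (auto simp: root_wt_index left_diff_distrib)
  then show ?thesis using m dim
    by (simp add: sum.distrib sum_subtractf weight_eval_def)
qed

lemma Theta_highest_weight_vector:
  assumes lam: "lam \<in> carrier_vec m" and v: "highest_weight_vector m lam lam v"
    and eta: "(lam + rho m) \<bullet> root_wt m (1, m) = 1"
  shows "highest_weight_vector m lam (lam - root_wt m (1, m)) (verma_act m lam (Theta m) v)"
proof -
  let ?V = "verma_pullback m lam"
  note V = left_ideal_setD[OF left_ideal_verma_pullback[of m lam]]
  obtain c f where cf: "c \<noteq> 0" "v = verma_vec m lam f" "f - scal_prod c \<in> ?V"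
    using highest_weight_vector_scalar[OF lam v] .
  have idx: "m \<in> {1..m}" "1 \<in> {1..m}" using m by auto
  have "lam \<bullet> root_wt m (1, m) + rho m \<bullet> root_wt m (1, m) = 1"
    using eta lam rho_carrier root_wt_carrier by (simp add: add_scalar_prod_distrib[of _ m])
  then have "lam $ 0 - lam $ (m - 1) + (of_nat m - 1) = 1"
    using rho_root[OF idx(1)] scalar_prod_root_wt[OF lam idx(2,1)] by simp
  \<comment> \<open>In other words, the scalar lambda_1 - lambda_m + m - 2 by which
    \<open>a_elt m\<close> acts on weight lambda is 0.\<close>
  then have "lam $ 0 - lam $ (m - 1) = of_nat 2 - of_nat m" by (simp add: algebra_simps)
  then have e: "scal_prod (lam $ 0) - scal_prod (lam $ (m - 1)) = of_nat 2 - of_nat m"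
    by (simp only: sc_diff[symmetric] scal_prod_of_nat[symmetric])
  have "(E_prod m 1 1 - scal_prod (lam $ (1 - 1))) - (E_prod m m m - scal_prod (lam $ (m - 1)))
      = E_prod m 1 1 - E_prod m m m - (scal_prod (lam $ 0) - scal_prod (lam $ (m - 1)))"
    by simp
  then have "a_elt m = (E_prod m 1 1 - scal_prod (lam $ (1 - 1))) - (E_prod m m m - scal_prod (lam $ (m - 1)))"
    unfolding e by (simp add: a_elt_def)
  then have a: "a_elt m \<in> ?V"
    using V(5) verma_pullback_E(2)[OF idx(1) lam] verma_pullback_E(2)[OF idx(2) lam] by simp
  have pos: "E_prod m i j * T m \<in> ?V" if "1 \<le> i" "i < j" "j \<le> m" for i j
  proof (rule pos_root_mult_mem[OF left_ideal_verma_pullback _ that])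
    show "E_prod m k (Suc k) * T m \<in> ?V" if "1 \<le> k" "k < m" for k
      using that a by (intro simple_root_Theta left_ideal_verma_pullback verma_pullback_E)
  qed
  have "highest_weight_vector m lam (lam - root_wt m (1, m)) (verma_vec m lam (T m * f))"
    unfolding highest_weight_vector_vec_iff mult.assoc[symmetric] mult_mem_verma_pullback_iff[OF cf(1,3)]
  proof (intro conjI ballI)
    show "T m \<notin> ?V" using Theta_not_in_verma_ideal lam m by simp
    \<comment> \<open>The elements that multiply \<open>T m\<close> into the ideal form a left
      ideal, to which the expansion of \<open>A\<close> into matrix units applies.\<close>
    have "left_ideal_set {g. g * T m \<in> ?V}"
      using V(1,2,3) by (auto simp: left_ideal_set_def distrib_right mult.assoc)
    then show "inc_prod m A * T m \<in> ?V" if "A \<in> n_plus m" for A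
      using eval_mat_n_plus_mem[OF that] pos inc_prod_eval_mat[OF n_plus_gl[OF that]] by auto
    show "(inc_prod m h - scal_prod (weight_eval (lam - root_wt m (1, m)) h)) * T m \<in> ?V" if h: "h \<in> cartan m" for h
    proof -
      \<comment> \<open>Theta has weight -eta, so moving it to the left of \<open>h\<close> shifts
        the eigenvalue back to lambda(h) and leaves a generator of the Verma ideal on the
        right.\<close>
      have "(inc_prod m h - scal_prod (weight_eval (lam - root_wt m (1, m)) h)) * T m
        = T m * (inc_prod m h - scal_prod (weight_eval lam h))"
        unfolding weight_eval_diff_root[OF lam]
        using eval_mat_cartan_T[OF h] m inc_prod_eval_mat[OF cartan_gl[OF h]]
          sc_central[of "weight_eval lam h" "T m"]
        by (simp add: left_diff_distrib right_diff_distrib sc_diff sc_add distrib_right)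
      then show ?thesis using V(3)[OF verma_pullback_cartan[OF h]] by simp
    qed
  qed
  then show ?thesis by (simp add: Theta_eq cf(2) verma_act_vec)
qed

end


section \<open>Shapovalov elements\<close>

text \<open>Along the chain every element except 1 is the larger entry of exactly one pair; hence
  the pairs determine \<open>J\<close>, and the roots attached to them telescope to eps_1 -
  eps_x.\<close>

lemma chain_pairs_index:
  assumes "J \<in> index_sets x" "1 \<le> x"
  shows "\<forall>(i, j)\<in>set (chain_pairs J). 1 \<le> j \<and> j < i \<and> i \<le> x"
    and "sorted_wrt (>) (map fst (chain_pairs J))"
    and "J = insert 1 (fst ` set (chain_pairs J))"
    and "\<And>a. \<lbrakk>a < m; x \<le> m\<rbrakk> \<Longrightarrow> (\<Sum>(i, j)\<in>set (chain_pairs J). root_wt m (j, i) $ a) = root_wt m (1, x) $ a"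
proof -
  have "(\<forall>(i, j)\<in>set (chain_pairs J). 1 \<le> j \<and> j < i \<and> i \<le> x)
    \<and> sorted_wrt (>) (map fst (chain_pairs J))
    \<and> J = insert 1 (fst ` set (chain_pairs J))
    \<and> (\<forall>a. a < m \<longrightarrow> x \<le> m \<longrightarrow> (\<Sum>(i, j)\<in>set (chain_pairs J). root_wt m (j, i) $ a) = root_wt m (1, x) $ a)"
    using assms
  proof (induction x arbitrary: J rule: less_induct)
    case (less x)
    show ?case
    proof (cases "x = 1")
      case True
      then have "J = {1}" using less.prems index_sets_1 by auto
      then show ?thesis using True by (simp add: chain_pairs_1 root_wt_index)
    next
      case False
      then have x: "1 < x" using less.prems by simp
      then obtain y K where y: "1 \<le> y" "y < x" "K \<in> index_sets y" "J = insert x K"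
        using less.prems unfolding index_sets_rec[OF x] by auto
      have cp: "chain_pairs J = (x, y) # chain_pairs K"
        using chain_pairs_insert y by simp
      note IH = less.IH[OF y(2,3,1)]
      have le: "fst p \<le> y" if "p \<in> set (chain_pairs K)" for p using IH that by auto
      then have lt: "\<forall>i\<in>set (map fst (chain_pairs K)). i < x" using y(2) by fastforce
      have "(x, y) \<notin> set (chain_pairs K)" using le y(2) by fastforce
      then have "(\<Sum>(i, j)\<in>set (chain_pairs J). root_wt m (j, i) $ a) = root_wt m (1, x) $ a"
        if "a < m" "x \<le> m" for a
        using IH that y(1,2) by (simp add: cp root_wt_index)
      moreover have "\<forall>(i, j)\<in>set (chain_pairs J). 1 \<le> j \<and> j < i \<and> i \<le> x"
        using IH y(1,2) unfolding cp by fastforce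
      moreover have "sorted_wrt (>) (map fst (chain_pairs J))"
        using IH lt by (simp add: cp)
      moreover have "J = insert 1 (fst ` set (chain_pairs J))"
      proof -
        have K: "K = insert 1 (fst ` set (chain_pairs K))" using IH by blast
        have "insert 1 (fst ` set (chain_pairs J)) = insert x (insert 1 (fst ` set (chain_pairs K)))"
          by (simp add: cp insert_commute)
        then show ?thesis by (simp only: y(4) K[symmetric])
      qed
      ultimately show ?thesis by blast
    qed
  qed
  then show "\<forall>(i, j)\<in>set (chain_pairs J). 1 \<le> j \<and> j < i \<and> i \<le> x"
    "sorted_wrt (>) (map fst (chain_pairs J))"
    "J = insert 1 (fst ` set (chain_pairs J))"
    "\<And>a. \<lbrakk>a < m; x \<le> m\<rbrakk> \<Longrightarrow> (\<Sum>(i, j)\<in>set (chain_pairs J). root_wt m (j, i) $ a) = root_wt m (1, x) $ a"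
    by blast+
qed

lemma chain_pairs_interval:
  assumes "1 \<le> x"
  shows "\<forall>(i, j)\<in>set (chain_pairs {1..x}). i = Suc j"
  using assms
proof (induction x rule: dec_induct)
  case base
  then show ?case by (simp add: chain_pairs_1)
next
  case (step x)
  have "{1..Suc x} = insert (Suc x) {1..x}" by auto
  moreover have "{1..x} \<in> index_sets x" using step by (auto simp: index_sets_def)
  ultimately have "chain_pairs {1..Suc x} = (Suc x, x) # chain_pairs {1..x}"
    using chain_pairs_insert by simp
  then show ?case using step by simp
qed

text \<open>A pair \<open>(i, j)\<close> of the chain stands for e_{i,j} with j < i, the root vector
  of -(eps_j - eps_i); this explains the swap.\<close>

definition chain_partition :: "nat set \<Rightarrow> nat \<times> nat \<Rightarrow> nat" where
  "chain_partition J \<alpha> = (if (snd \<alpha>, fst \<alpha>) \<in> set (chain_pairs J) then 1 else 0)"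

lemma partitions_index:
  assumes "\<pi> \<in> partitions m \<eta>" "a < m"
  shows "(\<Sum>\<alpha>\<in>pos_roots m. of_nat (\<pi> \<alpha>) * root_wt m \<alpha> $ a) = root_wt m \<eta> $ a"
proof -
  have *: "(\<lambda>\<alpha>. of_nat (\<pi> \<alpha>) \<cdot>\<^sub>v root_wt m \<alpha>) \<in> pos_roots m \<rightarrow> carrier_vec m"
    using root_wt_carrier by auto
  have "(\<Sum>\<alpha>\<in>pos_roots m. (of_nat (\<pi> \<alpha>) \<cdot>\<^sub>v root_wt m \<alpha>) $ a) = root_wt m \<eta> $ a"
    using assms index_finsum_vec[OF finite_pos_roots assms(2) *] by (simp add: partitions_def)
  moreover have "(of_nat (\<pi> \<alpha>) \<cdot>\<^sub>v root_wt m \<alpha>) $ a = of_nat (\<pi> \<alpha>) * root_wt m \<alpha> $ a" for \<alpha>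
    using assms(2) root_wt_carrier[of m \<alpha>] by simp
  ultimately show ?thesis by simp
qed

lemma partitionsI:
  assumes "\<And>\<alpha>. \<alpha> \<notin> pos_roots m \<Longrightarrow> \<pi> \<alpha> = 0"
    and "\<And>a. a < m \<Longrightarrow> (\<Sum>\<alpha>\<in>pos_roots m. of_nat (\<pi> \<alpha>) * root_wt m \<alpha> $ a) = root_wt m \<eta> $ a"
  shows "\<pi> \<in> partitions m \<eta>"
proof -
  let ?X = "\<lambda>\<alpha>. of_nat (\<pi> \<alpha>) \<cdot>\<^sub>v root_wt m \<alpha>"
  have *: "?X \<in> pos_roots m \<rightarrow> carrier_vec m"
    using root_wt_carrier by auto
  have "finsum_vec TYPE(complex) m ?X (pos_roots m) = root_wt m \<eta>"
  proof (rule eq_vecI)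
    show "dim_vec (finsum_vec TYPE(complex) m ?X (pos_roots m)) = dim_vec (root_wt m \<eta>)"
      using finsum_vec_closed[OF *] root_wt_carrier[of m \<eta>] by simp
    fix a assume "a < dim_vec (root_wt m \<eta>)"
    then have a: "a < m" using root_wt_carrier[of m \<eta>] by simp
    moreover have "(of_nat (\<pi> \<alpha>) \<cdot>\<^sub>v root_wt m \<alpha>) $ a = of_nat (\<pi> \<alpha>) * root_wt m \<alpha> $ a" for \<alpha>
      using a root_wt_carrier[of m \<alpha>] by simp
    ultimately show "finsum_vec TYPE(complex) m ?X (pos_roots m) $ a = root_wt m \<eta> $ a"
      using assms(2)[OF a] index_finsum_vec[OF finite_pos_roots a *] by simp
  qed
  then show ?thesis using assms(1) by (simp add: partitions_def)
qed

lemma chain_partition_mem: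
  assumes "J \<in> index_sets m" "1 \<le> m"
  shows "chain_partition J \<in> partitions m (1, m)"
proof (rule partitionsI)
  have sub: "1 \<le> j \<and> j < i \<and> i \<le> m" if "(i, j) \<in> set (chain_pairs J)" for i j
    using chain_pairs_index(1)[OF assms] that by auto
  show "chain_partition J \<alpha> = 0" if "\<alpha> \<notin> pos_roots m" for \<alpha>
    using sub that by (cases \<alpha>) (auto simp: chain_partition_def pos_roots_def)
  fix a assume "a < m"
  have "(\<Sum>\<alpha>\<in>pos_roots m. of_nat (chain_partition J \<alpha>) * root_wt m \<alpha> $ a)
      = (\<Sum>\<alpha>\<in>prod.swap ` set (chain_pairs J). root_wt m \<alpha> $ a)"
  proof (rule sum.mono_neutral_cong_right)
    show "prod.swap ` set (chain_pairs J) \<subseteq> pos_roots m"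
      using sub by (auto simp: pos_roots_def)
    show "\<forall>i\<in>pos_roots m - prod.swap ` set (chain_pairs J). of_nat (chain_partition J i) * root_wt m i $ a = 0"
      by (force simp: chain_partition_def)
    show "of_nat (chain_partition J x) * root_wt m x $ a = root_wt m x $ a"
      if "x \<in> prod.swap ` set (chain_pairs J)" for x
      using that by (auto simp: chain_partition_def)
  qed (rule finite_pos_roots)
  also have "\<dots> = (\<Sum>(i, j)\<in>set (chain_pairs J). root_wt m (j, i) $ a)"
    by (subst sum.reindex) (auto simp: inj_on_def case_prod_beta prod.swap_def intro!: sum.cong)
  also have "\<dots> = root_wt m (1, m) $ a"
    using chain_pairs_index(4)[OF assms \<open>a < m\<close>] by simp
  finally show "(\<Sum>\<alpha>\<in>pos_roots m. of_nat (chain_partition J \<alpha>) * root_wt m \<alpha> $ a) = root_wt m (1, m) $ a" .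
qed

lemma inj_on_chain_partition:
  assumes "1 \<le> m"
  shows "inj_on chain_partition (index_sets m)"
proof (rule inj_onI)
  fix I J assume I: "I \<in> index_sets m" and J: "J \<in> index_sets m" and eq: "chain_partition I = chain_partition J"
  have "(i, j) \<in> set (chain_pairs I) \<longleftrightarrow> (i, j) \<in> set (chain_pairs J)" for i j
    using fun_cong[OF eq, of "(j, i)"] by (simp add: chain_partition_def split: if_splits)
  then have "set (chain_pairs I) = set (chain_pairs J)" by auto
  then show "I = J" using chain_pairs_index(3)[OF I assms] chain_pairs_index(3)[OF J assms] by simp
qed

text \<open>Weighting coordinate \<open>a\<close> by \<open>- a\<close> turns a positive root into
  its height. The heights of the parts add up to m - 1, which bounds every multiplicity.\<close>

lemma finite_partitions:
  assumes "1 \<le> m"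
  shows "finite (partitions m (1, m))"
proof (rule finite_subset)
  show "finite {\<pi>. \<forall>\<alpha>. (\<alpha> \<in> pos_roots m \<longrightarrow> \<pi> \<alpha> \<in> {0..m}) \<and> (\<alpha> \<notin> pos_roots m \<longrightarrow> \<pi> \<alpha> = 0)}"
    by (intro finite_set_of_finite_funs finite_pos_roots) simp
  show "partitions m (1, m) \<subseteq> {\<pi>. \<forall>\<alpha>. (\<alpha> \<in> pos_roots m \<longrightarrow> \<pi> \<alpha> \<in> {0..m}) \<and> (\<alpha> \<notin> pos_roots m \<longrightarrow> \<pi> \<alpha> = 0)}"
  proof
    fix \<pi> assume \<pi>: "\<pi> \<in> partitions m (1, m)"
    have height: "(\<Sum>a\<in>{0..<m}. - of_nat a * root_wt m \<alpha> $ a) = (of_nat (snd \<alpha> - fst \<alpha>) :: complex)"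
      if \<alpha>: "1 \<le> fst \<alpha>" "fst \<alpha> \<le> snd \<alpha>" "snd \<alpha> \<le> m" for \<alpha>
    proof -
      have lt: "fst \<alpha> - 1 < m" "snd \<alpha> - 1 < m" using \<alpha> by auto
      have "(\<Sum>a\<in>{0..<m}. - of_nat a * root_wt m \<alpha> $ a)
        = (\<Sum>a\<in>{0..<m}. (if a = snd \<alpha> - 1 then of_nat (snd \<alpha> - 1) else 0)
            - (if a = fst \<alpha> - 1 then of_nat (fst \<alpha> - 1) else 0) :: complex)"
        by (intro sum.cong refl) (auto simp: root_wt_index_fst_snd)
      also have "\<dots> = of_nat (snd \<alpha> - 1) - of_nat (fst \<alpha> - 1)"
        using lt by (simp add: sum_subtractf)
      also have "\<dots> = of_nat (snd \<alpha> - fst \<alpha>)" using \<alpha> by (simp add: of_nat_diff)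
      finally show ?thesis .
    qed
    have "(\<Sum>a\<in>{0..<m}. - of_nat a * (\<Sum>\<alpha>\<in>pos_roots m. of_nat (\<pi> \<alpha>) * root_wt m \<alpha> $ a))
      = (\<Sum>a\<in>{0..<m}. - of_nat a * root_wt m (1, m) $ a)"
      using partitions_index[OF \<pi>] by (intro sum.cong) auto
    also have "\<dots> = of_nat (m - 1)" using height[of "(1, m)"] assms by simp
    also have "(\<Sum>a\<in>{0..<m}. - of_nat a * (\<Sum>\<alpha>\<in>pos_roots m. of_nat (\<pi> \<alpha>) * root_wt m \<alpha> $ a))
      = (\<Sum>\<alpha>\<in>pos_roots m. of_nat (\<pi> \<alpha>) * (\<Sum>a\<in>{0..<m}. - of_nat a * root_wt m \<alpha> $ a))"
      unfolding sum_distrib_left by (subst sum.swap) (simp add: mult.left_commute)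
    also have "\<dots> = (\<Sum>\<alpha>\<in>pos_roots m. of_nat (\<pi> \<alpha>) * of_nat (snd \<alpha> - fst \<alpha>))"
      by (intro sum.cong refl arg_cong2[where f = "(*)"] height) (auto simp: pos_roots_def)
    also have "\<dots> = of_nat (\<Sum>\<alpha>\<in>pos_roots m. \<pi> \<alpha> * (snd \<alpha> - fst \<alpha>))" by simp
    finally have eq: "(\<Sum>\<alpha>\<in>pos_roots m. \<pi> \<alpha> * (snd \<alpha> - fst \<alpha>)) = m - 1"
      by (simp only: of_nat_eq_iff)
    have "\<pi> \<alpha> \<le> m" if \<alpha>: "\<alpha> \<in> pos_roots m" for \<alpha>
    proof -
      have "\<pi> \<alpha> * 1 \<le> \<pi> \<alpha> * (snd \<alpha> - fst \<alpha>)"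
        using \<alpha> by (intro mult_le_mono) (auto simp: pos_roots_def)
      also have "\<dots> \<le> (\<Sum>\<alpha>\<in>pos_roots m. \<pi> \<alpha> * (snd \<alpha> - fst \<alpha>))"
        using \<alpha> finite_pos_roots by (intro member_le_sum) auto
      finally show ?thesis using eq by simp
    qed
    then show "\<pi> \<in> {\<pi>. \<forall>\<alpha>. (\<alpha> \<in> pos_roots m \<longrightarrow> \<pi> \<alpha> \<in> {0..m}) \<and> (\<alpha> \<notin> pos_roots m \<longrightarrow> \<pi> \<alpha> = 0)}"
      using \<pi> by (auto simp: partitions_def)
  qed
qed

lemma prod_list_map_filter:
  fixes f :: "'b \<Rightarrow> 'a::monoid_mult"
  shows "prod_list (map (\<lambda>x. f x ^ (if P x then 1 else 0)) xs) = prod_list (map f (filter P xs))"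
  by (induction xs) auto

text \<open>The larger indices along a chain decrease strictly, so no two of its roots share a
  second component. Any order by weakly decreasing second components therefore lists them in chain
  order, however it breaks ties.\<close>

lemma filter_roots_chain_pairs:
  assumes J: "J \<in> index_sets m" "1 \<le> m"
    and rs: "root_order m rs" "sorted_wrt (\<lambda>\<alpha> \<beta>. snd \<beta> \<le> snd \<alpha>) rs"
  shows "filter (\<lambda>\<alpha>. (snd \<alpha>, fst \<alpha>) \<in> set (chain_pairs J)) rs = map prod.swap (chain_pairs J)"
    (is "?A = ?B")
proof -
  note cp = chain_pairs_index(1,2)[OF J]
  have dist: "distinct (map fst (chain_pairs J))"
  proof -
    have "sorted_wrt (<) (rev (map fst (chain_pairs J)))" using cp(2) by (simp only: sorted_wrt_rev)
    then show ?thesis by (simp only: strict_sorted_iff distinct_rev)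
  qed
  then have inj: "inj_on fst (set (chain_pairs J))" by (simp add: distinct_map)
  have set: "set ?A = set ?B"
    using rs(1) cp(1) by (force simp: root_order_def pos_roots_def)
  have inj_snd: "inj_on snd (set ?A)"
    unfolding set using inj by (auto simp: inj_on_def)
  have "distinct (map snd ?A)" using rs(1) inj_snd by (simp add: distinct_map root_order_def)
  moreover have "sorted (rev (map snd ?A))"
    using sorted_wrt_filter[OF rs(2)] by (simp only: sorted_wrt_rev sorted_wrt_map)
  moreover have snd_B: "map snd ?B = map fst (chain_pairs J)" by simp
  moreover have "sorted (rev (map fst (chain_pairs J)))"
    unfolding sorted_wrt_rev by (rule sorted_wrt_mono_rel[OF _ cp(2)]) simp
  moreover have "set (map snd ?A) = set (map snd ?B)" by (simp only: set_map set)
  ultimately have "rev (map snd ?A) = rev (map snd ?B)"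
    using dist by (intro sorted_distinct_set_unique) (simp_all only: set_rev distinct_rev)
  then have "map snd ?A = map snd ?B" by (simp only: rev_is_rev_conv)
  then show ?thesis
    using inj_snd set by (intro map_inj_on[of snd]) auto
qed

definition ugl_e_neg :: "nat \<Rightarrow> (nat \<times> nat) list \<Rightarrow> (nat \<times> nat \<Rightarrow> nat) \<Rightarrow> ugl_prod" where
  "ugl_e_neg m rs \<pi> = prod_list (map (\<lambda>\<alpha>. E_prod m (snd \<alpha>) (fst \<alpha>) ^ \<pi> \<alpha>) rs)"

lemma e_neg_eq: "e_neg m rs \<pi> = ugl_comp m (ugl_e_neg m rs \<pi>)"
  by (simp add: e_neg_def ugl_e_neg_def ugl_comp_prod_list ugl_comp_power E_prod_def ugl_comp_inc_prod
      mat_unit_gl o_def)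

lemma ugl_e_neg_chain_partition:
  assumes "J \<in> index_sets m" "1 \<le> m"
    and "root_order m rs" "sorted_wrt (\<lambda>\<alpha> \<beta>. snd \<beta> \<le> snd \<alpha>) rs"
  shows "ugl_e_neg m rs (chain_partition J) = gl_elements.path_prod (E_prod m) J"
proof -
  interpret gl_elements m "E_prod m" scal_prod by (rule gl_elements_E_prod)
  show ?thesis
    unfolding ugl_e_neg_def chain_partition_def prod_list_map_filter filter_roots_chain_pairs[OF assms]
    by (simp add: path_prod_def o_def split_def)
qed

section \<open>Membership in the enveloping algebras of subalgebras\<close>

definition subring_pullback :: "nat \<Rightarrow> complex mat set \<Rightarrow> ugl_prod set" where
  "subring_pullback m S = {f. ugl_comp m f \<in> Ugl_sub m S}"

lemma subring_pullback_closed: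
  assumes "S \<subseteq> gl m"
  shows "1 \<in> subring_pullback m S" "scal_prod c \<in> subring_pullback m S"
    "\<And>A. A \<in> S \<Longrightarrow> inc_prod m A \<in> subring_pullback m S"
    "\<And>f g. f \<in> subring_pullback m S \<Longrightarrow> g \<in> subring_pullback m S \<Longrightarrow> f + g \<in> subring_pullback m S"
    "\<And>f g. f \<in> subring_pullback m S \<Longrightarrow> g \<in> subring_pullback m S \<Longrightarrow> f - g \<in> subring_pullback m S"
    "\<And>f g. f \<in> subring_pullback m S \<Longrightarrow> g \<in> subring_pullback m S \<Longrightarrow> f * g \<in> subring_pullback m S"
proof -
  interpret R: ring "Ugl m" by (rule ring_Ugl)
  note c = ugl_comp_simps and g = generate_ring.intros
  show "1 \<in> subring_pullback m S" "scal_prod c \<in> subring_pullback m S"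
    by (auto simp: subring_pullback_def Ugl_sub_def c intro: g)
  show "inc_prod m A \<in> subring_pullback m S" if "A \<in> S" for A
  proof -
    have "ugl_comp m (inc_prod m A) = ugl_inc m A" using that assms ugl_comp_inc_prod by blast
    then show ?thesis using that by (auto simp: subring_pullback_def Ugl_sub_def intro: g)
  qed
  show "f + g \<in> subring_pullback m S" "f - g \<in> subring_pullback m S" "f * g \<in> subring_pullback m S"
    if "f \<in> subring_pullback m S" "g \<in> subring_pullback m S" for f g
    using that by (auto simp: subring_pullback_def Ugl_sub_def c R.minus_eq intro: g)
qed

context
  fixes m :: nat
  assumes m: "2 \<le> m"
begin

interpretation gl_elements m "E_prod m" scal_prod by (rule gl_elements_E_prod)

lemma a_elt_subring:
  assumes S: "S \<subseteq> gl m" "\<And>i. mat_unit m i i \<in> S"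
  shows "a_elt x \<in> subring_pullback m S"
proof -
  note c = subring_pullback_closed[OF S(1)]
  have "E_prod m 1 1 - E_prod m x x + scal_prod (of_nat x) - scal_prod (of_nat 2) \<in> subring_pullback m S"
    unfolding E_prod_def by (intro c S)
  then show ?thesis unfolding scal_prod_of_nat by (simp add: a_elt_def)
qed

lemma prod_list_subring:
  assumes "S \<subseteq> gl m" "set fs \<subseteq> subring_pullback m S"
  shows "prod_list fs \<in> subring_pullback m S"
  using assms(2) subring_pullback_closed(1,6)[OF assms(1)] by (induction fs) auto

lemma gap_prod_subring: "gap_prod m J \<in> subring_pullback m (cartan m)"
proof -
  have "cartan m \<subseteq> gl m" using cartan_gl by blast
  then show ?thesis unfolding gap_prod_def
    by (intro prod_list_subring) (auto intro: a_elt_subring mat_unit_cartan)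
qed

lemma T_subring:
  assumes S: "S \<subseteq> gl m" "\<And>i j. j \<le> i \<Longrightarrow> mat_unit m i j \<in> S"
  shows "1 \<le> x \<Longrightarrow> T x \<in> subring_pullback m S"
proof (induction x rule: less_induct)
  case (less x)
  note c = subring_pullback_closed[OF S(1)]
  show ?case
  proof (cases "x = 1")
    case True
    then show ?thesis using T_1 c(1) by simp
  next
    case False
    then have x: "1 < x" using less.prems by simp
    have summand: "E_prod m x y * T y * A_elt y x \<in> subring_pullback m S" if "y \<in> {1..<x}" for y
    proof -
      have "A_elt y x \<in> subring_pullback m S"
        unfolding A_elt_def by (intro prod_list_subring S) (auto intro!: a_elt_subring S)
      moreover have "E_prod m x y \<in> subring_pullback m S"
        unfolding E_prod_def using that by (intro c S) auto
      moreover have "T y \<in> subring_pullback m S" using less.IH that by simp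
      ultimately show ?thesis by (intro c)
    qed
    have sum: "(\<Sum>y\<in>Y. g y) \<in> subring_pullback m S"
      if "\<And>y. y \<in> Y \<Longrightarrow> g y \<in> subring_pullback m S" for g and Y :: "nat set"
      using that c(2)[of 0] by (induction Y rule: infinite_finite_induct) (auto simp: sc_0 intro: c)
    show ?thesis unfolding T_rec[OF x] by (rule sum) (rule summand)
  qed
qed

lemma Theta_b_minus: "Theta m \<in> Ugl_sub m (b_minus m)"
proof -
  have z: "0\<^sub>m m m \<in> cartan m" "0\<^sub>m m m \<in> n_minus m"
    by (auto simp: cartan_def n_minus_def gl_def diagonal_mat_def)
  have "mat_unit m i j \<in> b_minus m" if "j \<le> i" for i j
  proof (cases "i = j")
    case True
    have "mat_unit m i j = mat_unit m i i + 0\<^sub>m m m" using True by (auto simp: mat_unit_def)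
    then show ?thesis using mat_unit_cartan z unfolding b_minus_def by blast
  next
    case False
    have "mat_unit m i j = 0\<^sub>m m m + mat_unit m i j" by (auto simp: mat_unit_def)
    moreover have "mat_unit m i j \<in> n_minus m"
      using that False by (auto simp: n_minus_def mat_unit_def gl_def)
    ultimately show ?thesis using z unfolding b_minus_def by blast
  qed
  moreover have "b_minus m \<subseteq> gl m" by (auto simp: b_minus_def cartan_def n_minus_def gl_def)
  ultimately have "T m \<in> subring_pullback m (b_minus m)" using m by (intro T_subring) auto
  then show ?thesis by (simp add: subring_pullback_def Theta_eq)
qed

lemma Theta_weight: "Ugl_has_weight m (Theta m) (- root_wt m (1, m))"
proof -
  have "weight_eval (- root_wt m (1, m)) h = h $$ (m - 1, m - 1) - h $$ (0, 0)" for h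
  proof -
    have "0\<^sub>v m - root_wt m (1, m) = - root_wt m (1, m)"
      using root_wt_carrier[of m "(1, m)"] by auto
    then show ?thesis
      using weight_eval_diff_root[OF m zero_carrier_vec, of h] by (simp add: weight_eval_def)
  qed
  moreover have "inc_prod m h * T m - T m * inc_prod m h = scal_prod (h $$ (m - 1, m - 1) - h $$ (0, 0)) * T m"
    if "h \<in> cartan m" for h
    using eval_mat_cartan_T[OF that] m inc_prod_eval_mat[OF cartan_gl[OF that]] by simp
  ultimately have "ugl_comp m (inc_prod m h * T m - T m * inc_prod m h)
      = ugl_comp m (scal_prod (weight_eval (- root_wt m (1, m)) h) * T m)" if "h \<in> cartan m" for h
    using that by simp
  then show ?thesis
    by (simp add: Ugl_has_weight_def Theta_eq ugl_comp_simps ugl_comp_inc_prod cartan_gl)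
qed

lemma Theta_partition_expansion:
  assumes rs: "root_order m rs" "sorted_wrt (\<lambda>\<alpha> \<beta>. snd \<beta> \<le> snd \<alpha>) rs"
  shows "\<exists>H. (\<forall>\<pi>\<in>partitions m (1, m). H \<pi> \<in> Ugl_sub m (cartan m)) \<and>
    Theta m = (\<Oplus>\<^bsub>Ugl m\<^esub>\<pi>\<in>partitions m (1, m). e_neg m rs \<pi> \<otimes>\<^bsub>Ugl m\<^esub> H \<pi>) \<and>
    (\<exists>\<pi>0\<in>partitions m (1, m). (\<forall>\<alpha>\<in>pos_roots m - simple_roots m. \<pi>0 \<alpha> = 0) \<and> H \<pi>0 = \<one>\<^bsub>Ugl m\<^esub>)"
proof -
  interpret R: ring "Ugl m" by (rule ring_Ugl)
  have m1: "1 \<le> m" using m by simp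
  \<comment> \<open>The coefficient is 0 at partitions that do not come from a chain, so the sum
    over all partitions collapses to the index sets.\<close>
  define h where "h \<pi> = (if \<pi> \<in> chain_partition ` index_sets m
    then gap_prod m (the_inv_into (index_sets m) chain_partition \<pi>) else 0)" for \<pi>
  have h_chain: "h (chain_partition J) = gap_prod m J" if "J \<in> index_sets m" for J
    using that by (simp add: h_def the_inv_into_f_f[OF inj_on_chain_partition[OF m1]])
  have cartan: "cartan m \<subseteq> gl m" using cartan_gl by blast
  show ?thesis
  proof (intro exI[of _ "\<lambda>\<pi>. ugl_comp m (h \<pi>)"] conjI ballI)
    fix \<pi>
    have "h \<pi> \<in> subring_pullback m (cartan m)"
      using gap_prod_subring subring_pullback_closed(2)[OF cartan, of 0] by (simp add: h_def sc_0)
    then show "ugl_comp m (h \<pi>) \<in> Ugl_sub m (cartan m)" by (simp add: subring_pullback_def)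
  next
    have "(\<Sum>\<pi>\<in>partitions m (1, m). ugl_e_neg m rs \<pi> * h \<pi>)
       = (\<Sum>\<pi>\<in>chain_partition ` index_sets m. ugl_e_neg m rs \<pi> * h \<pi>)"
      using chain_partition_mem[OF _ m1] finite_partitions[OF m1]
      by (intro sum.mono_neutral_right) (auto simp: h_def)
    also have "\<dots> = (\<Sum>J\<in>index_sets m. ugl_e_neg m rs (chain_partition J) * h (chain_partition J))"
      by (simp add: sum.reindex[OF inj_on_chain_partition[OF m1]])
    also have "\<dots> = T m"
      unfolding T_def by (intro sum.cong refl) (simp add: ugl_e_neg_chain_partition[OF _ m1 rs] h_chain)
    finally have "Theta m = ugl_comp m (\<Sum>\<pi>\<in>partitions m (1, m). ugl_e_neg m rs \<pi> * h \<pi>)"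
      by (simp add: Theta_eq)
    then show "Theta m = (\<Oplus>\<^bsub>Ugl m\<^esub>\<pi>\<in>partitions m (1, m). e_neg m rs \<pi> \<otimes>\<^bsub>Ugl m\<^esub> ugl_comp m (h \<pi>))"
      by (simp only: ugl_comp_sum[OF finite_partitions[OF m1]] e_neg_eq ugl_comp_simps(4))
  next
    \<comment> \<open>The full chain uses simple roots only and leaves no gaps, so its coefficient
      is an empty product.\<close>
    have J: "{1..m} \<in> index_sets m" using m by (auto simp: index_sets_def)
    show "\<exists>\<pi>0\<in>partitions m (1, m). (\<forall>\<alpha>\<in>pos_roots m - simple_roots m. \<pi>0 \<alpha> = 0) \<and> ugl_comp m (h \<pi>0) = \<one>\<^bsub>Ugl m\<^esub>"
    proof (intro bexI[of _ "chain_partition {1..m}"] conjI ballI)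
      show "chain_partition {1..m} \<in> partitions m (1, m)" by (rule chain_partition_mem[OF J m1])
      show "ugl_comp m (h (chain_partition {1..m})) = \<one>\<^bsub>Ugl m\<^esub>"
        unfolding h_chain[OF J] by (simp add: gap_prod_def ugl_comp_simps)
      fix \<alpha> assume "\<alpha> \<in> pos_roots m - simple_roots m"
      then have "snd \<alpha> \<noteq> Suc (fst \<alpha>)" by (cases \<alpha>) (auto simp: pos_roots_def simple_roots_def)
      then show "chain_partition {1..m} \<alpha> = 0"
        using chain_pairs_interval[OF m1] by (auto simp: chain_partition_def)
    qed
  qed
qed

text \<open>The congruence for simple roots is applied to the sum of two left ideals: one contains
  n^+, the other contains \<open>a_elt m\<close> and with it the term
  \<open>T (m - 1) * a_elt m\<close> of the last simple root.\<close>

lemma Theta_raising: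
  assumes "\<alpha> \<in> pos_roots m"
  shows "ugl_inc m (mat_unit m (fst \<alpha>) (snd \<alpha>)) \<otimes>\<^bsub>Ugl m\<^esub> Theta m
    \<in> left_ideal m {ugl_inc m (h_elt (root_wt m (1, m))) \<oplus>\<^bsub>Ugl m\<^esub>
        ugl_scal m (weight_eval (rho m) (h_elt (root_wt m (1, m))) - (root_wt m (1, m) \<bullet> root_wt m (1, m)) / 2)}
      <+>\<^bsub>Ugl m\<^esub> left_ideal m (ugl_inc m ` n_plus m)"
proof -
  interpret R: ring "Ugl m" by (rule ring_Ugl)
  have idx: "1 \<in> {1..m}" "m \<in> {1..m}" using m by auto
  have "weight_eval (rho m) (h_elt (root_wt m (1, m))) = rho m \<bullet> root_wt m (1, m)"
    using h_elt_props(2)[OF root_wt_carrier rho_carrier] comm_scalar_prod[OF rho_carrier root_wt_carrier] by simp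
  moreover have "root_wt m (1, m) \<bullet> root_wt m (1, m) = 2"
    using m by (simp add: scalar_prod_root_wt[OF root_wt_carrier idx, simplified] root_wt_index)
  \<comment> \<open>As (eta, eta)/2 = 1, the generator in the Shapovalov condition is
    \<open>hk m (m - 1)\<close>.\<close>
  ultimately have x0: "ugl_inc m (h_elt (root_wt m (1, m))) \<oplus>\<^bsub>Ugl m\<^esub>
        ugl_scal m (weight_eval (rho m) (h_elt (root_wt m (1, m))) - (root_wt m (1, m) \<bullet> root_wt m (1, m)) / 2)
      = ugl_comp m (a_elt m)"
    using hk_eq[of "m - 1" m] m by (simp add: hk_def)
  define I1 where "I1 = left_ideal m {ugl_comp m (a_elt m)}"
  define I2 where "I2 = left_ideal m (ugl_inc m ` n_plus m)"
  have S: "{ugl_comp m (a_elt m)} \<subseteq> carrier (Ugl m)" "ugl_inc m ` n_plus m \<subseteq> carrier (Ugl m)"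
    using ugl_comp_closed ugl_inc_carrier n_plus_gl by auto
  define L1 where "L1 = {f. ugl_comp m f \<in> I1}"
  define L2 where "L2 = {f. ugl_comp m f \<in> I2}"
  have L: "left_ideal_set L1" "left_ideal_set L2"
    unfolding L1_def L2_def I1_def I2_def by (intro left_ideal_pullback S)+
  define L where "L = {f + g | f g. f \<in> L1 \<and> g \<in> L2}"
  have "left_ideal_set L"
    unfolding left_ideal_set_def
  proof (intro conjI ballI allI)
    show "0 \<in> L"
      unfolding L_def using left_ideal_setD(1)[OF L(1)] left_ideal_setD(1)[OF L(2)] by force
  next
    fix x y assume "x \<in> L" "y \<in> L"
    then obtain f g f' g' where *: "x = f + g" "y = f' + g'" "f \<in> L1" "g \<in> L2" "f' \<in> L1" "g' \<in> L2"
      by (auto simp: L_def)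
    have "x + y = (f + f') + (g + g')" by (simp add: *)
    then show "x + y \<in> L"
      unfolding L_def using left_ideal_setD(2)[OF L(1) *(3,5)] left_ideal_setD(2)[OF L(2) *(4,6)] by blast
  next
    fix u x assume "x \<in> L"
    then obtain f g where *: "x = f + g" "f \<in> L1" "g \<in> L2" by (auto simp: L_def)
    have "u * x = u * f + u * g" by (simp add: * distrib_left)
    then show "u * x \<in> L"
      unfolding L_def using left_ideal_setD(3)[OF L(1) *(2)] left_ideal_setD(3)[OF L(2) *(3)] by blast
  qed
  moreover have "E_prod m i j \<in> L" if "i < j" for i j
  proof -
    have "E_prod m i j \<in> L2"
      using left_ideal_props(2)[OF S(2)] mat_unit_n_plus[OF that]
      by (auto simp: L2_def I2_def E_prod_def ugl_comp_inc_prod mat_unit_gl)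
    moreover have "E_prod m i j = 0 + E_prod m i j" by simp
    ultimately show ?thesis unfolding L_def using left_ideal_setD(1)[OF L(1)] by blast
  qed
  moreover have "a_elt m \<in> L"
  proof -
    have "a_elt m \<in> L1" using left_ideal_props(2)[OF S(1)] by (auto simp: L1_def I1_def)
    moreover have "a_elt m = a_elt m + 0" by simp
    ultimately show ?thesis unfolding L_def using left_ideal_setD(1)[OF L(2)] by blast
  qed
  ultimately have simple: "E_prod m k (Suc k) * T m \<in> L" if "1 \<le> k" "k < m" for k
    using that by (intro simple_root_Theta[OF m]) auto
  have "E_prod m (fst \<alpha>) (snd \<alpha>) * T m \<in> L"
    using assms by (intro pos_root_mult_mem[OF \<open>left_ideal_set L\<close> simple]) (auto simp: pos_roots_def)
  then obtain f g where fg: "E_prod m (fst \<alpha>) (snd \<alpha>) * T m = f + g" "f \<in> L1" "g \<in> L2"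
    by (auto simp: L_def)
  have "ugl_inc m (mat_unit m (fst \<alpha>) (snd \<alpha>)) \<otimes>\<^bsub>Ugl m\<^esub> Theta m
      = ugl_comp m (E_prod m (fst \<alpha>) (snd \<alpha>) * T m)"
    by (simp add: Theta_eq ugl_comp_simps E_prod_def ugl_comp_inc_prod mat_unit_gl)
  also have "\<dots> = ugl_comp m f \<oplus>\<^bsub>Ugl m\<^esub> ugl_comp m g" by (simp add: fg ugl_comp_simps)
  also have "\<dots> \<in> I1 <+>\<^bsub>Ugl m\<^esub> I2"
    using fg(2,3) by (auto simp: L1_def L2_def set_add_def' )
  finally show ?thesis unfolding x0 I1_def I2_def .
qed

lemma Theta_shapovalov:
  assumes "root_order m rs" "sorted_wrt (\<lambda>\<alpha> \<beta>. snd \<beta> \<le> snd \<alpha>) rs"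
  shows "shapovalov m rs (1, m) (Theta m)"
  unfolding shapovalov_def
  using Theta_b_minus Theta_weight Theta_partition_expansion[OF assms] Theta_raising by blast

end

theorem theorem2p3:
  fixes m :: nat
  assumes "m \<ge> 2"
  shows
    "(\<forall>lam\<in>carrier_vec m. \<forall>v. highest_weight_vector m lam lam v \<longrightarrow>
        (\<forall>k. 1 \<le> k \<and> k \<le> m - 2 \<longrightarrow>
           verma_act m lam (ugl_inc m (mat_unit m k (k + 1))) (verma_act m lam (Theta m) v) = verma_ideal m lam) \<and>
        ((lam + rho m) \<bullet> root_wt m (1, m) = 1 \<longrightarrow>
           (\<exists>\<mu>\<in>carrier_vec m. highest_weight_vector m lam \<mu> (verma_act m lam (Theta m) v))))
     \<and> (\<forall>rs. root_order m rs \<and> sorted_wrt (\<lambda>\<alpha> \<beta>. snd \<beta> \<le> snd \<alpha>) rs \<longrightarrow>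
          shapovalov m rs (1, m) (Theta m))"
proof (intro conjI ballI allI impI)
  fix lam v assume lam: "lam \<in> carrier_vec m" and v: "highest_weight_vector m lam lam v"
  show "verma_act m lam (ugl_inc m (mat_unit m k (k + 1))) (verma_act m lam (Theta m) v) = verma_ideal m lam"
    if "1 \<le> k \<and> k \<le> m - 2" for k
    using simple_root_Theta_verma[OF assms lam v] that by blast
  show "\<exists>\<mu>\<in>carrier_vec m. highest_weight_vector m lam \<mu> (verma_act m lam (Theta m) v)"
    if "(lam + rho m) \<bullet> root_wt m (1, m) = 1"
    using Theta_highest_weight_vector[OF assms lam v that]
    by (rule bexI) (rule minus_carrier_vec[OF lam root_wt_carrier])
next
  fix rs assume "root_order m rs \<and> sorted_wrt (\<lambda>\<alpha> \<beta>. snd \<beta> \<le> snd \<alpha>) rs"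
  then show "shapovalov m rs (1, m) (Theta m)" using Theta_shapovalov[OF assms] by blast
qed

end
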